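(* Let $S$ be a finite relative simplicial complex. Then its first barycentric subdivision $\mathrm{Sd}(S)$ carries a Morse shelling, and there is a finite sequence of stellar subdivisions, each at a facet of the current complex, after which the resulting complex carries a shellable $h$-tiling. The same holds true using stellar subdivisions at ridges instead, or using sequences mixing stellar subdivisions at facets and at ridges. Finally, when the dimension of $S$ is bounded, both the sequence of subdivisions and the shelling can be produced by an algorithm whose running time is quadratic in the number of facets of $S$.
   Context: A relative simplex is a simplex (its underlying simplex) deprived of some of its proper faces; its dimension is that of its underlying simplex. A ridge of an $n$-simplex is an $(n-1)$-dimensional face. A basic tile of dimension $n$ and order $k\in\{0,\dots,n+1\}$ is an $n$-simplex deprived of $k$ ridges; it has a unique face of least dimension $k-1$. A critical tile of dimension $n$ and index $k\in\{0,\dots,n\}$ is a basic tile of order $k$ deprived moreover of this $(k-1)$-dimensional face. A Morse tile of dimension $n$ and order $k$ is an $n$-simplex deprived of $k$ ridges together with possibly one further face of codimension at least two not contained in the removed ridges. A finite relative simplicial complex $S=K\setminus L$ consists of a finite simplicial complex $K$ and a subcomplex $L$ containing no maximal simplex of $K$; $|S|=|K|\setminus|L|$. Its facets are the maximal simplices of $K$; its ridges are faces of $K$ of codimension one in every facet containing them. A tiling of $S$ is a partition of $|S|$ into relative simplices whose underlying simplices belong to $K$ such that for every $d\ge0$ the union of tiles of dimension $>d$ is closed in $|S|$; it is shellable if its tiles admit an ordering $T_1,\dots,T_N$ (a shelling) with each $T_1\cup\dots\cup T_p$ closed in $|S|$. An $h$-tiling (resp. Morse tiling) is a tiling all of whose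 tiles are basic or critical tiles (resp. Morse tiles); a Morse shelling is a shelling of a Morse tiling. For a simplicial complex $K$ and a nonempty face $\tau$, the stellar subdivision $\mathrm{st}_\tau(K)$ is obtained by removing all simplices containing $\tau$ and adding a new vertex $\hat\tau$ and all cones $\hat\tau*\rho$, $\rho$ ranging over faces not containing $\tau$ of simplices containing $\tau$; for $S=K\setminus L$, $\mathrm{st}_\tau(S)=\mathrm{st}_\tau(K)\setminus\mathrm{st}_\tau(L)$ with $\mathrm{st}_\tau(L)=L$ if $\tau\notin L$. The barycentric subdivision is $\mathrm{Sd}(S)=\mathrm{Sd}(K)\setminus\mathrm{Sd}(L)$, where $\mathrm{Sd}(K)$ is the complex of chains $\sigma_0\subsetneq\dots\subsetneq\sigma_q$ of nonempty simplices of $K$. *)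

theory Defs
  imports "HOL-Analysis.Analysis" "HOL-Library.Infinite_Typeclass" "HOL-Library.Disjoint_Sets"
begin

section \<open>Finite relative simplicial complexes\<close>

text \<open>Complexes are abstract; a simplex is its finite vertex set. The empty simplex belongs to every
  nonvoid complex, and the void complex \<open>{}\<close> is allowed. The pair \<open>K\<close>, \<open>L\<close> stands for
  \<open>S = K \ L\<close>.\<close>

definition simplicial_complex :: "'v set set \<Rightarrow> bool" where
  "simplicial_complex K \<longleftrightarrow>
     finite K \<and> (\<forall>\<sigma>\<in>K. finite \<sigma>) \<and> (\<forall>\<sigma>\<in>K. \<forall>\<rho>. \<rho> \<subseteq> \<sigma> \<longrightarrow> \<rho> \<in> K)"

definition facets :: "'v set set \<Rightarrow> 'v set set" where
  "facets K = {\<sigma> \<in> K. \<forall>\<rho>\<in>K. \<sigma> \<subseteq> \<rho> \<longrightarrow> \<rho> = \<sigma>}"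

definition ridges :: "'v set set \<Rightarrow> 'v set set" where
  "ridges K = {\<tau> \<in> K. \<forall>\<sigma>\<in>facets K. \<tau> \<subseteq> \<sigma> \<longrightarrow> card \<sigma> = card \<tau> + 1}"

definition relative_complex :: "'v set set \<Rightarrow> 'v set set \<Rightarrow> bool" where
  "relative_complex K L \<longleftrightarrow>
     simplicial_complex K \<and> simplicial_complex L \<and> L \<subseteq> K \<and> L \<inter> facets K = {}"

text \<open>Geometric realization by barycentric coordinates, as a subspace of the product space
  \<^typ>\<open>'v \<Rightarrow> real\<close>.\<close>

definition simplex_realization :: "'v set \<Rightarrow> ('v \<Rightarrow> real) set" where
  "simplex_realization \<sigma> = {x. (\<forall>v. 0 \<le> x v) \<and> (\<forall>v. v \<notin> \<sigma> \<longrightarrow> x v = 0) \<and> (\<Sum>v\<in>\<sigma>. x v) = 1}"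

definition complex_realization :: "'v set set \<Rightarrow> ('v \<Rightarrow> real) set" where
  "complex_realization K = (\<Union>\<sigma>\<in>K. simplex_realization \<sigma>)"

definition relative_realization :: "'v set set \<Rightarrow> 'v set set \<Rightarrow> ('v \<Rightarrow> real) set" where
  "relative_realization K L = complex_realization K - complex_realization L"


section \<open>Tiles, tilings and shellings\<close>

text \<open>A relative simplex is a pair of its underlying simplex and the set of faces it is deprived
  of (each together with its own faces).\<close>

type_synonym 'v tile = "'v set \<times> 'v set set"

definition relative_simplex :: "'v tile \<Rightarrow> bool" where
  "relative_simplex T \<longleftrightarrow> finite (fst T) \<and> fst T \<noteq> {} \<and> (\<forall>\<rho>\<in>snd T. \<rho> \<subset> fst T)"

definition tile_dim :: "'v tile \<Rightarrow> nat" where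
  "tile_dim T = card (fst T) - 1"

definition tile_realization :: "'v tile \<Rightarrow> ('v \<Rightarrow> real) set" where
  "tile_realization T = simplex_realization (fst T) - (\<Union>\<rho>\<in>snd T. simplex_realization \<rho>)"

definition tile_faces :: "'v tile \<Rightarrow> 'v set set" where
  "tile_faces T = {\<rho>. \<rho> \<subseteq> fst T \<and> (\<forall>\<omega>\<in>snd T. \<not> \<rho> \<subseteq> \<omega>)}"

definition basic_tile :: "nat \<Rightarrow> nat \<Rightarrow> 'v tile \<Rightarrow> bool" where
  "basic_tile n k T \<longleftrightarrow>
     card (fst T) = n + 1 \<and> (\<forall>\<rho>\<in>snd T. \<rho> \<subseteq> fst T \<and> card \<rho> = n) \<and> card (snd T) = k"

text \<open>The \<open>(k - 1)\<close>-dimensional face of a basic tile of order \<open>k\<close> is unique; for \<open>k = 0\<close> it is the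
  empty face, so a critical tile of index \<open>0\<close> has the realization of a closed simplex.\<close>

definition critical_tile :: "nat \<Rightarrow> nat \<Rightarrow> 'v tile \<Rightarrow> bool" where
  "critical_tile n k T \<longleftrightarrow>
     k \<le> n \<and>
     (\<exists>R \<mu>. basic_tile n k (fst T, R) \<and> \<mu> \<in> tile_faces (fst T, R) \<and> card \<mu> = k \<and>
            snd T = insert \<mu> R)"

definition morse_tile :: "nat \<Rightarrow> nat \<Rightarrow> 'v tile \<Rightarrow> bool" where
  "morse_tile n k T \<longleftrightarrow>
     (\<exists>R. basic_tile n k (fst T, R) \<and>
          (snd T = R \<or>
           (\<exists>\<mu>. \<mu> \<in> tile_faces (fst T, R) \<and> card \<mu> + 2 \<le> card (fst T) \<and> snd T = insert \<mu> R)))"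

definition tiling :: "'v set set \<Rightarrow> 'v set set \<Rightarrow> 'v tile set \<Rightarrow> bool" where
  "tiling K L \<T> \<longleftrightarrow>
     (\<forall>T\<in>\<T>. relative_simplex T \<and> fst T \<in> K) \<and>
     disjoint_family_on tile_realization \<T> \<and>
     (\<Union>T\<in>\<T>. tile_realization T) = relative_realization K L \<and>
     (\<forall>d. closedin (top_of_set (relative_realization K L))
            (\<Union>T\<in>{T\<in>\<T>. tile_dim T > d}. tile_realization T))"

definition shelling :: "'v set set \<Rightarrow> 'v set set \<Rightarrow> 'v tile list \<Rightarrow> bool" where
  "shelling K L Ts \<longleftrightarrow>
     distinct Ts \<and> tiling K L (set Ts) \<and>
     (\<forall>p\<le>length Ts. closedin (top_of_set (relative_realization K L))
            (\<Union>T\<in>set (take p Ts). tile_realization T))"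

definition h_shelling :: "'v set set \<Rightarrow> 'v set set \<Rightarrow> 'v tile list \<Rightarrow> bool" where
  "h_shelling K L Ts \<longleftrightarrow>
     shelling K L Ts \<and> (\<forall>T\<in>set Ts. \<exists>n k. basic_tile n k T \<or> critical_tile n k T)"

definition morse_shelling :: "'v set set \<Rightarrow> 'v set set \<Rightarrow> 'v tile list \<Rightarrow> bool" where
  "morse_shelling K L Ts \<longleftrightarrow> shelling K L Ts \<and> (\<forall>T\<in>set Ts. \<exists>n k. morse_tile n k T)"


section \<open>Subdivisions\<close>

text \<open>The side condition on the empty chain makes the subdivision of the void complex void.\<close>

definition Sd :: "'v set set \<Rightarrow> 'v set set set" where
  "Sd K = {c. c \<subseteq> K - {{}} \<and> (\<forall>\<sigma>\<in>c. \<forall>\<rho>\<in>c. \<sigma> \<subseteq> \<rho> \<or> \<rho> \<subseteq> \<sigma>) \<and> (c = {} \<longrightarrow> {} \<in> K)}"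

text \<open>Stellar subdivision at \<open>\<tau>\<close> with new vertex \<open>w\<close>; the faces \<open>\<rho>\<close> of a cone are among the simplices
  that are kept.\<close>

definition stellar :: "'v set \<Rightarrow> 'v \<Rightarrow> 'v set set \<Rightarrow> 'v set set" where
  "stellar \<tau> w K =
     (if \<tau> \<in> K
      then {\<sigma> \<in> K. \<not> \<tau> \<subseteq> \<sigma>} \<union> {insert w \<rho> |\<rho>. \<exists>\<sigma>\<in>K. \<tau> \<subseteq> \<sigma> \<and> \<rho> \<subseteq> \<sigma> \<and> \<not> \<tau> \<subseteq> \<rho>}
      else K)"

definition stellar_seq :: "('v set \<times> 'v) list \<Rightarrow> 'v set set \<Rightarrow> 'v set set" where
  "stellar_seq steps K = fold (\<lambda>(\<tau>, w). stellar \<tau> w) steps K"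

datatype site = Facet | Ridge

fun sites :: "site \<Rightarrow> 'v set set \<Rightarrow> 'v set set" where
  "sites Facet K = facets K - {{}}"
| "sites Ridge K = ridges K - {{}}"

fun valid_steps :: "'v set set \<Rightarrow> site list \<Rightarrow> ('v set \<times> 'v) list \<Rightarrow> bool" where
  "valid_steps K [] [] \<longleftrightarrow> True"
| "valid_steps K (s # ss) ((\<tau>, w) # steps) \<longleftrightarrow>
     \<tau> \<in> sites s K \<and> w \<notin> \<Union>K \<and> valid_steps (stellar \<tau> w K) ss steps"
| "valid_steps K _ _ \<longleftrightarrow> False"

text \<open>A mixed sequence uses both kinds of sites, except on a complex of dimension at most \<open>0\<close>, which has
  no nonempty ridge.\<close>

datatype mode = At_Facets | At_Ridges | Mixed

fun site_pattern :: "mode \<Rightarrow> 'v set set \<Rightarrow> site list \<Rightarrow> bool" where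
  "site_pattern At_Facets K ss \<longleftrightarrow> set ss \<subseteq> {Facet}"
| "site_pattern At_Ridges K ss \<longleftrightarrow> set ss \<subseteq> {Ridge}"
| "site_pattern Mixed K ss \<longleftrightarrow> ((\<exists>\<sigma>\<in>K. card \<sigma> \<ge> 2) \<longrightarrow> set ss = {Facet, Ridge})"

definition subdivision_seq :: "mode \<Rightarrow> 'v set set \<Rightarrow> ('v set \<times> 'v) list \<Rightarrow> bool" where
  "subdivision_seq m K steps \<longleftrightarrow> (\<exists>ss. site_pattern m K ss \<and> valid_steps K ss steps)"


section \<open>Algorithms and their running time\<close>

text \<open>The machine model is a first-order functional language on binary trees with unit-cost
  operations, in the style of N. D. Jones' language F, whose leaves are natural numbers (vertex
  names). A program is a list of unary functions given by their bodies; its entry point is function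
  \<open>0\<close>. Numbers can only be compared and incremented. Ill-typed primitives return \<open>Num 0\<close>, which also
  encodes the empty list. The last argument of the evaluation relation is the running time.\<close>

datatype val = Num nat | Cell val val

datatype exp =
    Arg | Const nat | Succ exp | Less exp exp | Same exp exp
  | MkCell exp exp | First exp | Second exp | IsCell exp
  | IfNZ exp exp exp | Call nat exp

fun v_succ :: "val \<Rightarrow> val" where
  "v_succ (Num m) = Num (Suc m)"
| "v_succ _ = Num 0"

fun v_less :: "val \<Rightarrow> val \<Rightarrow> val" where
  "v_less (Num m) (Num n) = Num (if m < n then 1 else 0)"
| "v_less _ _ = Num 0"

fun v_same :: "val \<Rightarrow> val \<Rightarrow> val" where
  "v_same (Num m) (Num n) = Num (if m = n then 1 else 0)"
| "v_same _ _ = Num 0"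

fun v_first :: "val \<Rightarrow> val" where
  "v_first (Cell a b) = a"
| "v_first _ = Num 0"

fun v_second :: "val \<Rightarrow> val" where
  "v_second (Cell a b) = b"
| "v_second _ = Num 0"

fun v_iscell :: "val \<Rightarrow> val" where
  "v_iscell (Cell a b) = Num 1"
| "v_iscell _ = Num 0"

inductive eval_exp :: "exp list \<Rightarrow> val \<Rightarrow> exp \<Rightarrow> val \<Rightarrow> nat \<Rightarrow> bool" for P where
  "eval_exp P a Arg a 1"
| "eval_exp P a (Const m) (Num m) 1"
| "eval_exp P a e v t \<Longrightarrow> eval_exp P a (Succ e) (v_succ v) (t + 1)"
| "eval_exp P a e v t \<Longrightarrow> eval_exp P a e' v' t' \<Longrightarrow>
     eval_exp P a (Less e e') (v_less v v') (t + t' + 1)"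
| "eval_exp P a e v t \<Longrightarrow> eval_exp P a e' v' t' \<Longrightarrow>
     eval_exp P a (Same e e') (v_same v v') (t + t' + 1)"
| "eval_exp P a e v t \<Longrightarrow> eval_exp P a e' v' t' \<Longrightarrow>
     eval_exp P a (MkCell e e') (Cell v v') (t + t' + 1)"
| "eval_exp P a e v t \<Longrightarrow> eval_exp P a (First e) (v_first v) (t + 1)"
| "eval_exp P a e v t \<Longrightarrow> eval_exp P a (Second e) (v_second v) (t + 1)"
| "eval_exp P a e v t \<Longrightarrow> eval_exp P a (IsCell e) (v_iscell v) (t + 1)"
| "eval_exp P a e v t \<Longrightarrow> v \<noteq> Num 0 \<Longrightarrow> eval_exp P a e1 v' t' \<Longrightarrow>
     eval_exp P a (IfNZ e e1 e2) v' (t + t' + 1)"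
| "eval_exp P a e (Num 0) t \<Longrightarrow> eval_exp P a e2 v' t' \<Longrightarrow>
     eval_exp P a (IfNZ e e1 e2) v' (t + t' + 1)"
| "eval_exp P a e v t \<Longrightarrow> f < length P \<Longrightarrow> eval_exp P v (P ! f) v' t' \<Longrightarrow>
     eval_exp P a (Call f e) v' (t + t' + 1)"

definition runs :: "exp list \<Rightarrow> val \<Rightarrow> val \<Rightarrow> nat \<Rightarrow> bool" where
  "runs P inp out t \<longleftrightarrow> P \<noteq> [] \<and> eval_exp P inp (P ! 0) out t"

fun enc_list :: "('a \<Rightarrow> val) \<Rightarrow> 'a list \<Rightarrow> val" where
  "enc_list e [] = Num 0"
| "enc_list e (x # xs) = Cell (e x) (enc_list e xs)"

fun enc_pair :: "('a \<Rightarrow> val) \<Rightarrow> ('b \<Rightarrow> val) \<Rightarrow> 'a \<times> 'b \<Rightarrow> val" where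
  "enc_pair e e' (x, y) = Cell (e x) (e' y)"

text \<open>A complex is presented to an algorithm by any duplicate-free list of its facets, each of which is
  given by any duplicate-free list of its vertices.\<close>

definition presents :: "nat list list \<Rightarrow> nat set set \<Rightarrow> bool" where
  "presents xs K \<longleftrightarrow>
     distinct (map set xs) \<and> set (map set xs) = facets K \<and> (\<forall>x\<in>set xs. distinct x)"

abbreviation enc_simplex :: "nat list \<Rightarrow> val" where
  "enc_simplex \<equiv> enc_list Num"

abbreviation enc_complex :: "nat list list \<Rightarrow> val" where
  "enc_complex \<equiv> enc_list enc_simplex"

text \<open>On output simplices are lists of vertices as well, and a tile is a pair of a simplex and a list of
  removed faces. A vertex of the barycentric subdivision is itself a simplex, that is, a list.\<close>

definition enc_steps :: "(nat list \<times> nat) list \<Rightarrow> val" where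
  "enc_steps = enc_list (enc_pair enc_simplex Num)"

definition steps_of :: "(nat list \<times> nat) list \<Rightarrow> (nat set \<times> nat) list" where
  "steps_of = map (\<lambda>(xs, w). (set xs, w))"

definition enc_tiles :: "('a \<Rightarrow> val) \<Rightarrow> ('a list \<times> 'a list list) list \<Rightarrow> val" where
  "enc_tiles e = enc_list (enc_pair (enc_list e) (enc_list (enc_list e)))"

definition tiles_of :: "('a \<Rightarrow> 'v) \<Rightarrow> ('a list \<times> 'a list list) list \<Rightarrow> 'v tile list" where
  "tiles_of r = map (\<lambda>(xs, F). (r ` set xs, (\<lambda>ys. r ` set ys) ` set F))"

text \<open>Some program solves the given problem on all relative complexes of dimension at most \<open>d\<close>, within
  time quadratic in the number of facets (the summand \<open>1\<close> only matters for the void complex, which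
  has none).\<close>

definition quadratic_time_solvable ::
    "nat \<Rightarrow> (nat set set \<Rightarrow> nat set set \<Rightarrow> val \<Rightarrow> bool) \<Rightarrow> bool" where
  "quadratic_time_solvable d solution \<longleftrightarrow>
     (\<exists>P C. \<forall>K L xs ys.
        relative_complex K L \<and> (\<forall>\<sigma>\<in>K. card \<sigma> \<le> d + 1) \<and> presents xs K \<and> presents ys L \<longrightarrow>
        (\<exists>out t. runs P (Cell (enc_complex xs) (enc_complex ys)) out t \<and>
                 t \<le> C * ((card (facets K))\<^sup>2 + 1) \<and> solution K L out))"

end

theory Submission
  imports Defs
begin

text \<open>Ordering the facets of \<open>K\<close> by decreasing dimension and depriving each of them of its faces in \<open>L\<close>
  and in the earlier facets cuts \<open>S\<close> into pieces, whose prefixes are closed.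

  In \<open>Sd(S)\<close> the flags of each piece are put in lexicographic order. A flag then meets the earlier flags
  in the ridges obtained by omitting a descent, and the removed faces of the piece contribute at most one
  further face, namely the chain of all removed members of the flag; so its tile is a Morse tile.

  Stellar subdivision of a piece at itself or at a ridge that is not removed replaces it by pieces, one
  for each vertex of the site. A suitable order of the vertices makes every new piece less bad, where a
  piece that is not bad is a basic or critical tile, and the badness is the number of those
  removed faces that contain all vertices opposite to removed ridges. A round subdivides once near every
  bad piece. In bounded dimension boundedly many rounds leave no bad piece, and each of them multiplies
  the number of pieces by a bounded factor, so that only linearly many subdivisions occur, each of
  which takes linear time.\<close>

section \<open>Combinatorial criterion for shellings\<close>

text \<open>The overview does not say why subdividing for the sake of one piece never harms another.
  A ridge that a piece keeps lies in no earlier piece; every other piece containing it therefore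
  comes later, has it removed, and so has a tight vertex opposite to it. At such a site the children
  become less bad too, which is what \<open>good_site\<close> records. As the site is not a simplex
  of \<open>L\<close>, no face of \<open>L\<close> contains it, and \<open>L\<close> survives all
  subdivisions unchanged. Surplus vertices are the right obstruction because a removed face outside
  all removed ridges must contain every tight vertex, while a critical tile allows only the face
  spanned by exactly these. Greedy selection keeps the sites of a round apart: every bad piece
  contains a selected site, and no selected piece contains the site of another one. The running time
  also rests on \<open>normal\<close>. It lists the removed faces anew as subsets of the piece
  itself, so that a piece has bounded size although it may meet unboundedly many others.\<close>

definition supp :: "('v \<Rightarrow> real) \<Rightarrow> 'v set" where
  "supp x = {v. x v \<noteq> 0}"

definition bary :: "('v \<Rightarrow> real) \<Rightarrow> bool" where
  "bary x \<longleftrightarrow> (\<forall>v. 0 \<le> x v) \<and> finite (supp x) \<and> sum x (supp x) = 1"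

lemma bary_supp_nonempty: "bary x \<Longrightarrow> supp x \<noteq> {}"
  by (auto simp: bary_def)

text \<open>Coordinates outside the support vanish, so the sum over \<open>\<sigma>\<close> is the
  sum over the support. Membership depends on the support alone, which turns the later geometry into
  combinatorics of supports.\<close>

lemma in_simplex_realization:
  assumes "finite \<sigma>"
  shows "x \<in> simplex_realization \<sigma> \<longleftrightarrow> bary x \<and> supp x \<subseteq> \<sigma>"
proof -
  have "(\<forall>v. v \<notin> \<sigma> \<longrightarrow> x v = 0) \<longleftrightarrow> supp x \<subseteq> \<sigma>"
    by (auto simp: supp_def)
  moreover have "sum x \<sigma> = sum x (supp x)" if "supp x \<subseteq> \<sigma>"
    using that assms by (intro sum.mono_neutral_right) (auto simp: supp_def)
  ultimately show ?thesis
    using assms by (auto simp: simplex_realization_def bary_def intro: finite_subset)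
qed

lemma in_complex_realization:
  assumes "simplicial_complex K"
  shows "x \<in> complex_realization K \<longleftrightarrow> bary x \<and> supp x \<in> K"
  using assms unfolding complex_realization_def simplicial_complex_def
  by (auto simp: in_simplex_realization)

text \<open>Coordinates are continuous in the product topology, and closed conditions may be
  intersected over all vertices.\<close>

lemma closed_simplex_realization: "closed (simplex_realization \<sigma>)"
proof -
  have "simplex_realization \<sigma> =
      {x. \<forall>v. 0 \<le> x v} \<inter> {x. \<forall>v. v \<notin> \<sigma> \<longrightarrow> x v = 0} \<inter> {x. (\<Sum>v\<in>\<sigma>. x v) = 1}"
    by (auto simp: simplex_realization_def)
  moreover have "closed {x :: 'a \<Rightarrow> real. \<forall>v. 0 \<le> x v}"
    by (intro closed_Collect_all closed_Collect_le continuous_intros continuous_on_product_coordinates)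
  moreover have "closed {x :: 'a \<Rightarrow> real. \<forall>v. v \<notin> \<sigma> \<longrightarrow> x v = 0}"
    by (intro closed_Collect_all closed_Collect_imp closed_Collect_eq continuous_intros
        continuous_on_product_coordinates) auto
  moreover have "closed {x :: 'a \<Rightarrow> real. (\<Sum>v\<in>\<sigma>. x v) = 1}"
    by (intro closed_Collect_eq continuous_intros continuous_on_product_coordinates)
  ultimately show ?thesis
    by auto
qed

text \<open>\<open>A\<close> stands for the faces already used, by the removed subcomplex or by
  earlier tiles. The empty face is exempt, being the support of no point.\<close>

fun shelled :: "('v set \<Rightarrow> bool) \<Rightarrow> 'v tile list \<Rightarrow> bool" where
  "shelled A [] \<longleftrightarrow> True"
| "shelled A (T # Ts) \<longleftrightarrow>
     relative_simplex T \<and>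
     (\<forall>F. F \<noteq> {} \<and> F \<subseteq> fst T \<longrightarrow> ((\<exists>\<omega>\<in>snd T. F \<subseteq> \<omega>) \<longleftrightarrow> A F)) \<and>
     shelled (\<lambda>F. A F \<or> F \<subseteq> fst T) Ts"

lemma shelled_cong:
  assumes "\<And>F T. T \<in> set Ts \<Longrightarrow> F \<noteq> {} \<Longrightarrow> F \<subseteq> fst T \<Longrightarrow> A F \<longleftrightarrow> B F"
  shows "shelled A Ts \<longleftrightarrow> shelled B Ts"
  using assms
proof (induction Ts arbitrary: A B)
  case (Cons T Ts)
  have 1: "shelled (\<lambda>F. A F \<or> F \<subseteq> fst T) Ts \<longleftrightarrow> shelled (\<lambda>F. B F \<or> F \<subseteq> fst T) Ts"
    by (rule Cons.IH) (metis Cons.prems list.set_intros(2))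
  have 2: "A F \<longleftrightarrow> B F" if "F \<noteq> {}" "F \<subseteq> fst T" for F
    by (metis Cons.prems list.set_intros(1) that)
  show ?case
    unfolding shelled.simps 1 by (metis (no_types) 2)
qed simp

lemma shelled_append:
  "shelled A (Ts @ Us) \<longleftrightarrow> shelled A Ts \<and> shelled (\<lambda>F. A F \<or> (\<exists>T\<in>set Ts. F \<subseteq> fst T)) Us"
  by (induction Ts arbitrary: A) (simp_all add: disj_assoc)

lemma in_tile_realization:
  assumes "relative_simplex T"
  shows "x \<in> tile_realization T \<longleftrightarrow>
    bary x \<and> supp x \<subseteq> fst T \<and> \<not> (\<exists>\<omega>\<in>snd T. supp x \<subseteq> \<omega>)"
proof -
  have "finite \<omega>" if "\<omega> \<in> snd T" for \<omega>
    using assms that by (meson finite_subset psubset_imp_subset relative_simplex_def)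
  then show ?thesis
    using assms by (auto simp: tile_realization_def in_simplex_realization relative_simplex_def)
qed

lemma shelled_relative_simplex: "shelled A Ts \<Longrightarrow> T \<in> set Ts \<Longrightarrow> relative_simplex T"
  by (induction Ts arbitrary: A) auto

lemma shelled_Union:
  "shelled A Ts \<Longrightarrow>
    (\<Union>T\<in>set Ts. tile_realization T) =
      {x. bary x \<and> \<not> A (supp x) \<and> (\<exists>T\<in>set Ts. supp x \<subseteq> fst T)}"
proof (induction Ts arbitrary: A)
  case (Cons T Ts)
  have rs: "relative_simplex T" and "shelled (\<lambda>F. A F \<or> F \<subseteq> fst T) Ts"
    and A: "\<And>F. F \<noteq> {} \<Longrightarrow> F \<subseteq> fst T \<Longrightarrow> (\<exists>\<omega>\<in>snd T. F \<subseteq> \<omega>) \<longleftrightarrow> A F"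
    using Cons.prems by auto
  note IH = Cons.IH[OF this(2)]
  have "x \<in> tile_realization T \<longleftrightarrow> bary x \<and> \<not> A (supp x) \<and> supp x \<subseteq> fst T" for x
    using A[of "supp x"] bary_supp_nonempty[of x] in_tile_realization[OF rs] by blast
  then show ?case
    using IH by auto
qed simp

text \<open>Removed faces are proper, so none of them contains the top face; hence the top face
  cannot have been used before.\<close>

lemma shelled_avoids: "shelled A Ts \<Longrightarrow> T \<in> set Ts \<Longrightarrow> \<not> A (fst T)"
proof (induction Ts arbitrary: A)
  case (Cons S Ts)
  show ?case
  proof (cases "T = S")
    case True
    then have "relative_simplex T" "fst T \<noteq> {} \<Longrightarrow> (\<exists>\<omega>\<in>snd T. fst T \<subseteq> \<omega>) \<longleftrightarrow> A (fst T)"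
      using Cons.prems by auto
    then show ?thesis
      unfolding relative_simplex_def by blast
  next
    case False
    then show ?thesis
      using Cons.IH[of "\<lambda>F. A F \<or> F \<subseteq> fst S"] Cons.prems by auto
  qed
qed simp

lemma shelled_distinct: "shelled A Ts \<Longrightarrow> distinct Ts"
proof (induction Ts arbitrary: A)
  case (Cons T Ts)
  then show ?case
    using shelled_avoids[of "\<lambda>F. A F \<or> F \<subseteq> fst T" Ts T] by auto
qed simp

lemma shelled_disjoint: "shelled A Ts \<Longrightarrow> disjoint_family_on tile_realization (set Ts)"
proof (induction Ts arbitrary: A)
  case (Cons T Ts)
  let ?B = "\<lambda>F. A F \<or> F \<subseteq> fst T"
  have rs: "relative_simplex T" and B: "shelled ?B Ts"
    using Cons.prems by auto
  have "T \<notin> set Ts"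
    using shelled_distinct[OF Cons.prems] by simp
  moreover have "tile_realization T \<inter> (\<Union>S\<in>set Ts. tile_realization S) = {}"
    using shelled_Union[OF B] by (auto simp: in_tile_realization[OF rs])
  ultimately show ?case
    using Cons.IH[OF B] by (simp add: disjoint_family_on_insert)
qed (simp add: disjoint_family_on_def)

text \<open>Meant for the predicate that the dimension exceeds \<open>d\<close>: in decreasing
  order, the tiles of large dimension form an initial segment.\<close>

lemma antimono_filter_eq_takeWhile:
  assumes "sorted_wrt (\<lambda>a b. P b \<longrightarrow> P a) xs"
  shows "filter P xs = takeWhile P xs"
  using assms by (induction xs) (auto simp: filter_empty_conv)

text \<open>Closedness of an initial segment comes for free: within the relative realization it
  fills the union of its finitely many closed simplices, since a face missing from a tile is missing
  altogether or filled by an earlier tile. Decreasing dimension reduces the last condition of a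
  tiling to initial segments.\<close>

theorem shelling_if_shelled:
  assumes K: "simplicial_complex K" and L: "simplicial_complex L"
    and Ts: "shelled (\<lambda>F. F \<in> L) Ts"
    and cover: "\<And>F. F \<noteq> {} \<Longrightarrow> F \<in> K \<longleftrightarrow> F \<in> L \<or> (\<exists>T\<in>set Ts. F \<subseteq> fst T)"
    and sorted: "sorted_wrt (\<lambda>T T'. card (fst T') \<le> card (fst T)) Ts"
  shows "shelling K L Ts"
proof -
  let ?S = "relative_realization K L"
  have S: "?S = {x. bary x \<and> supp x \<notin> L \<and> (\<exists>T\<in>set Ts. supp x \<subseteq> fst T)}"
    unfolding relative_realization_def
    using cover[OF bary_supp_nonempty]
    by (intro set_eqI) (simp add: in_complex_realization[OF K] in_complex_realization[OF L], blast)
  have closed: "closedin (top_of_set ?S) (\<Union>T\<in>set (take p Ts). tile_realization T)" for p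
  proof -
    have sh: "shelled (\<lambda>F. F \<in> L) (take p Ts)"
      using Ts shelled_append[of _ "take p Ts" "drop p Ts"] by simp
    have "x \<in> (\<Union>T\<in>set (take p Ts). tile_realization T) \<longleftrightarrow>
        x \<in> ?S \<inter> (\<Union>T\<in>set (take p Ts). simplex_realization (fst T))" for x
    proof -
      have "x \<in> simplex_realization (fst T) \<longleftrightarrow> bary x \<and> supp x \<subseteq> fst T" if "T \<in> set (take p Ts)" for T
        using shelled_relative_simplex[OF sh that]
        by (simp add: relative_simplex_def in_simplex_realization)
      then have "x \<in> (\<Union>T\<in>set (take p Ts). simplex_realization (fst T)) \<longleftrightarrow>
          bary x \<and> (\<exists>T\<in>set (take p Ts). supp x \<subseteq> fst T)"
        by auto
      then show ?thesis
        unfolding S shelled_Union[OF sh] using set_take_subset[of p Ts] by blast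
    qed
    then have "(\<Union>T\<in>set (take p Ts). tile_realization T) =
        ?S \<inter> (\<Union>T\<in>set (take p Ts). simplex_realization (fst T))"
      by blast
    then show ?thesis
      by (metis (no_types, lifting) closed_UN closed_simplex_realization closedin_closed_Int
          List.finite_set)
  qed
  have dims: "closedin (top_of_set ?S) (\<Union>T\<in>{T \<in> set Ts. tile_dim T > d}. tile_realization T)" for d
  proof -
    have "sorted_wrt (\<lambda>a b. tile_dim b > d \<longrightarrow> tile_dim a > d) Ts"
      by (rule sorted_wrt_mono_rel[OF _ sorted]) (auto simp: tile_dim_def)
    then have "{T \<in> set Ts. tile_dim T > d} = set (takeWhile (\<lambda>T. tile_dim T > d) Ts)"
      by (metis antimono_filter_eq_takeWhile set_filter)
    then show ?thesis
      using closed by (metis takeWhile_eq_take)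
  qed
  have "relative_simplex T \<and> fst T \<in> K" if "T \<in> set Ts" for T
    using shelled_relative_simplex[OF Ts that] cover[of "fst T"] that
    by (auto simp: relative_simplex_def)
  then show ?thesis
    unfolding shelling_def tiling_def
    using shelled_distinct[OF Ts] shelled_disjoint[OF Ts] closed dims
    by (auto simp: S shelled_Union[OF Ts])
qed

section \<open>Complexes given by lists\<close>

text \<open>A piece consists of a facet and of a list of proper faces which generate its intersection with
  everything that precedes it.\<close>

type_synonym 'v piece = "'v list \<times> 'v list list"

text \<open>Membership in the subcomplex generated by \<open>G\<close>. For \<open>G = []\<close> it
  is void, and not even the empty set is covered.\<close>

definition covered :: "'v list list \<Rightarrow> 'v set \<Rightarrow> bool" where
  "covered G F \<longleftrightarrow> (\<exists>g\<in>set G. F \<subseteq> set g)"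

text \<open>The equivalence includes the empty face. For a piece without tight and surplus vertices
  this separates a basic tile of order 0 from a critical tile of index 0.\<close>

definition valid_piece :: "('v set \<Rightarrow> bool) \<Rightarrow> 'v piece \<Rightarrow> bool" where
  "valid_piece A p \<longleftrightarrow>
     distinct (fst p) \<and> fst p \<noteq> [] \<and> \<not> A (set (fst p)) \<and>
     (\<forall>g\<in>set (snd p). set g \<subseteq> set (fst p)) \<and>
     (\<forall>F. F \<subseteq> set (fst p) \<longrightarrow> (covered (snd p) F \<longleftrightarrow> A F))"

fun valid_pieces :: "('v set \<Rightarrow> bool) \<Rightarrow> 'v piece list \<Rightarrow> bool" where
  "valid_pieces A [] \<longleftrightarrow> True"
| "valid_pieces A (p # ps) \<longleftrightarrow>
     valid_piece A p \<and> valid_pieces (\<lambda>F. A F \<or> F \<subseteq> set (fst p)) ps"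

text \<open>Passing to all generated faces of \<open>q\<close> leaves at most
  \<open>2 ^ length q\<close> generators, however long \<open>G\<close> was.\<close>

definition normal :: "'v list \<Rightarrow> 'v list list \<Rightarrow> 'v list list" where
  "normal q G = filter (\<lambda>s. covered G (set s)) (subseqs q)"

lemma covered_mono: "covered G F \<Longrightarrow> E \<subseteq> F \<Longrightarrow> covered G E"
  by (auto simp: covered_def)

lemma normal_subset: "g \<in> set (normal q G) \<Longrightarrow> set g \<subseteq> set q"
  using subseqs_powset[of q] by (auto simp: normal_def)

lemma covered_normal:
  assumes "F \<subseteq> set q"
  shows "covered (normal q G) F \<longleftrightarrow> covered G F"
proof
  assume "covered G F"
  moreover have "F \<in> set ` set (subseqs q)"
    using assms by (simp add: subseqs_powset)
  ultimately show "covered (normal q G) F"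
    by (auto simp: covered_def normal_def)
qed (auto simp: covered_def normal_def)

text \<open>\<open>zs\<close> generates everything used before \<open>x\<close>: at the start it
  lists the facets of \<open>L\<close>, later also the facets already passed.\<close>

fun initial :: "'v list list \<Rightarrow> 'v list list \<Rightarrow> 'v piece list" where
  "initial zs [] = []"
| "initial zs (x # xs) = (x, normal x zs) # initial (x # zs) xs"

lemma fst_initial: "map fst (initial zs xs) = xs"
  by (induction zs xs rule: initial.induct) auto

lemma valid_initial:
  assumes "\<And>F. covered zs F \<longleftrightarrow> A F"
    and "\<And>x. x \<in> set xs \<Longrightarrow> distinct x \<and> x \<noteq> [] \<and> \<not> A (set x)"
    and "sorted_wrt (\<lambda>x y. \<not> set y \<subseteq> set x) xs"
  shows "valid_pieces A (initial zs xs)"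
  using assms
proof (induction zs xs arbitrary: A rule: initial.induct)
  case (2 zs x xs)
  have "valid_piece A (x, normal x zs)"
    using 2(2) 2(3)[of x] normal_subset[of _ x zs] by (auto simp: valid_piece_def covered_normal)
  moreover have "valid_pieces (\<lambda>F. A F \<or> F \<subseteq> set x) (initial (x # zs) xs)"
    by (rule 2(1)) (use 2(2-) in \<open>auto simp: covered_def\<close>)
  ultimately show ?case
    by simp
qed simp

text \<open>A bucket sort with one linear pass per length. Lengths start at 1, which drops the facet
  \<open>{}\<close> of the complex \<open>{{}}\<close>.\<close>

definition by_dim :: "nat \<Rightarrow> 'v list list \<Rightarrow> 'v list list" where
  "by_dim d xs = concat (map (\<lambda>c. filter (\<lambda>x. length x = c) xs) (rev [1..<Suc (Suc d)]))"

lemma set_by_dim: "set (by_dim d xs) = {x \<in> set xs. x \<noteq> [] \<and> length x \<le> Suc d}"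
proof -
  have "set (rev [1..<Suc (Suc d)]) = {1..Suc d}"
    by auto
  then have "set (by_dim d xs) = (\<Union>c\<in>{1..Suc d}. {x \<in> set xs. length x = c})"
    by (simp add: by_dim_def del: upt_Suc set_rev set_upt)
  then show ?thesis
    by (auto simp: Suc_le_eq)
qed

lemma sorted_by_dim: "sorted_wrt (\<lambda>x y. length y \<le> length x) (by_dim d xs)"
proof -
  have "sorted_wrt (\<lambda>x y. length y \<le> length x) (concat (map (\<lambda>c. filter (\<lambda>x. length x = c) xs) cs))"
    if "sorted_wrt (\<lambda>a b. b \<le> a) cs" for cs
    using that
  proof (induction cs)
    case (Cons c cs)
    have "sorted_wrt (\<lambda>x y. length y \<le> length x) (filter (\<lambda>x. length x = c) xs)"
      by (induction xs) auto
    then show ?case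
      using Cons by (auto simp: sorted_wrt_append)
  qed simp
  moreover have "sorted_wrt (\<lambda>a b. b \<le> a) (rev [1..<Suc (Suc d)])"
    by (simp add: sorted_wrt_rev del: upt_Suc)
  ultimately show ?thesis
    unfolding by_dim_def by blast
qed

lemma distinct_map_by_dim: "distinct (map f xs) \<Longrightarrow> distinct (map f (by_dim d xs))"
proof -
  assume xs: "distinct (map f xs)"
  have "distinct (map f (concat (map (\<lambda>c. filter (\<lambda>x. length x = c) xs) cs)))" if "distinct cs" for cs
    using that
  proof (induction cs)
    case (Cons c cs)
    have "inj_on f (set xs)"
      using xs by (simp add: distinct_map)
    then show ?case
      using Cons xs by (auto simp: distinct_map_filter inj_on_eq_iff)
  qed simp
  then show ?thesis
    unfolding by_dim_def by (metis distinct_rev distinct_upt)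
qed

text \<open>The polymorphic form of \<open>presents\<close>, since the existence statement concerns
  any infinite vertex type.\<close>

definition listing :: "'v list list \<Rightarrow> 'v set set \<Rightarrow> bool" where
  "listing xs K \<longleftrightarrow>
     distinct (map set xs) \<and> set (map set xs) = facets K \<and> (\<forall>x\<in>set xs. distinct x)"

lemma exists_listing:
  assumes "simplicial_complex K"
  shows "\<exists>xs. listing xs K"
proof -
  have "finite (facets K)"
    using assms by (auto simp: simplicial_complex_def facets_def)
  then obtain fs where fs: "set fs = facets K" "distinct fs"
    using finite_distinct_list by blast
  have "\<forall>\<sigma>\<in>facets K. \<exists>x. set x = \<sigma> \<and> distinct x"
    using assms by (auto simp: simplicial_complex_def facets_def intro: finite_distinct_list)
  then obtain g where g: "\<And>\<sigma>. \<sigma> \<in> facets K \<Longrightarrow> set (g \<sigma>) = \<sigma> \<and> distinct (g \<sigma>)"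
    by metis
  have "map set (map g fs) = fs"
    using g fs(1) by (auto intro: map_idI)
  then have "listing (map g fs) K"
    using g fs unfolding listing_def by auto
  then show ?thesis ..
qed

lemma in_complex_iff_facet:
  assumes "simplicial_complex K"
  shows "F \<in> K \<longleftrightarrow> (\<exists>\<sigma>\<in>facets K. F \<subseteq> \<sigma>)"
proof
  assume "F \<in> K"
  then obtain m where "m \<in> K" "F \<subseteq> m" "\<forall>b\<in>K. m \<subseteq> b \<longrightarrow> m = b"
    using assms finite_has_maximal2[of K F] by (auto simp: simplicial_complex_def)
  then show "\<exists>\<sigma>\<in>facets K. F \<subseteq> \<sigma>"
    by (auto simp: facets_def)
qed (use assms in \<open>auto simp: simplicial_complex_def facets_def\<close>)

lemma covered_listing:
  assumes "simplicial_complex K" "listing xs K"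
  shows "covered xs F \<longleftrightarrow> F \<in> K"
proof -
  have "F \<in> K \<longleftrightarrow> (\<exists>\<sigma>\<in>set ` set xs. F \<subseteq> \<sigma>)"
    using in_complex_iff_facet[OF assms(1), of F] assms(2) by (simp add: listing_def)
  then show ?thesis
    by (simp add: covered_def)
qed

definition sorted_pieces :: "'v piece list \<Rightarrow> bool" where
  "sorted_pieces ps \<longleftrightarrow> sorted_wrt (\<lambda>p q. length (fst q) \<le> length (fst p)) ps"

text \<open>The empty simplex is exempt: the complex \<open>{{}}\<close> contains it but has no
  pieces.\<close>

definition carries :: "'v set set \<Rightarrow> 'v piece list \<Rightarrow> bool" where
  "carries K ps \<longleftrightarrow> (\<forall>F. F \<noteq> {} \<longrightarrow> (F \<in> K \<longleftrightarrow> (\<exists>p\<in>set ps. F \<subseteq> set (fst p))))"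

lemma initial_pieces:
  assumes KL: "relative_complex K L" and d: "\<And>\<sigma>. \<sigma> \<in> K \<Longrightarrow> card \<sigma> \<le> d + 1"
    and xs: "listing xs K" and ys: "listing ys L"
  defines "ps \<equiv> initial ys (by_dim d xs)"
  shows "valid_pieces (\<lambda>F. F \<in> L) ps" "sorted_pieces ps" "carries K ps"
proof -
  have K: "simplicial_complex K" and L: "simplicial_complex L"
    using KL by (auto simp: relative_complex_def)
  have facet: "set x \<in> facets K" "distinct x" if "x \<in> set xs" for x
    using xs that by (auto simp: listing_def)
  have "length x \<le> Suc d" if "x \<in> set xs" for x
    using facet[OF that] d[of "set x"] by (simp add: facets_def distinct_card)
  then have set_xs: "set (by_dim d xs) = {x \<in> set xs. x \<noteq> []}"
    by (auto simp: set_by_dim)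
  have "sorted_wrt (\<lambda>x y. length y \<le> length x) (map fst ps)"
    unfolding ps_def fst_initial by (rule sorted_by_dim)
  then show "sorted_pieces ps"
    by (simp add: sorted_pieces_def sorted_wrt_map)
  have fst_ps: "fst ` set ps = {x \<in> set xs. x \<noteq> []}"
    unfolding ps_def set_map[symmetric] fst_initial by (rule set_xs)
  have "F \<in> K \<longleftrightarrow> (\<exists>p\<in>set ps. F \<subseteq> set (fst p))" if F: "F \<noteq> {}" for F
  proof -
    have "F \<in> K \<longleftrightarrow> (\<exists>x\<in>fst ` set ps. F \<subseteq> set x)"
      unfolding fst_ps using covered_listing[OF K xs, of F] F by (auto simp: covered_def)
    then show ?thesis
      by auto
  qed
  then show "carries K ps"
    by (auto simp: carries_def)
  have "sorted_wrt (\<lambda>x y. \<not> set y \<subseteq> set x) (by_dim d xs)"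
  proof -
    have "distinct (map set (by_dim d xs))"
      using xs by (simp add: listing_def distinct_map_by_dim)
    then have "sorted_wrt (\<lambda>x y. set x \<noteq> set y) (by_dim d xs)"
      by (simp add: sorted_wrt_iff_nth_less distinct_conv_nth)
    moreover have "\<not> set y \<subseteq> set x" if "x \<in> set xs" "y \<in> set xs" "set x \<noteq> set y" for x y
      using facet(1)[OF that(1)] facet(1)[OF that(2)] that(3) by (auto simp: facets_def)
    ultimately show ?thesis
      by (rule sorted_wrt_mono_rel[rotated]) (simp_all add: set_xs)
  qed
  then show "valid_pieces (\<lambda>F. F \<in> L) ps"
    unfolding ps_def
  proof (intro valid_initial)
    show "distinct x \<and> x \<noteq> [] \<and> set x \<notin> L" if "x \<in> set (by_dim d xs)" for x
      using that facet[of x] KL unfolding set_xs relative_complex_def by blast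
  qed (simp_all add: covered_listing[OF L ys])
qed

section \<open>Barycentric subdivisions\<close>

fun tails :: "'a list \<Rightarrow> 'a list list" where
  "tails [] = []"
| "tails (x # xs) = (x # xs) # tails xs"

text \<open>Each descent contributes the suffix behind it. This is the only member of the flag that
  changes when the two entries are exchanged, and the exchange leads to a lexicographically earlier
  permutation.\<close>

fun descents :: "('a \<Rightarrow> nat) \<Rightarrow> 'a list \<Rightarrow> 'a list list" where
  "descents k (x # y # zs) = (if k y < k x then [y # zs] else []) @ descents k (y # zs)"
| "descents k _ = []"

text \<open>The number \<open>n\<close> only bounds the length. Recursion on it, instead of on the
  list, allows the program for a fixed \<open>n\<close> to be built by iterated composition.\<close>

fun perms :: "nat \<Rightarrow> 'a list \<Rightarrow> 'a list list" where
  "perms 0 xs = [[]]"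
| "perms (Suc n) xs =
     (if xs = [] then [[]] else concat (map (\<lambda>v. map (Cons v) (perms n (removeAll v xs))) xs))"

text \<open>A permutation of a simplex encodes a maximal flag by its nonempty suffixes, from the
  whole simplex down to the last vertex.\<close>

definition flag :: "'a list \<Rightarrow> 'a set set" where
  "flag \<pi> = set ` set (tails \<pi>)"

definition chain :: "'a set set \<Rightarrow> bool" where
  "chain C \<longleftrightarrow> (\<forall>X\<in>C. \<forall>Y\<in>C. X \<subseteq> Y \<or> Y \<subseteq> X)"

lemma flag_Nil [simp]: "flag [] = {}"
  by (simp add: flag_def)

lemma flag_Cons: "flag (x # \<pi>) = insert (insert x (set \<pi>)) (flag \<pi>)"
  by (simp add: flag_def)

lemma flag_subset: "X \<in> flag \<pi> \<Longrightarrow> X \<subseteq> set \<pi>"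
  by (induction \<pi>) (auto simp: flag_Cons)

lemma flag_nonempty: "X \<in> flag \<pi> \<Longrightarrow> X \<noteq> {}"
  by (induction \<pi>) (auto simp: flag_Cons)

lemma chain_flag: "chain (flag \<pi>)"
proof (induction \<pi>)
  case (Cons x \<pi>)
  then show ?case
    using flag_subset[of _ \<pi>] by (fastforce simp: chain_def flag_Cons)
qed (simp add: chain_def)

lemma chain_subset: "chain C \<Longrightarrow> D \<subseteq> C \<Longrightarrow> chain D"
  by (auto simp: chain_def)

lemma finite_flag: "finite (flag \<pi>)"
  by (simp add: flag_def)

lemma card_flag: "distinct \<pi> \<Longrightarrow> card (flag \<pi>) = length \<pi>"
proof (induction \<pi>)
  case (Cons x \<pi>)
  then have "insert x (set \<pi>) \<notin> flag \<pi>"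
    using flag_subset by fastforce
  then show ?case
    using Cons by (simp add: flag_Cons finite_flag)
qed simp

lemma Union_chain: "finite C \<Longrightarrow> C \<noteq> {} \<Longrightarrow> chain C \<Longrightarrow> \<Union>C \<in> C"
proof (induction C rule: finite_ne_induct)
  case (insert X C)
  then have "\<Union>C \<in> C"
    by (auto simp: chain_def)
  then have "X \<subseteq> \<Union>C \<or> \<Union>C \<subseteq> X"
    using insert.prems by (auto simp: chain_def)
  then show ?case
    using \<open>\<Union>C \<in> C\<close> by (metis Union_insert insert_iff sup.absorb1 sup.absorb2)
qed simp

lemma perms_props:
  assumes "distinct \<sigma>" "length \<sigma> \<le> n" "\<pi> \<in> set (perms n \<sigma>)"
  shows "set \<pi> = set \<sigma> \<and> distinct \<pi>"
  using assms
proof (induction n arbitrary: \<sigma> \<pi>)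
  case (Suc n)
  show ?case
  proof (cases "\<sigma> = []")
    case False
    then obtain v \<rho> where v: "v \<in> set \<sigma>" "\<pi> = v # \<rho>" "\<rho> \<in> set (perms n (removeAll v \<sigma>))"
      using Suc.prems by auto
    then have "length (removeAll v \<sigma>) \<le> n"
      using Suc.prems length_removeAll_less[of v \<sigma>] by simp
    then have "set \<rho> = set (removeAll v \<sigma>) \<and> distinct \<rho>"
      using Suc.IH v Suc.prems by (metis distinct_removeAll)
    then show ?thesis
      using v by auto
  qed (use Suc.prems in auto)
qed simp

text \<open>Among the members other than the whole set there is a largest one, and it misses some
  vertex \<open>u\<close>. Putting \<open>u\<close> first leaves a chain in the remaining
  vertices.\<close>

lemma chain_in_perms:
  assumes "distinct \<sigma>" "length \<sigma> \<le> n" "chain C" "\<And>X. X \<in> C \<Longrightarrow> X \<noteq> {} \<and> X \<subseteq> set \<sigma>"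
  shows "\<exists>\<pi>\<in>set (perms n \<sigma>). C \<subseteq> flag \<pi>"
  using assms
proof (induction n arbitrary: \<sigma> C)
  case (Suc n)
  show ?case
  proof (cases "\<sigma> = []")
    case False
    let ?D = "C - {set \<sigma>}"
    have "finite ?D"
      by (rule finite_subset[of _ "Pow (set \<sigma>)"]) (use Suc.prems in auto)
    have "\<exists>u\<in>set \<sigma>. u \<notin> \<Union>?D"
    proof (cases "?D = {}")
      case True
      then show ?thesis
        using False by (cases \<sigma>) auto
    next
      case nonempty: False
      then have "\<Union>?D \<in> ?D"
        using \<open>finite ?D\<close> Suc.prems(3) by (intro Union_chain) (auto simp: chain_def)
      then show ?thesis
        using Suc.prems(4)[of "\<Union>?D"] by blast
    qed
    then obtain u where u: "u \<in> set \<sigma>" "u \<notin> \<Union>?D" by blast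
    have "\<exists>\<pi>\<in>set (perms n (removeAll u \<sigma>)). ?D \<subseteq> flag \<pi>"
    proof (rule Suc.IH)
      show "length (removeAll u \<sigma>) \<le> n"
        using Suc.prems length_removeAll_less[OF u(1)] by simp
      show "chain ?D"
        by (rule chain_subset[OF Suc.prems(3)]) auto
      show "X \<noteq> {} \<and> X \<subseteq> set (removeAll u \<sigma>)" if "X \<in> ?D" for X
      proof -
        have "X \<in> C" "u \<notin> X"
          using that u(2) by auto
        then show ?thesis
          using Suc.prems(4)[OF \<open>X \<in> C\<close>] by auto
      qed
    qed (use Suc.prems in \<open>auto simp: distinct_removeAll\<close>)
    then obtain \<pi> where \<pi>: "\<pi> \<in> set (perms n (removeAll u \<sigma>))" "?D \<subseteq> flag \<pi>" by blast
    have "u # \<pi> \<in> set (perms (Suc n) \<sigma>)"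
      using \<pi> u False by auto
    moreover have "set (u # \<pi>) = set \<sigma>"
      using calculation Suc.prems perms_props by blast
    then have "C \<subseteq> flag (u # \<pi>)"
      using \<pi>(2) by (auto simp: flag_Cons)
    ultimately show ?thesis
      by blast
  qed (use Suc.prems in force)
qed force

lemma descents_in_tails: "s \<in> set (descents k \<pi>) \<Longrightarrow> s \<in> set (tails \<pi>)"
  by (induction k \<pi> rule: descents.induct) (auto split: if_splits)

lemma descents_in_flag: "s \<in> set (descents k \<pi>) \<Longrightarrow> set s \<in> flag \<pi>"
  using descents_in_tails by (auto simp: flag_def)

lemma descents_Cons:
  "descents k (v # \<pi>) = (if \<pi> \<noteq> [] \<and> k (hd \<pi>) < k v then [\<pi>] else []) @ descents k \<pi>"
  by (cases \<pi>) auto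

text \<open>A descent before \<open>u\<close> would put a suffix containing \<open>u\<close> into
  \<open>C\<close>. So the entries ascend up to \<open>u\<close>.\<close>

lemma ascending_upto:
  assumes "inj_on k (set \<pi>)" "u \<in> set \<pi>" "\<forall>s\<in>set (descents k \<pi>). set s \<in> C" "u \<notin> \<Union>C"
  shows "k (hd \<pi>) \<le> k u"
  using assms
proof (induction \<pi>)
  case (Cons x \<pi>)
  show ?case
  proof (cases "u = x")
    case False
    then have u: "u \<in> set \<pi>"
      using Cons.prems by simp
    then have ne: "\<pi> \<noteq> []"
      by auto
    have "k (hd \<pi>) \<le> k u"
      using Cons.IH Cons.prems u by (auto simp: descents_Cons)
    moreover have "\<not> k (hd \<pi>) < k x"
      using Cons.prems u ne by (auto simp: descents_Cons split: if_splits)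
    ultimately show ?thesis
      by simp
  qed simp
qed simp

section \<open>The lexicographic order of the flags\<close>

lemma concat_eq_splitE:
  assumes "concat xss = us @ x # vs"
  obtains as xs bs cs es where "xss = as @ xs # bs" "xs = cs @ x # es" "us = concat as @ cs"
  using assms
proof (induction xss arbitrary: us thesis)
  case (Cons ys xss)
  have "ys @ concat xss = us @ x # vs"
    using Cons.prems by simp
  then consider zs where "ys = us @ x # zs"
    | zs where "us = ys @ zs" "concat xss = zs @ x # vs"
    by (auto simp: append_eq_append_conv2 append_eq_Cons_conv)
  then show ?case
  proof cases
    case 1
    then show ?thesis
      using Cons.prems(1)[of "[]" ys xss us zs] by simp
  next
    case 2
    show ?thesis
      by (rule Cons.IH[OF _ 2(2)]) (use Cons.prems(1)[of "ys # _"] 2(1) in simp)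
  qed
qed simp

lemma inj_if_sorted:
  fixes k :: "'a \<Rightarrow> nat"
  assumes "sorted_wrt (\<lambda>x y. k x < k y) xs"
  shows "inj_on k (set xs)"
  using assms by (induction xs) fastforce+

text \<open>The permutations come in lexicographic order, and exchanging two consecutive entries of a
  permutation changes a single member of its flag. If a chain contains all members of a flag that can be
  exchanged for an earlier one, then no earlier flag contains the chain.\<close>

lemma perms_earlier:
  assumes "distinct \<sigma>" "length \<sigma> \<le> n" "sorted_wrt (\<lambda>x y. k x < k y) \<sigma>"
    and "perms n \<sigma> = us @ \<pi> # vs" "C \<subseteq> flag \<pi>"
  shows "(\<exists>\<pi>'\<in>set us. C \<subseteq> flag \<pi>') \<longleftrightarrow> (\<exists>s\<in>set (descents k \<pi>). set s \<notin> C)"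
  using assms
proof (induction n arbitrary: \<sigma> us \<pi> vs C)
  case 0
  then show ?case
    by (simp add: Cons_eq_append_conv)
next
  case (Suc n)
  show ?case
  proof (cases "\<sigma> = []")
    case True
    then show ?thesis
      using Suc.prems by (simp add: Cons_eq_append_conv)
  next
    case False
    let ?g = "\<lambda>v. map (Cons v) (perms n (removeAll v \<sigma>))"
    have "concat (map ?g \<sigma>) = us @ \<pi> # vs"
      using Suc.prems False by simp
    then obtain as xs bs cs es where as': "map ?g \<sigma> = as @ xs # bs" and
      xs: "xs = cs @ \<pi> # es" and us: "us = concat as @ cs"
      by (rule concat_eq_splitE)
    obtain a v b where \<sigma>: "\<sigma> = a @ v # b" and as: "as = map ?g a" and xs': "xs = ?g v"
      using as' unfolding map_eq_append_conv map_eq_Cons_conv by blast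
    obtain cs' \<rho> es' where split: "perms n (removeAll v \<sigma>) = cs' @ \<rho> # es'"
      and cs: "cs = map (Cons v) cs'" and \<pi>: "\<pi> = v # \<rho>"
      using xs unfolding xs' map_eq_append_conv map_eq_Cons_conv by blast
    have len: "length (removeAll u \<sigma>) \<le> n" if "u \<in> set \<sigma>" for u
      using Suc.prems length_removeAll_less[OF that] by simp
    have dist: "distinct (removeAll u \<sigma>)" for u
      using Suc.prems(1) by (rule distinct_removeAll)
    have v: "v \<in> set \<sigma>"
      by (simp add: \<sigma>)
    have \<rho>: "set \<rho> = set \<sigma> - {v}" "distinct \<rho>"
      using perms_props[OF dist len[OF v], of \<rho>] split by auto
    have top: "set (v # \<rho>) = set \<sigma>"
      using \<rho> v by auto
    \<comment> \<open>The whole simplex belongs to every flag, so only the other members of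
      \<open>C\<close> constrain a permutation.\<close>
    let ?D = "C - {set \<sigma>}"
    have D: "?D \<subseteq> flag \<rho>"
      using Suc.prems \<pi> top by (auto simp: flag_Cons)
    have "sorted_wrt (\<lambda>x y. k x < k y) (removeAll v \<sigma>)"
      using Suc.prems by (simp add: removeAll_filter_not_eq sorted_wrt_filter)
    then have IH: "(\<exists>\<pi>'\<in>set cs'. ?D \<subseteq> flag \<pi>') \<longleftrightarrow> (\<exists>s\<in>set (descents k \<rho>). set s \<notin> ?D)"
      by (intro Suc.IH[OF dist len[OF v] _ split D])
    have ka: "k u < k v" if "u \<in> set a" for u
      using Suc.prems \<sigma> that by (auto simp: sorted_wrt_append)
    have kb: "k v < k u" if "u \<in> set b" for u
      using Suc.prems \<sigma> that by (auto simp: sorted_wrt_append)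
    have inj: "inj_on k (set \<sigma>)"
      by (rule inj_if_sorted[OF Suc.prems(3)])
    \<comment> \<open>The flag of a permutation starting with \<open>u\<close> can contain
      \<open>C\<close> iff \<open>u\<close> avoids all members below the top, as these must occur in
      the flag of the rest.\<close>
    have block: "(\<exists>\<pi>'\<in>set (?g u). C \<subseteq> flag \<pi>') \<longleftrightarrow> u \<notin> \<Union>?D" if u: "u \<in> set \<sigma>" for u
    proof
      assume "\<exists>\<pi>'\<in>set (?g u). C \<subseteq> flag \<pi>'"
      then obtain \<tau> where \<tau>: "\<tau> \<in> set (perms n (removeAll u \<sigma>))" "C \<subseteq> flag (u # \<tau>)"
        by auto
      then have "set \<tau> = set \<sigma> - {u}"
        using perms_props[OF dist len[OF u], of \<tau>] by auto
      then have "?D \<subseteq> flag \<tau>"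
        using \<tau>(2) u by (auto simp: flag_Cons insert_absorb)
      then show "u \<notin> \<Union>?D"
        using flag_subset[of _ \<tau>] \<open>set \<tau> = set \<sigma> - {u}\<close> by blast
    next
      assume nu: "u \<notin> \<Union>?D"
      have "\<exists>\<tau>\<in>set (perms n (removeAll u \<sigma>)). ?D \<subseteq> flag \<tau>"
      proof (rule chain_in_perms[OF dist len[OF u]])
        show "chain ?D"
          using D chain_flag chain_subset by blast
        show "X \<noteq> {} \<and> X \<subseteq> set (removeAll u \<sigma>)" if "X \<in> ?D" for X
        proof -
          have "X \<in> flag \<rho>"
            using that D by blast
          then show ?thesis
            using nu that flag_subset[of X \<rho>] flag_nonempty[of X \<rho>] \<rho>(1) by auto
        qed
      qed
      then obtain \<tau> where \<tau>: "\<tau> \<in> set (perms n (removeAll u \<sigma>))" "?D \<subseteq> flag \<tau>" by blast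
      then have "set (u # \<tau>) = set \<sigma>"
        using perms_props[OF dist len[OF u], of \<tau>] u by auto
      then have "C \<subseteq> flag (u # \<tau>)"
        using \<tau>(2) by (auto simp: flag_Cons)
      then show "\<exists>\<pi>'\<in>set (?g u). C \<subseteq> flag \<pi>'"
        using \<tau>(1) by auto
    qed
    have "(\<exists>\<pi>'\<in>set cs. C \<subseteq> flag \<pi>') \<longleftrightarrow> (\<exists>\<pi>'\<in>set cs'. ?D \<subseteq> flag \<pi>')"
    proof -
      have "C \<subseteq> flag (v # \<tau>) \<longleftrightarrow> ?D \<subseteq> flag \<tau>" if "\<tau> \<in> set cs'" for \<tau>
      proof -
        have "set \<tau> = set \<sigma> - {v}"
          using perms_props[OF dist len[OF v], of \<tau>] split that by auto
        then have "insert v (set \<tau>) = set \<sigma>"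
          using v by auto
        then show ?thesis
          by (auto simp: flag_Cons)
      qed
      then show ?thesis
        by (simp add: cs)
    qed
    moreover have "set us = (\<Union>u\<in>set a. set (?g u)) \<union> set cs"
      unfolding us as by (simp only: set_append set_concat set_map image_image)
    then have "(\<exists>\<pi>'\<in>set us. C \<subseteq> flag \<pi>') \<longleftrightarrow>
        (\<exists>u\<in>set a. \<exists>\<pi>'\<in>set (?g u). C \<subseteq> flag \<pi>') \<or> (\<exists>\<pi>'\<in>set cs. C \<subseteq> flag \<pi>')"
      by (simp only: bex_Un bex_UN)
    moreover have "(\<exists>u\<in>set a. \<exists>\<pi>'\<in>set (?g u). C \<subseteq> flag \<pi>') \<longleftrightarrow> (\<exists>u\<in>set a. u \<notin> \<Union>?D)"
      by (rule bex_cong[OF refl], rule block) (simp add: \<sigma>)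
    ultimately have earlier: "(\<exists>\<pi>'\<in>set us. C \<subseteq> flag \<pi>') \<longleftrightarrow>
        (\<exists>u\<in>set a. u \<notin> \<Union>?D) \<or> (\<exists>s\<in>set (descents k \<rho>). set s \<notin> ?D)"
      by (simp only: IH)
    have desc: "(\<exists>s\<in>set (descents k \<pi>). set s \<notin> C) \<longleftrightarrow>
        (\<rho> \<noteq> [] \<and> k (hd \<rho>) < k v \<and> set \<rho> \<notin> ?D) \<or> (\<exists>s\<in>set (descents k \<rho>). set s \<notin> ?D)"
    proof -
      have "set s \<noteq> set \<sigma>" if "s \<in> set (descents k \<rho>)" for s
        using flag_subset[OF descents_in_flag[OF that]] \<rho> v by auto
      moreover have "set \<rho> \<noteq> set \<sigma>"
        using \<rho> v by auto
      ultimately show ?thesis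
        unfolding \<pi> descents_Cons by auto
    qed
    \<comment> \<open>If the tail misses no descent, the first entry decides: \<open>\<rho>\<close>
      ascends up to any free \<open>u\<close> below \<open>v\<close>, so its head lies below
      \<open>v\<close> as well; conversely, the head of \<open>\<rho>\<close> is itself such a free
      vertex.\<close>
    have "(\<exists>u\<in>set a. u \<notin> \<Union>?D) \<longleftrightarrow> \<rho> \<noteq> [] \<and> k (hd \<rho>) < k v \<and> set \<rho> \<notin> ?D"
      if none: "\<forall>s\<in>set (descents k \<rho>). set s \<in> ?D"
    proof
      assume "\<exists>u\<in>set a. u \<notin> \<Union>?D"
      then obtain u where u: "u \<in> set a" "u \<notin> \<Union>?D" by blast
      then have "u \<in> set \<rho>"
        using \<rho> \<sigma> ka by force
      moreover have "k (hd \<rho>) \<le> k u"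
        using ascending_upto[OF _ \<open>u \<in> set \<rho>\<close> none u(2)] inj \<rho> by (simp add: inj_on_diff)
      ultimately show "\<rho> \<noteq> [] \<and> k (hd \<rho>) < k v \<and> set \<rho> \<notin> ?D"
        using ka[OF u(1)] u(2) by (auto simp: )
    next
      assume h: "\<rho> \<noteq> [] \<and> k (hd \<rho>) < k v \<and> set \<rho> \<notin> ?D"
      then obtain u \<rho>' where \<rho>': "\<rho> = u # \<rho>'"
        by (cases \<rho>) auto
      then have "u \<in> set \<sigma>" "u \<noteq> v"
        using \<rho> by auto
      then have "u \<in> set a"
        using h \<rho>' kb[of u] \<sigma> by auto
      moreover have "u \<notin> \<Union>?D"
        using D h \<rho>' \<rho>(2) flag_subset[of _ \<rho>'] by (auto simp: flag_Cons)
      ultimately show "\<exists>u\<in>set a. u \<notin> \<Union>?D"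
        by blast
    qed
    then show ?thesis
      unfolding earlier desc by blast
  qed
qed

section \<open>The tiles of the barycentric subdivision\<close>

definition position :: "'a list \<Rightarrow> 'a \<Rightarrow> nat" where
  "position xs v = length (takeWhile (\<lambda>y. y \<noteq> v) xs)"

lemma sorted_position: "distinct xs \<Longrightarrow> sorted_wrt (\<lambda>x y. position xs x < position xs y) xs"
proof -
  assume xs: "distinct xs"
  have "position xs (xs ! i) = i" if i: "i < length xs" for i
  proof -
    have "xs = take i xs @ xs ! i # drop (Suc i) xs"
      using i by (rule id_take_nth_drop)
    moreover have "takeWhile (\<lambda>y. y \<noteq> xs ! i) (take i xs @ xs ! i # drop (Suc i) xs) = take i xs"
      using xs i by (subst takeWhile_append2) (auto simp: in_set_conv_nth nth_eq_iff_index_eq)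
    ultimately show ?thesis
      using i by (simp add: position_def)
  qed
  then show ?thesis
    by (simp add: sorted_wrt_iff_nth_less)
qed

text \<open>Suffixes of one permutation are told apart by their lengths. The chain of covered
  members is listed only if it contains all descents; otherwise it already lies in the ridge that
  omits an uncovered descent.\<close>

definition sd_removed :: "'v list list \<Rightarrow> ('v \<Rightarrow> nat) \<Rightarrow> 'v list \<Rightarrow> 'v list list list" where
  "sd_removed G k \<pi> =
     (let R = map (\<lambda>s. filter (\<lambda>t. length t \<noteq> length s) (tails \<pi>)) (descents k \<pi>) in
      if \<exists>s\<in>set (descents k \<pi>). \<not> covered G (set s) then R
      else filter (\<lambda>t. covered G (set t)) (tails \<pi>) # R)"

definition sd_tile :: "'v piece \<Rightarrow> 'v list \<Rightarrow> 'v list list \<times> 'v list list list" where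
  "sd_tile p \<pi> = (tails \<pi>, sd_removed (snd p) (position (fst p)) \<pi>)"

definition sd_tiles ::
    "nat \<Rightarrow> 'v list list \<Rightarrow> 'v list list \<Rightarrow> ('v list list \<times> 'v list list list) list" where
  "sd_tiles d xs ys =
     concat (map (\<lambda>p. map (sd_tile p) (perms (Suc d) (fst p))) (initial ys (by_dim d xs)))"

definition real_tile :: "('a \<Rightarrow> 'v) \<Rightarrow> 'a list \<times> 'a list list \<Rightarrow> 'v tile" where
  "real_tile r T = (r ` set (fst T), (\<lambda>ys. r ` set ys) ` set (snd T))"

lemma tiles_of_eq: "tiles_of r = map (real_tile r)"
  by (auto simp: tiles_of_def real_tile_def fun_eq_iff)

lemma length_eq_if_flag:
  assumes "distinct \<pi>" "s \<in> set (tails \<pi>)" "t \<in> set (tails \<pi>)"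
  shows "length s = length t \<longleftrightarrow> s = t" "set s = set t \<longleftrightarrow> s = t"
proof -
  have "length t < length (x # \<pi>)" if "t \<in> set (tails \<pi>)" for x \<pi> and t :: "'a list"
    using that by (induction \<pi>) auto
  moreover have "distinct t" if "distinct \<pi>" "t \<in> set (tails \<pi>)" for \<pi> and t :: "'a list"
    using that by (induction \<pi>) auto
  ultimately show 1: "length s = length t \<longleftrightarrow> s = t"
    using assms by (induction \<pi>) (auto, (metis length_Cons less_irrefl)+)
  show "set s = set t \<longleftrightarrow> s = t"
    using 1 assms \<open>\<And>t \<pi>. distinct \<pi> \<Longrightarrow> t \<in> set (tails \<pi>) \<Longrightarrow> distinct t\<close> distinct_card by metis
qed

lemma real_sd_tile:
  assumes "distinct \<pi>"
  shows "fst (real_tile set (sd_tile p \<pi>)) = flag \<pi>"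
    and "snd (real_tile set (sd_tile p \<pi>)) =
      (\<lambda>s. flag \<pi> - {set s}) ` set (descents (position (fst p)) \<pi>) \<union>
      (if \<exists>s\<in>set (descents (position (fst p)) \<pi>). \<not> covered (snd p) (set s) then {}
       else {{X \<in> flag \<pi>. covered (snd p) X}})"
proof -
  show "fst (real_tile set (sd_tile p \<pi>)) = flag \<pi>"
    by (simp add: real_tile_def sd_tile_def flag_def)
  have 1: "set ` {t \<in> set (tails \<pi>). length t \<noteq> length s} = flag \<pi> - {set s}"
    if "s \<in> set (descents (position (fst p)) \<pi>)" for s
  proof -
    have "length t \<noteq> length s \<longleftrightarrow> set t \<noteq> set s" if "t \<in> set (tails \<pi>)" for t
      using length_eq_if_flag[OF assms that descents_in_tails[OF \<open>s \<in> _\<close>]] by simp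
    then show ?thesis
      unfolding flag_def by blast
  qed
  have 2: "set ` {t \<in> set (tails \<pi>). covered (snd p) (set t)} = {X \<in> flag \<pi>. covered (snd p) X}"
    by (auto simp: flag_def)
  show "snd (real_tile set (sd_tile p \<pi>)) =
      (\<lambda>s. flag \<pi> - {set s}) ` set (descents (position (fst p)) \<pi>) \<union>
      (if \<exists>s\<in>set (descents (position (fst p)) \<pi>). \<not> covered (snd p) (set s) then {}
       else {{X \<in> flag \<pi>. covered (snd p) X}})"
    by (simp add: real_tile_def sd_tile_def sd_removed_def Let_def image_image 1 2 cong: image_cong)
qed

text \<open>Unfolds the recursion, so that a tile can be checked against an explicit list of
  predecessors.\<close>

lemma shelled_if_splits:
  assumes "\<And>us T vs. Ts = us @ T # vs \<Longrightarrow> relative_simplex T \<and>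
    (\<forall>F. F \<noteq> {} \<and> F \<subseteq> fst T \<longrightarrow> ((\<exists>\<omega>\<in>snd T. F \<subseteq> \<omega>) \<longleftrightarrow> A F \<or> (\<exists>U\<in>set us. F \<subseteq> fst U)))"
  shows "shelled A Ts"
  using assms
proof (induction Ts arbitrary: A)
  case (Cons T Ts)
  have "shelled (\<lambda>F. A F \<or> F \<subseteq> fst T) Ts"
  proof (rule Cons.IH)
    fix us S vs assume "Ts = us @ S # vs"
    then have "T # Ts = (T # us) @ S # vs"
      by simp
    from Cons.prems[OF this] show "relative_simplex S \<and>
      (\<forall>F. F \<noteq> {} \<and> F \<subseteq> fst S \<longrightarrow>
        ((\<exists>\<omega>\<in>snd S. F \<subseteq> \<omega>) \<longleftrightarrow> (A F \<or> F \<subseteq> fst T) \<or> (\<exists>U\<in>set us. F \<subseteq> fst U)))"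
      by (simp add: disj_assoc)
  qed
  then show ?case
    using Cons.prems[of "[]" T Ts] by simp
qed simp

context
  fixes p :: "'v piece" and A :: "'v set \<Rightarrow> bool" and n :: nat
  assumes p: "valid_piece A p" and n: "length (fst p) \<le> n"
begin

lemma uncovered_top: "\<not> covered (snd p) (set (fst p))"
  using p by (auto simp: valid_piece_def)

lemma sd_tile_relative_simplex:
  assumes "\<pi> \<in> set (perms n (fst p))"
  shows "relative_simplex (real_tile set (sd_tile p \<pi>))"
proof -
  have \<pi>: "set \<pi> = set (fst p)" "distinct \<pi>"
    using perms_props[OF _ n assms] p by (auto simp: valid_piece_def)
  then have "\<pi> \<noteq> []"
    using p by (auto simp: valid_piece_def)
  then have top: "set \<pi> \<in> flag \<pi>"
    by (cases \<pi>) (auto simp: flag_Cons)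
  have "\<not> covered (snd p) (set \<pi>)"
    using uncovered_top \<pi> by simp
  then have "\<omega> \<subset> flag \<pi>" if "\<omega> \<in> snd (real_tile set (sd_tile p \<pi>))" for \<omega>
    using that top descents_in_flag[of _ _ \<pi>] unfolding real_sd_tile[OF \<pi>(2)]
    by (auto split: if_splits)
  then show ?thesis
    unfolding relative_simplex_def real_sd_tile(1)[OF \<pi>(2)] using top finite_flag by blast
qed

text \<open>The union of a finite chain is its largest member, so all members of \<open>F\<close>
  are covered iff the union is. If an uncovered descent suppresses the extra face, such an
  \<open>F\<close> misses that descent anyway.\<close>

lemma sd_tile_covers:
  assumes "\<pi> \<in> set (perms n (fst p))" "F \<noteq> {}" "F \<subseteq> flag \<pi>"
  shows "(\<exists>\<omega>\<in>snd (real_tile set (sd_tile p \<pi>)). F \<subseteq> \<omega>) \<longleftrightarrow>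
    covered (snd p) (\<Union>F) \<or> (\<exists>s\<in>set (descents (position (fst p)) \<pi>). set s \<notin> F)"
proof -
  have \<pi>: "set \<pi> = set (fst p)" "distinct \<pi>"
    using perms_props[OF _ n assms(1)] p by (auto simp: valid_piece_def)
  have "\<Union>F \<in> F"
    using assms by (intro Union_chain)
      (auto intro: finite_subset[OF _ finite_flag] chain_subset[OF chain_flag])
  then have "covered (snd p) (\<Union>F) \<longleftrightarrow> (\<forall>X\<in>F. covered (snd p) X)"
    using covered_mono by blast
  then show ?thesis
    unfolding real_sd_tile[OF \<pi>(2)] using assms(3) by auto
qed

text \<open>\<open>B\<close> is \<open>A\<close> carried over to the subdivision: a chain is used
  iff its largest member is.\<close>

lemma shelled_sd_piece:
  assumes "\<And>F. F \<noteq> {} \<Longrightarrow> chain F \<Longrightarrow> {} \<notin> F \<Longrightarrow> \<Union>F \<subseteq> set (fst p) \<Longrightarrow> B F \<longleftrightarrow> A (\<Union>F)"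
  shows "shelled B (map (real_tile set \<circ> sd_tile p) (perms n (fst p)))"
proof (rule shelled_if_splits)
  fix us T vs assume "map (real_tile set \<circ> sd_tile p) (perms n (fst p)) = us @ T # vs"
  then obtain us' \<pi> vs' where split: "perms n (fst p) = us' @ \<pi> # vs'"
    and us: "us = map (real_tile set \<circ> sd_tile p) us'" and T: "T = real_tile set (sd_tile p \<pi>)"
    by (auto simp: map_eq_append_conv map_eq_Cons_conv)
  have dist: "distinct (fst p)"
    using p by (simp add: valid_piece_def)
  have in_perms: "\<rho> \<in> set (perms n (fst p))" if "\<rho> \<in> insert \<pi> (set us')" for \<rho>
    using that split by auto
  then have props: "set \<rho> = set (fst p) \<and> distinct \<rho>" if "\<rho> \<in> insert \<pi> (set us')" for \<rho>
    using that perms_props[OF dist n] by blast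
  have "(\<exists>\<omega>\<in>snd T. F \<subseteq> \<omega>) \<longleftrightarrow> B F \<or> (\<exists>U\<in>set us. F \<subseteq> fst U)" if F: "F \<noteq> {}" "F \<subseteq> fst T" for F
  proof -
    have F': "F \<subseteq> flag \<pi>"
      using F(2) props by (simp add: T real_sd_tile)
    have "(\<exists>U\<in>set us. F \<subseteq> fst U) \<longleftrightarrow> (\<exists>\<rho>\<in>set us'. F \<subseteq> flag \<rho>)"
      using props by (simp add: us real_sd_tile cong: bex_cong)
    also have "\<dots> \<longleftrightarrow> (\<exists>s\<in>set (descents (position (fst p)) \<pi>). set s \<notin> F)"
      by (rule perms_earlier[OF dist n sorted_position[OF dist] split F'])
    finally have 1: "(\<exists>U\<in>set us. F \<subseteq> fst U) \<longleftrightarrow>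
      (\<exists>s\<in>set (descents (position (fst p)) \<pi>). set s \<notin> F)" .
    have "\<Union>F \<subseteq> set (fst p)"
      using F' flag_subset[of _ \<pi>] props[of \<pi>] by blast
    moreover have "{} \<notin> F"
      using F' flag_nonempty by blast
    ultimately have "B F \<longleftrightarrow> covered (snd p) (\<Union>F)"
      using assms[OF F(1) chain_subset[OF chain_flag F']] p by (simp add: valid_piece_def)
    then show ?thesis
      using 1 sd_tile_covers[OF in_perms F(1) F'] by (simp add: T)
  qed
  then show "relative_simplex T \<and>
    (\<forall>F. F \<noteq> {} \<and> F \<subseteq> fst T \<longrightarrow> ((\<exists>\<omega>\<in>snd T. F \<subseteq> \<omega>) \<longleftrightarrow> B F \<or> (\<exists>U\<in>set us. F \<subseteq> fst U)))"
    using sd_tile_relative_simplex[OF in_perms] by (simp add: T)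
qed

lemma morse_tileI_basic: "basic_tile m k T \<Longrightarrow> morse_tile m k T"
  unfolding morse_tile_def by (rule exI[of _ "snd T"]) simp

lemma morse_tileI_face:
  "basic_tile m k (fst T, R) \<Longrightarrow> \<mu> \<in> tile_faces (fst T, R) \<Longrightarrow> card \<mu> + 2 \<le> card (fst T) \<Longrightarrow>
    snd T = insert \<mu> R \<Longrightarrow> morse_tile m k T"
  by (auto simp: morse_tile_def)

text \<open>The extra face contains all descents, hence lies in no removed ridge, and it misses the
  top member because the facet itself is not covered. In codimension one it counts as another
  removed ridge.\<close>

lemma morse_sd_tile:
  assumes "\<pi> \<in> set (perms n (fst p))"
  shows "\<exists>m k. morse_tile m k (real_tile set (sd_tile p \<pi>))"
proof -
  let ?D = "descents (position (fst p)) \<pi>" and ?M = "{X \<in> flag \<pi>. covered (snd p) X}"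
    and ?T = "real_tile set (sd_tile p \<pi>)"
  let ?R = "(\<lambda>s. flag \<pi> - {set s}) ` set ?D"
  have \<pi>: "set \<pi> = set (fst p)" "distinct \<pi>"
    using perms_props[OF _ n assms] p by (auto simp: valid_piece_def)
  then have ne: "\<pi> \<noteq> []"
    using p by (auto simp: valid_piece_def)
  then have top: "set \<pi> \<in> flag \<pi>"
    by (cases \<pi>) (auto simp: flag_Cons)
  have card: "card (flag \<pi>) = length \<pi> - 1 + 1"
    using ne card_flag[OF \<pi>(2)] by (cases \<pi>) auto
  have R: "\<forall>\<rho>\<in>?R. \<rho> \<subseteq> flag \<pi> \<and> card \<rho> = length \<pi> - 1"
    using card descents_in_flag[of _ _ \<pi>] by (auto simp: finite_flag)
  note T = real_sd_tile[OF \<pi>(2), of p]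
  show ?thesis
  proof (cases "\<exists>s\<in>set ?D. \<not> covered (snd p) (set s)")
    case True
    then have "snd ?T = ?R"
      by (simp add: T)
    then have "basic_tile (length \<pi> - 1) (card ?R) ?T"
      using R card by (simp add: basic_tile_def T(1))
    then show ?thesis
      using morse_tileI_basic by blast
  next
    case False
    then have snd: "snd ?T = insert ?M ?R"
      by (simp add: T)
    have "set \<pi> \<notin> ?M"
      using uncovered_top \<pi> by simp
    then have "?M \<subset> flag \<pi>"
      using top by blast
    then have less: "card ?M < card (flag \<pi>)"
      by (rule psubset_card_mono[OF finite_flag])
    show ?thesis
    proof (cases "card ?M + 2 \<le> card (flag \<pi>)")
      case True
      have "basic_tile (length \<pi> - 1) (card ?R) (fst ?T, ?R)"
        using R card by (simp add: basic_tile_def T(1))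
      moreover have "?M \<in> tile_faces (fst ?T, ?R)"
        using False descents_in_flag[of _ _ \<pi>] by (auto simp: tile_faces_def T)
      ultimately show ?thesis
        using True snd unfolding T(1)[symmetric] by (intro exI) (rule morse_tileI_face)
    next
      case M: False
      then have "card ?M = length \<pi> - 1"
        using less card by linarith
      then have "basic_tile (length \<pi> - 1) (card (insert ?M ?R)) ?T"
        using R card by (simp add: basic_tile_def T(1) snd)
      then show ?thesis
        using morse_tileI_basic by blast
    qed
  qed
qed

end

text \<open>The flags of a facet contain exactly the chains of nonempty sets whose union lies in it.
  So after its tiles, a chain is again used iff its union is.\<close>

lemma shelled_sd_pieces:
  assumes "valid_pieces A ps" "\<And>p. p \<in> set ps \<Longrightarrow> length (fst p) \<le> n"
    and "\<And>F. F \<noteq> {} \<Longrightarrow> chain F \<Longrightarrow> {} \<notin> F \<Longrightarrow> B F \<longleftrightarrow> A (\<Union>F)"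
  shows "shelled B (concat (map (\<lambda>p. map (real_tile set \<circ> sd_tile p) (perms n (fst p))) ps))"
  using assms
proof (induction ps arbitrary: A B)
  case (Cons p ps)
  let ?Ts = "map (real_tile set \<circ> sd_tile p) (perms n (fst p))"
  have p: "valid_piece A p" and n: "length (fst p) \<le> n"
    using Cons.prems by auto
  have dist: "distinct (fst p)"
    using p by (simp add: valid_piece_def)
  have "(\<exists>T\<in>set ?Ts. F \<subseteq> fst T) \<longleftrightarrow> \<Union>F \<subseteq> set (fst p)" if "chain F" "{} \<notin> F" for F
  proof -
    have "(\<exists>T\<in>set ?Ts. F \<subseteq> fst T) \<longleftrightarrow> (\<exists>\<pi>\<in>set (perms n (fst p)). F \<subseteq> flag \<pi>)"
      using perms_props[OF dist n] by (simp add: real_sd_tile cong: bex_cong)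
    also have "\<dots> \<longleftrightarrow> \<Union>F \<subseteq> set (fst p)"
    proof
      assume "\<Union>F \<subseteq> set (fst p)"
      then have "X \<noteq> {} \<and> X \<subseteq> set (fst p)" if "X \<in> F" for X
        using \<open>{} \<notin> F\<close> that by blast
      then show "\<exists>\<pi>\<in>set (perms n (fst p)). F \<subseteq> flag \<pi>"
        by (rule chain_in_perms[OF dist n \<open>chain F\<close>])
    next
      assume "\<exists>\<pi>\<in>set (perms n (fst p)). F \<subseteq> flag \<pi>"
      then show "\<Union>F \<subseteq> set (fst p)"
        using perms_props[OF dist n] flag_subset by blast
    qed
    finally show ?thesis .
  qed
  then have "shelled (\<lambda>F. B F \<or> (\<exists>T\<in>set ?Ts. F \<subseteq> fst T))
      (concat (map (\<lambda>p. map (real_tile set \<circ> sd_tile p) (perms n (fst p))) ps))"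
    using Cons.prems by (intro Cons.IH[of "\<lambda>F. A F \<or> F \<subseteq> set (fst p)"]) simp_all
  moreover have "shelled B ?Ts"
    using Cons.prems by (intro shelled_sd_piece[OF p n]) simp
  ultimately show ?case
    by (simp only: list.map concat.simps shelled_append)
qed simp

lemma Sd_iff:
  assumes "F \<noteq> {}"
  shows "F \<in> Sd K \<longleftrightarrow> F \<subseteq> K - {{}} \<and> chain F"
  using assms by (auto simp: Sd_def chain_def)

lemma Sd_iff_Union:
  assumes "simplicial_complex K" "F \<noteq> {}" "chain F" "{} \<notin> F" "finite F"
  shows "F \<in> Sd K \<longleftrightarrow> \<Union>F \<in> K"
proof
  assume "F \<in> Sd K"
  then show "\<Union>F \<in> K"
    using Union_chain[of F] assms by (auto simp: Sd_iff)
next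
  assume "\<Union>F \<in> K"
  then have "X \<in> K" if "X \<in> F" for X
    using assms(1) that unfolding simplicial_complex_def by blast
  then show "F \<in> Sd K"
    using assms by (auto simp: Sd_iff)
qed

lemma simplicial_complex_Sd:
  assumes "simplicial_complex K"
  shows "simplicial_complex (Sd K)"
proof -
  have K: "finite K" "\<And>\<sigma> \<rho>. \<sigma> \<in> K \<Longrightarrow> \<rho> \<subseteq> \<sigma> \<Longrightarrow> \<rho> \<in> K"
    using assms unfolding simplicial_complex_def by auto
  have sub: "c \<subseteq> K" if "c \<in> Sd K" for c
    using that by (auto simp: Sd_def)
  then have "finite (Sd K)"
    using K(1) by (intro finite_subset[of "Sd K" "Pow K"]) auto
  moreover have "finite c" if "c \<in> Sd K" for c
    using sub[OF that] K(1) by (rule finite_subset)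
  moreover have "b \<in> Sd K" if "c \<in> Sd K" "b \<subseteq> c" for b c
  proof -
    have "{} \<in> K"
    proof (cases "c = {}")
      case True
      then show ?thesis
        using that by (simp add: Sd_def)
    next
      case False
      then obtain X where "X \<in> c"
        by blast
      then have "X \<in> K"
        using sub \<open>c \<in> Sd K\<close> by blast
      then show ?thesis
        using K(2)[of X "{}"] by simp
    qed
    moreover have "c \<subseteq> K - {{}}" "chain c"
      using that(1) by (auto simp: Sd_def chain_def)
    then have "b \<subseteq> K - {{}}" "chain b"
      using that(2) chain_subset[of c b] by auto
    ultimately show ?thesis
      by (simp add: Sd_def chain_def)
  qed
  ultimately show ?thesis
    by (simp add: simplicial_complex_def)
qed

lemma sorted_wrt_concat_map:
  fixes m :: "'b \<Rightarrow> nat"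
  assumes "sorted_wrt (\<lambda>a b. l b \<le> l a) ps" "\<And>p y. p \<in> set ps \<Longrightarrow> y \<in> set (g p) \<Longrightarrow> m y = l p"
  shows "sorted_wrt (\<lambda>a b. m b \<le> m a) (concat (map g ps))"
  using assms
proof (induction ps)
  case (Cons p ps)
  have "sorted_wrt (\<lambda>a b. m b \<le> m a) (g p)"
    using Cons.prems(2)[of p] by (simp add: sorted_wrt_iff_nth_less)
  then show ?case
    using Cons by (fastforce simp: sorted_wrt_append)
qed simp

lemma morse_shelling_Sd:
  assumes KL: "relative_complex K L" and d: "\<And>\<sigma>. \<sigma> \<in> K \<Longrightarrow> card \<sigma> \<le> d + 1"
    and xs: "listing xs K" and ys: "listing ys L"
  shows "morse_shelling (Sd K) (Sd L) (tiles_of set (sd_tiles d xs ys))"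
proof -
  define ps where "ps = initial ys (by_dim d xs)"
  have K: "simplicial_complex K" and L: "simplicial_complex L" and "L \<subseteq> K"
    using KL by (auto simp: relative_complex_def)
  note ps = initial_pieces[OF KL d xs ys, folded ps_def]
  define Ts where "Ts = concat (map (\<lambda>p. map (real_tile set \<circ> sd_tile p) (perms (Suc d) (fst p))) ps)"
  have Ts: "tiles_of set (sd_tiles d xs ys) = Ts"
    by (simp add: tiles_of_eq sd_tiles_def Ts_def ps_def map_concat comp_def)
  have valid: "\<exists>A. valid_piece A p" if "p \<in> set ps" for p
  proof -
    have "\<exists>A. valid_piece A p" if "valid_pieces A ps" "p \<in> set ps" for A ps
      using that by (induction ps arbitrary: A) auto
    then show ?thesis
      using ps(1) that by blast
  qed
  have len: "length (fst p) \<le> Suc d" if "p \<in> set ps" for p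
  proof -
    have "set (fst p) \<in> K"
      using ps(3) that valid[OF that] by (auto simp: carries_def valid_piece_def)
    then show ?thesis
      using d[of "set (fst p)"] valid[OF that] by (auto simp: valid_piece_def distinct_card)
  qed
  have \<pi>: "set \<pi> = set (fst p) \<and> distinct \<pi>" if "p \<in> set ps" "\<pi> \<in> set (perms (Suc d) (fst p))" for p \<pi>
    using perms_props[OF _ len[OF that(1)] that(2)] valid[OF that(1)] by (auto simp: valid_piece_def)
  \<comment> \<open>The criterion asks for an equivalence on all chains. The case distinction only
    settles infinite ones, which are faces of no tile and are discarded by
    \<open>shelled_cong\<close>.\<close>
  have "shelled (\<lambda>F. if finite F then F \<in> Sd L else \<Union>F \<in> L) Ts"
    unfolding Ts_def by (rule shelled_sd_pieces[OF ps(1) len]) (auto simp: Sd_iff_Union[OF L])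
  moreover have "finite (fst T)" if "T \<in> set Ts" for T
    using \<pi> that by (auto simp: Ts_def real_sd_tile finite_flag)
  ultimately have "shelled (\<lambda>F. F \<in> Sd L) Ts"
    by (subst (asm) shelled_cong[of _ _ "\<lambda>F. F \<in> Sd L"]) (auto dest: finite_subset[rotated])
  moreover have "F \<in> Sd K \<longleftrightarrow> F \<in> Sd L \<or> (\<exists>T\<in>set Ts. F \<subseteq> fst T)" if F: "F \<noteq> {}" for F
  proof -
    have "(\<exists>T\<in>set Ts. F \<subseteq> fst T) \<longleftrightarrow> (\<exists>p\<in>set ps. \<exists>\<pi>\<in>set (perms (Suc d) (fst p)). F \<subseteq> flag \<pi>)"
      using \<pi> by (simp add: Ts_def real_sd_tile cong: bex_cong)
    also have "\<dots> \<longleftrightarrow> F \<in> Sd K"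
    proof
      assume "\<exists>p\<in>set ps. \<exists>\<pi>\<in>set (perms (Suc d) (fst p)). F \<subseteq> flag \<pi>"
      then obtain p \<pi> where p: "p \<in> set ps" "\<pi> \<in> set (perms (Suc d) (fst p))" "F \<subseteq> flag \<pi>" by blast
      have "X \<in> K" "X \<noteq> {}" if "X \<in> F" for X
      proof -
        have "X \<in> flag \<pi>"
          using p(3) that by blast
        then show "X \<noteq> {}"
          by (rule flag_nonempty)
        then show "X \<in> K"
          using ps(3) p(1) flag_subset[OF \<open>X \<in> flag \<pi>\<close>] \<pi>[OF p(1,2)] unfolding carries_def by blast
      qed
      then show "F \<in> Sd K"
        using F chain_subset[OF chain_flag p(3)] by (auto simp: Sd_iff)
    next
      assume FK: "F \<in> Sd K"
      then have "finite F"
        using simplicial_complex_Sd[OF K] by (simp add: simplicial_complex_def)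
      have F': "chain F" "{} \<notin> F"
        using FK F by (auto simp: Sd_iff)
      have "\<Union>F \<in> F"
        using \<open>finite F\<close> F F' by (intro Union_chain)
      then have "\<Union>F \<in> K" "\<Union>F \<noteq> {}"
        using FK F F' by (auto simp: Sd_iff)
      then obtain p where p: "p \<in> set ps" "\<Union>F \<subseteq> set (fst p)"
        using ps(3) by (auto simp: carries_def)
      have "\<exists>\<pi>\<in>set (perms (Suc d) (fst p)). F \<subseteq> flag \<pi>"
      proof (rule chain_in_perms[OF _ len[OF p(1)] F'(1)])
        show "distinct (fst p)"
          using valid[OF p(1)] by (auto simp: valid_piece_def)
        show "X \<noteq> {} \<and> X \<subseteq> set (fst p)" if "X \<in> F" for X
          using that p(2) F'(2) by blast
      qed
      then show "\<exists>p\<in>set ps. \<exists>\<pi>\<in>set (perms (Suc d) (fst p)). F \<subseteq> flag \<pi>"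
        using p(1) by blast
    qed
    finally show ?thesis
      using \<open>L \<subseteq> K\<close> F by (auto simp: Sd_iff)
  qed
  moreover have "sorted_wrt (\<lambda>T T'. card (fst T') \<le> card (fst T)) Ts"
    unfolding Ts_def
  proof (rule sorted_wrt_concat_map[of "\<lambda>p. length (fst p)"])
    show "sorted_wrt (\<lambda>p q. length (fst q) \<le> length (fst p)) ps"
      using ps(2) by (simp add: sorted_pieces_def)
    show "card (fst T) = length (fst p)"
      if p: "p \<in> set ps" and T: "T \<in> set (map (real_tile set \<circ> sd_tile p) (perms (Suc d) (fst p)))"
      for p T
    proof -
      obtain \<rho> where \<rho>: "\<rho> \<in> set (perms (Suc d) (fst p))" "T = real_tile set (sd_tile p \<rho>)"
        using T by auto
      have "length \<rho> = length (fst p)"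
        using \<pi>[OF p \<rho>(1)] valid[OF p] by (metis distinct_card valid_piece_def)
      then show ?thesis
        using \<pi>[OF p \<rho>(1)] by (simp add: \<rho>(2) real_sd_tile card_flag)
    qed
  qed
  ultimately have "shelling (Sd K) (Sd L) Ts"
    by (intro shelling_if_shelled simplicial_complex_Sd K L)
  moreover have "\<exists>m k. morse_tile m k T" if T: "T \<in> set Ts" for T
  proof -
    obtain p \<rho> where p: "p \<in> set ps" "\<rho> \<in> set (perms (Suc d) (fst p))" "T = real_tile set (sd_tile p \<rho>)"
      using T by (auto simp: Ts_def)
    then show ?thesis
      using morse_sd_tile[OF _ len[OF p(1)] p(2)] valid[OF p(1)] by blast
  qed
  ultimately show ?thesis
    by (simp add: morse_shelling_def Ts)
qed

section \<open>Stellar subdivision of pieces\<close>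

text \<open>The tight vertices are those opposite to the removed ridges. A piece can be made a basic or
  critical tile iff none of its other vertices is surplus.\<close>

definition tight :: "'v piece \<Rightarrow> 'v list" where
  "tight p = filter (\<lambda>v. covered (snd p) (set (removeAll v (fst p)))) (fst p)"

text \<open>Beyond ridges, a critical tile is deprived only of the face spanned by the tight
  vertices. A surplus vertex witnesses a removed face strictly larger than that one.\<close>

definition surplus :: "'v piece \<Rightarrow> 'v list" where
  "surplus p =
     filter (\<lambda>u. u \<notin> set (tight p) \<and> covered (snd p) (set (u # tight p))) (fst p)"

text \<open>At a tight vertex the new vertex becomes tight, which leaves no removed face outside the
  removed ridges; and once these children are passed, the tight vertices of the site stay tight.
  Surplus vertices come next so that each later child loses a face counted by the badness.\<close>

definition order :: "'v list \<Rightarrow> 'v piece \<Rightarrow> 'v list" where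
  "order \<tau> p =
     filter (\<lambda>x. x \<in> set \<tau>)
       (tight p @ surplus p @
        filter (\<lambda>x. x \<notin> set (tight p) \<and> x \<notin> set (surplus p)) (fst p))"

text \<open>The removed part has three sources: old removed faces without \<open>x\<close>; cones
  over old removed faces that contain the site; and ridges shared with the earlier children, whose
  omitted vertices are listed in \<open>e\<close>.\<close>

definition child :: "'v list \<Rightarrow> 'v \<Rightarrow> 'v piece \<Rightarrow> 'v list \<Rightarrow> 'v \<Rightarrow> 'v piece" where
  "child \<tau> w p e x =
     (w # removeAll x (fst p),
      normal (w # removeAll x (fst p))
        (map (removeAll x) (snd p) @
         map (\<lambda>g. w # removeAll x g) (filter (\<lambda>g. set \<tau> \<subseteq> set g) (snd p)) @
         map (\<lambda>y. w # removeAll y (removeAll x (fst p))) e))"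

definition split :: "'v list \<Rightarrow> 'v \<Rightarrow> 'v piece \<Rightarrow> 'v piece list" where
  "split \<tau> w p =
     (if set \<tau> \<subseteq> set (fst p)
      then map (\<lambda>x. child \<tau> w p (takeWhile (\<lambda>y. y \<noteq> x) (order \<tau> p)) x) (order \<tau> p)
      else [p])"

lemma set_tight: "set (tight p) = {v \<in> set (fst p). covered (snd p) (set (fst p) - {v})}"
  by (auto simp: tight_def)

lemma set_surplus:
  "set (surplus p) =
    {u \<in> set (fst p). u \<notin> set (tight p) \<and> covered (snd p) (insert u (set (tight p)))}"
  by (auto simp: surplus_def)

lemma set_order: "set \<tau> \<subseteq> set (fst p) \<Longrightarrow> set (order \<tau> p) = set \<tau>"
  by (auto simp: order_def set_tight set_surplus)

lemma distinct_order: "distinct (fst p) \<Longrightarrow> distinct (order \<tau> p)"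
  by (auto simp: order_def tight_def surplus_def)

lemma fst_child [simp]: "fst (child \<tau> w p e x) = w # removeAll x (fst p)"
  by (simp add: child_def)

lemma set_fst_child: "set (fst (child \<tau> w p e x)) = insert w (set (fst p) - {x})"
  by simp

section \<open>Removed faces of the children\<close>

lemma covered_append: "covered (G @ H) F \<longleftrightarrow> covered G F \<or> covered H F"
  by (auto simp: covered_def)

lemma covered_map: "covered (map f G) F \<longleftrightarrow> (\<exists>g\<in>set G. F \<subseteq> set (f g))"
  by (auto simp: covered_def)

text \<open>A cone comes from a removed face containing the site, so it is removed iff adding the
  site to its base gives a removed face. The last disjunct is the intersection with earlier
  children.\<close>

lemma covered_child:
  assumes w: "w \<notin> set (fst p)" and G: "\<forall>g\<in>set (snd p). set g \<subseteq> set (fst p)"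
    and x: "x \<in> set \<tau>" "x \<in> set (fst p)" and F: "F \<subseteq> insert w (set (fst p) - {x})"
  shows "covered (snd (child \<tau> w p e x)) F \<longleftrightarrow>
    (if w \<in> F then covered (snd p) (F - {w} \<union> set \<tau>) else covered (snd p) F) \<or>
    (\<exists>y\<in>set e. F \<subseteq> insert w (set (fst p) - {y}))"
proof -
  have 1: "covered (snd (child \<tau> w p e x)) F \<longleftrightarrow>
      (\<exists>g\<in>set (snd p). F \<subseteq> set g - {x}) \<or>
      (\<exists>g\<in>set (snd p). set \<tau> \<subseteq> set g \<and> F \<subseteq> insert w (set g - {x})) \<or>
      (\<exists>y\<in>set e. F \<subseteq> insert w (set (fst p) - {x} - {y}))"
    using F unfolding child_def snd_conv
    by (subst covered_normal) (auto simp add: covered_append covered_map Bex_def)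
  have 2: "F \<subseteq> set g - {x} \<longleftrightarrow> w \<notin> F \<and> F \<subseteq> set g" if "g \<in> set (snd p)" for g
    using w G that F x by blast
  have 3: "F \<subseteq> insert w (set g - {x}) \<longleftrightarrow> F - {w} \<subseteq> set g" for g
    using w F x by auto
  have 4: "F \<subseteq> insert w (set (fst p) - {x} - {y}) \<longleftrightarrow> F \<subseteq> insert w (set (fst p) - {y})" for y
    using F by blast
  have "(\<exists>g\<in>set (snd p). F \<subseteq> set g - {x}) \<longleftrightarrow> w \<notin> F \<and> covered (snd p) F"
    using 2 by (auto simp: covered_def)
  moreover have "(\<exists>g\<in>set (snd p). set \<tau> \<subseteq> set g \<and> F \<subseteq> insert w (set g - {x})) \<longleftrightarrow>
      covered (snd p) (F - {w} \<union> set \<tau>)"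
    unfolding 3 covered_def by auto
  moreover have "covered (snd p) (F - {w} \<union> set \<tau>) \<Longrightarrow> w \<notin> F \<Longrightarrow> covered (snd p) F"
    by (rule covered_mono) auto
  ultimately show ?thesis
    unfolding 1 4 by auto
qed

text \<open>A cone \<open>w * \<rho>\<close> belongs to a stellar subdivision at \<open>\<tau>\<close> iff \<open>\<rho> \<union> \<tau>\<close> belongs to the complex.\<close>

definition subdivides :: "'v set \<Rightarrow> 'v \<Rightarrow> ('v set \<Rightarrow> bool) \<Rightarrow> ('v set \<Rightarrow> bool) \<Rightarrow> bool" where
  "subdivides \<tau> w A A' \<longleftrightarrow>
     (\<forall>F. \<not> \<tau> \<subseteq> F \<longrightarrow> (A' F \<longleftrightarrow> (if w \<in> F then A (F - {w} \<union> \<tau>) else A F)))"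

lemma valid_pieces_append:
  "valid_pieces A (ps @ qs) \<longleftrightarrow>
    valid_pieces A ps \<and> valid_pieces (\<lambda>F. A F \<or> (\<exists>p\<in>set ps. F \<subseteq> set (fst p))) qs"
  by (induction ps arbitrary: A) (simp_all add: disj_assoc)

lemma takeWhile_neq_split: "distinct (us @ x # vs) \<Longrightarrow> takeWhile (\<lambda>y. y \<noteq> x) (us @ x # vs) = us"
  by (induction us) auto

text \<open>A child meets each earlier child in the ridge opposite to the vertex omitted there;
  \<open>takeWhile\<close> collects just these vertices.\<close>

lemma valid_split:
  assumes p: "valid_piece A p" and w: "w \<notin> set (fst p)" and \<tau>: "w \<notin> set \<tau>"
    and A: "subdivides (set \<tau>) w A A'"
  shows "valid_pieces A' (split \<tau> w p)"
proof (cases "set \<tau> \<subseteq> set (fst p)")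
  case False
  have "A' F \<longleftrightarrow> A F" if "F \<subseteq> set (fst p)" for F
  proof -
    have "\<not> set \<tau> \<subseteq> F" "w \<notin> F"
      using False that w by auto
    then show ?thesis
      using A by (simp add: subdivides_def)
  qed
  then have "valid_piece A' p"
    using p by (simp add: valid_piece_def)
  then show ?thesis
    using False by (simp add: split_def)
next
  case True
  let ?q = "set (fst p)"
  let ?f = "\<lambda>x. child \<tau> w p (takeWhile (\<lambda>y. y \<noteq> x) (order \<tau> p)) x"
  have dist: "distinct (order \<tau> p)"
    using p by (simp add: distinct_order valid_piece_def)
  have G: "\<forall>g\<in>set (snd p). set g \<subseteq> ?q"
    using p by (simp add: valid_piece_def)
  have "valid_pieces (\<lambda>F. A' F \<or> (\<exists>y\<in>set pre. F \<subseteq> insert w (?q - {y}))) (map ?f xs)"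
    if "order \<tau> p = pre @ xs" for pre xs
    using that
  proof (induction xs arbitrary: pre)
    case (Cons x xs)
    have pre: "takeWhile (\<lambda>y. y \<noteq> x) (order \<tau> p) = pre"
      using dist Cons.prems takeWhile_neq_split by metis
    have x: "x \<in> set \<tau>" "x \<in> ?q" "x \<notin> set pre"
      using Cons.prems set_order[OF True] dist True by auto
    have pre_sub: "y \<in> ?q \<and> y \<noteq> x" if "y \<in> set pre" for y
      using Cons.prems set_order[OF True] True x(3) that by (metis Un_iff set_append subsetD)
    have *: "A' F \<longleftrightarrow> (if w \<in> F then A (F - {w} \<union> set \<tau>) else A F)"
      if "F \<subseteq> insert w (?q - {x})" for F
      using A that x \<tau> unfolding subdivides_def by (metis Diff_iff insert_iff singletonI subsetD)
    let ?B = "\<lambda>F. A' F \<or> (\<exists>y\<in>set pre. F \<subseteq> insert w (?q - {y}))"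
    have "valid_piece ?B (?f x)"
      unfolding valid_piece_def
    proof (intro conjI allI impI ballI)
      have "insert w (?q - {x}) - {w} \<union> set \<tau> = ?q"
        using w x True by auto
      then have "\<not> A' (insert w (?q - {x}))"
        using *[of "insert w (?q - {x})"] p by (simp add: valid_piece_def)
      moreover have "\<not> insert w (?q - {x}) \<subseteq> insert w (?q - {y})" if "y \<in> set pre" for y
        using pre_sub[OF that] w by auto
      ultimately show "\<not> (A' (set (fst (?f x))) \<or>
          (\<exists>y\<in>set pre. set (fst (?f x)) \<subseteq> insert w (?q - {y})))"
        unfolding set_fst_child by blast
      show "distinct (fst (?f x))"
        using p w by (simp add: valid_piece_def distinct_removeAll)
      show "set g \<subseteq> set (fst (?f x))" if "g \<in> set (snd (?f x))" for g
        using that normal_subset[of g "w # removeAll x (fst p)"] by (simp add: child_def)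
      show "covered (snd (?f x)) F \<longleftrightarrow> ?B F" if "F \<subseteq> set (fst (?f x))" for F
      proof -
        have F: "F \<subseteq> insert w (?q - {x})"
          using that by simp
        have "F - {w} \<union> set \<tau> \<subseteq> ?q" "w \<notin> F \<Longrightarrow> F \<subseteq> ?q"
          using F True by auto
        then have "A' F \<longleftrightarrow> (if w \<in> F then covered (snd p) (F - {w} \<union> set \<tau>) else covered (snd p) F)"
          using *[OF F] p unfolding valid_piece_def by simp
        then show ?thesis
          unfolding pre using covered_child[OF w G x(1,2) F, of pre] by blast
      qed
    qed simp
    moreover have "valid_pieces (\<lambda>F. ?B F \<or> F \<subseteq> set (fst (?f x))) (map ?f xs)"
      using Cons.IH[of "pre @ [x]"] Cons.prems by (simp add: bex_Un disj_commute disj_left_commute)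
    ultimately show ?case
      by simp
  qed simp
  from this[of "[]" "order \<tau> p"] show ?thesis
    using True by (simp add: split_def)
qed

text \<open>A face not containing the site misses some vertex \<open>x\<close> of it, and then fits
  into the child omitting \<open>x\<close>.\<close>

lemma subset_split_iff:
  assumes w: "w \<notin> set (fst p)" and "w \<notin> set \<tau>" "\<tau> \<noteq> []" and F: "\<not> set \<tau> \<subseteq> F"
  shows "(\<exists>c\<in>set (split \<tau> w p). F \<subseteq> set (fst c)) \<longleftrightarrow>
    (if w \<in> F then F - {w} \<union> set \<tau> \<subseteq> set (fst p) else F \<subseteq> set (fst p))"
proof (cases "set \<tau> \<subseteq> set (fst p)")
  case True
  have 1: "(\<exists>c\<in>set (split \<tau> w p). F \<subseteq> set (fst c)) \<longleftrightarrow>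
      (\<exists>x\<in>set \<tau>. F \<subseteq> insert w (set (fst p) - {x}))"
    using True by (simp add: split_def set_order)
  obtain x where "x \<in> set \<tau>" "x \<notin> F"
    using F by blast
  then show ?thesis
    unfolding 1 using True w by auto
next
  case False
  then show ?thesis
    using w by (auto simp: split_def)
qed

lemma subdivides_split:
  assumes "w \<notin> set (fst p)" "w \<notin> set \<tau>" "\<tau> \<noteq> []" "subdivides (set \<tau>) w A A'"
  shows "subdivides (set \<tau>) w (\<lambda>F. A F \<or> F \<subseteq> set (fst p))
    (\<lambda>F. A' F \<or> (\<exists>c\<in>set (split \<tau> w p). F \<subseteq> set (fst c)))"
  using assms(4) subset_split_iff[OF assms(1-3)] by (simp add: subdivides_def)

lemma valid_pieces_split:
  assumes "valid_pieces A ps" "\<And>p. p \<in> set ps \<Longrightarrow> w \<notin> set (fst p)" "w \<notin> set \<tau>" "\<tau> \<noteq> []"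
    and "subdivides (set \<tau>) w A A'"
  shows "valid_pieces A' (concat (map (split \<tau> w) ps))"
  using assms
proof (induction ps arbitrary: A A')
  case (Cons p ps)
  have "valid_pieces (\<lambda>F. A' F \<or> (\<exists>c\<in>set (split \<tau> w p). F \<subseteq> set (fst c)))
      (concat (map (split \<tau> w) ps))"
    using Cons.prems by (intro Cons.IH[of "\<lambda>F. A F \<or> F \<subseteq> set (fst p)"] subdivides_split) auto
  moreover have "valid_pieces A' (split \<tau> w p)"
    using Cons.prems by (intro valid_split[of A]) auto
  ultimately show ?case
    by (simp add: valid_pieces_append)
qed simp

text \<open>A child exchanges one vertex for the new one. Hence splitting preserves the order by
  dimension.\<close>

lemma length_split:
  assumes "c \<in> set (split \<tau> w p)" "distinct (fst p)"
  shows "length (fst c) = length (fst p)"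
proof (cases "set \<tau> \<subseteq> set (fst p)")
  case True
  then obtain x where "x \<in> set (fst p)" "fst c = w # removeAll x (fst p)"
    using assms(1) set_order[OF True] by (auto simp: split_def)
  then show ?thesis
    using assms(2) by (simp add: distinct_remove1_removeAll[symmetric] length_remove1)
      (metis One_nat_def Suc_pred length_pos_if_in_set)
next
  case False
  then show ?thesis
    using assms by (simp add: split_def)
qed

lemma valid_pieces_splitD:
  assumes "valid_pieces A (us @ p # vs)"
  shows "valid_piece (\<lambda>F. A F \<or> (\<exists>u\<in>set us. F \<subseteq> set (fst u))) p"
  using assms by (simp add: valid_pieces_append)

lemma valid_pieces_distinct: "valid_pieces A ps \<Longrightarrow> p \<in> set ps \<Longrightarrow> distinct (fst p) \<and> fst p \<noteq> []"
  by (induction ps arbitrary: A) (auto simp: valid_piece_def)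

lemma sorted_pieces_split:
  assumes "valid_pieces A ps" "sorted_pieces ps"
  shows "sorted_pieces (concat (map (split \<tau> w) ps))"
  using assms(2) valid_pieces_distinct[OF assms(1)] unfolding sorted_pieces_def
  by (intro sorted_wrt_concat_map[of "\<lambda>p. length (fst p)"]) (auto intro: length_split)

text \<open>Faces containing the site vanish on both sides. Any other face is traced back to the old
  complex, by replacing the new vertex with the site if it is a cone.\<close>

lemma carries_split:
  assumes ps: "carries K ps" and "set \<tau> \<in> K" "\<tau> \<noteq> []" and w: "w \<notin> \<Union>K"
    and K: "simplicial_complex K"
  shows "carries (stellar (set \<tau>) w K) (concat (map (split \<tau> w) ps))"
  unfolding carries_def
proof (intro allI impI)
  fix F :: "'a set" assume F: "F \<noteq> {}"
  have K': "\<And>\<sigma> \<rho>. \<sigma> \<in> K \<Longrightarrow> \<rho> \<subseteq> \<sigma> \<Longrightarrow> \<rho> \<in> K"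
    using K unfolding simplicial_complex_def by auto
  have w\<tau>: "w \<notin> set \<tau>"
    using w assms(2) by auto
  have wp: "w \<notin> set (fst p)" if "p \<in> set ps" for p
  proof
    assume "w \<in> set (fst p)"
    then have "{w} \<in> K"
      using ps that unfolding carries_def by (metis empty_subsetI insert_not_empty insert_subset)
    then show False
      using w by auto
  qed
  have inK: "(\<exists>p\<in>set ps. E \<subseteq> set (fst p)) \<longleftrightarrow> E \<in> K" if "E \<noteq> {}" for E
    using ps that by (simp add: carries_def)
  show "F \<in> stellar (set \<tau>) w K \<longleftrightarrow> (\<exists>c\<in>set (concat (map (split \<tau> w) ps)). F \<subseteq> set (fst c))"
  proof (cases "set \<tau> \<subseteq> F")
    case True
    have "\<not> F \<subseteq> set (fst c)" if p: "p \<in> set ps" and c: "c \<in> set (split \<tau> w p)" for p c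
    proof (cases "set \<tau> \<subseteq> set (fst p)")
      case True': True
      then obtain x where "x \<in> set \<tau>" "set (fst c) = insert w (set (fst p) - {x})"
        using c set_order[OF True'] by (auto simp: split_def)
      then show ?thesis
        using True w\<tau> by auto
    next
      case False
      then show ?thesis
        using c True by (auto simp: split_def)
    qed
    moreover have "F \<notin> stellar (set \<tau>) w K"
    proof
      assume "F \<in> stellar (set \<tau>) w K"
      then obtain \<rho> where "F = insert w \<rho>" "\<not> set \<tau> \<subseteq> \<rho>"
        using True assms(2) by (auto simp: stellar_def)
      then show False
        using True w\<tau> by auto
    qed
    ultimately show ?thesis
      by auto
  next
    case False
    have 1: "(\<exists>c\<in>set (concat (map (split \<tau> w) ps)). F \<subseteq> set (fst c)) \<longleftrightarrow>
        (\<exists>p\<in>set ps. if w \<in> F then F - {w} \<union> set \<tau> \<subseteq> set (fst p) else F \<subseteq> set (fst p))"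
      using subset_split_iff[OF wp w\<tau> assms(3) False] by simp
    have 2: "F - {w} \<union> set \<tau> \<noteq> {}"
      using assms(3) by simp
    have "F \<in> stellar (set \<tau>) w K \<longleftrightarrow> (if w \<in> F then F - {w} \<union> set \<tau> \<in> K else F \<in> K)"
    proof (cases "w \<in> F")
      case True
      have "F \<in> stellar (set \<tau>) w K \<longleftrightarrow>
          (\<exists>\<rho>. F = insert w \<rho> \<and> (\<exists>\<sigma>\<in>K. set \<tau> \<subseteq> \<sigma> \<and> \<rho> \<subseteq> \<sigma> \<and> \<not> set \<tau> \<subseteq> \<rho>))"
      proof -
        have "F \<notin> {\<sigma> \<in> K. \<not> set \<tau> \<subseteq> \<sigma>}"
          using w True by blast
        then show ?thesis
          using assms(2) unfolding stellar_def by (simp, blast)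
      qed
      also have "\<dots> \<longleftrightarrow> F - {w} \<union> set \<tau> \<in> K"
      proof
        assume "\<exists>\<rho>. F = insert w \<rho> \<and> (\<exists>\<sigma>\<in>K. set \<tau> \<subseteq> \<sigma> \<and> \<rho> \<subseteq> \<sigma> \<and> \<not> set \<tau> \<subseteq> \<rho>)"
        then obtain \<rho> \<sigma> where "F = insert w \<rho>" "\<sigma> \<in> K" "set \<tau> \<subseteq> \<sigma>" "\<rho> \<subseteq> \<sigma>"
          by (elim exE conjE bexE)
        then show "F - {w} \<union> set \<tau> \<in> K"
          using K'[of \<sigma> "F - {w} \<union> set \<tau>"] by blast
      next
        assume "F - {w} \<union> set \<tau> \<in> K"
        then show "\<exists>\<rho>. F = insert w \<rho> \<and> (\<exists>\<sigma>\<in>K. set \<tau> \<subseteq> \<sigma> \<and> \<rho> \<subseteq> \<sigma> \<and> \<not> set \<tau> \<subseteq> \<rho>)"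
          using True False
          by (intro exI[of _ "F - {w}"] conjI bexI[of _ "F - {w} \<union> set \<tau>"]) auto
      qed
      finally show ?thesis
        using True by simp
    next
      case wF: False
      then show ?thesis
        using assms(2) False by (auto simp: stellar_def)
    qed
    then show ?thesis
      unfolding 1 using inK[OF F] inK[OF 2] by simp
  qed
qed

lemma simplicial_complex_stellar:
  assumes K: "simplicial_complex K"
  shows "simplicial_complex (stellar \<tau> w K)"
proof (cases "\<tau> \<in> K")
  case True
  have K': "finite K" "\<And>\<sigma>. \<sigma> \<in> K \<Longrightarrow> finite \<sigma>" "\<And>\<sigma> \<rho>. \<sigma> \<in> K \<Longrightarrow> \<rho> \<subseteq> \<sigma> \<Longrightarrow> \<rho> \<in> K"
    using K unfolding simplicial_complex_def by auto
  have st: "stellar \<tau> w K = {\<sigma> \<in> K. \<not> \<tau> \<subseteq> \<sigma>} \<union>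
      {insert w \<rho> |\<rho>. \<exists>\<sigma>\<in>K. \<tau> \<subseteq> \<sigma> \<and> \<rho> \<subseteq> \<sigma> \<and> \<not> \<tau> \<subseteq> \<rho>}"
    using True by (simp add: stellar_def)
  have "stellar \<tau> w K \<subseteq> K \<union> insert w ` K"
  proof
    fix F assume "F \<in> stellar \<tau> w K"
    then consider "F \<in> K" | \<rho> \<sigma> where "F = insert w \<rho>" "\<sigma> \<in> K" "\<rho> \<subseteq> \<sigma>"
      unfolding st by blast
    then show "F \<in> K \<union> insert w ` K"
      by cases (use K'(3) in auto)
  qed
  then have "finite (stellar \<tau> w K)" "\<And>\<sigma>. \<sigma> \<in> stellar \<tau> w K \<Longrightarrow> finite \<sigma>"
    using K'(1,2) by (auto dest: finite_subset)
  moreover have "F \<in> stellar \<tau> w K" if "E \<in> stellar \<tau> w K" "F \<subseteq> E" for E F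
  proof (cases "E \<in> K \<and> \<not> \<tau> \<subseteq> E")
    case True
    then show ?thesis
      unfolding st using K'(3)[of E F] that(2) by blast
  next
    case False
    then have "E \<in> {insert w \<rho> |\<rho>. \<exists>\<sigma>\<in>K. \<tau> \<subseteq> \<sigma> \<and> \<rho> \<subseteq> \<sigma> \<and> \<not> \<tau> \<subseteq> \<rho>}"
      using that(1) unfolding st by blast
    then obtain \<rho> \<sigma> where E: "E = insert w \<rho>" "\<sigma> \<in> K" "\<tau> \<subseteq> \<sigma>" "\<rho> \<subseteq> \<sigma>" "\<not> \<tau> \<subseteq> \<rho>"
      by blast
    show ?thesis
    proof (cases "w \<in> F")
      case True
      then have "F = insert w (F \<inter> \<rho>)"
        using that(2) E(1) by auto
      moreover have "\<exists>\<sigma>\<in>K. \<tau> \<subseteq> \<sigma> \<and> F \<inter> \<rho> \<subseteq> \<sigma> \<and> \<not> \<tau> \<subseteq> F \<inter> \<rho>"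
        using E by (intro bexI[of _ \<sigma>]) auto
      ultimately show ?thesis
        unfolding st by blast
    next
      case False
      then have "F \<subseteq> \<rho>"
        using that(2) E(1) by auto
      then have "F \<in> K" "\<not> \<tau> \<subseteq> F"
        using E K'(3)[of \<sigma> F] by auto
      then show ?thesis
        unfolding st by simp
    qed
  qed
  ultimately show ?thesis
    unfolding simplicial_complex_def by blast
qed (use K in \<open>simp add: stellar_def\<close>)

lemma Union_stellar: "\<Union>(stellar \<tau> w K) \<subseteq> insert w (\<Union>K)"
  by (auto simp: stellar_def)

text \<open>The faces counted are the removed ones outside all removed ridges. A critical tile still
  has one of them, so pieces without surplus vertices get the value 0 explicitly.\<close>

definition badness :: "'v piece \<Rightarrow> nat" where
  "badness p =
     (if surplus p = [] then 0
      else card {F. F \<subseteq> set (fst p) \<and> covered (snd p) F \<and> set (tight p) \<subseteq> F})"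

text \<open>This bound is the source of the number of rounds.\<close>

lemma badness_le: "badness p \<le> 2 ^ length (fst p)"
proof -
  have "card {F. F \<subseteq> set (fst p) \<and> covered (snd p) F \<and> set (tight p) \<subseteq> F} \<le> card (Pow (set (fst p)))"
    by (rule card_mono) auto
  also have "\<dots> \<le> 2 ^ length (fst p)"
    by (simp add: card_Pow card_length)
  finally show ?thesis
    by (simp add: badness_def)
qed

lemma psubset_if_mem: "A \<subseteq> B \<Longrightarrow> y \<in> B \<Longrightarrow> y \<notin> A \<Longrightarrow> A \<subset> B"
  by blast

lemma card_pos_if_mem: "finite A \<Longrightarrow> y \<in> A \<Longrightarrow> 0 < card A"
  by (auto simp: card_gt_0_iff)

text \<open>\<open>order\<close> keeps the blocks of tight, surplus and other vertices apart. By the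
  second fact, if the site meets the surplus, a vertex \<open>x\<close> that is not tight is surplus
  itself or comes after a surplus vertex.\<close>

lemma order_prefix:
  assumes "order \<tau> p = pre @ x # post" "x \<notin> set (tight p)"
  shows "set (tight p) \<inter> set \<tau> \<subseteq> set pre"
    and "surplus p = [] \<or> set (surplus p) \<inter> set \<tau> = {} \<or> x \<in> set (surplus p) \<or> \<not> set pre \<subseteq> set (tight p)"
proof -
  let ?f = "filter (\<lambda>x. x \<in> set \<tau>)"
  let ?rest = "filter (\<lambda>x. x \<notin> set (tight p) \<and> x \<notin> set (surplus p)) (fst p)"
  have split: "?f (tight p) @ ?f (surplus p) @ ?f ?rest = pre @ x # post"
    using assms(1) by (simp add: order_def)
  have x: "x \<notin> set (?f (tight p))"
    using assms(2) by simp
  obtain ys where ys: "?f (tight p) = pre @ ys \<and> ys @ ?f (surplus p) @ ?f ?rest = x # post \<or>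
      ?f (tight p) @ ys = pre \<and> ?f (surplus p) @ ?f ?rest = ys @ x # post"
    using split unfolding append_eq_append_conv2 by blast
  have "\<exists>zs. pre = ?f (tight p) @ zs \<and> ?f (surplus p) @ ?f ?rest = zs @ x # post"
    using ys
  proof (elim disjE conjE)
    assume *: "?f (tight p) = pre @ ys" "ys @ ?f (surplus p) @ ?f ?rest = x # post"
    have "ys = []"
    proof (cases ys)
      case (Cons y ys')
      then have "x \<in> set ys"
        using *(2) by simp
      then show ?thesis
        using x unfolding *(1) by simp
    qed
    then show ?thesis
      using * by (intro exI[of _ "[]"]) (simp only: append_Nil append_Nil2)
  qed blast
  then obtain zs where zs: "pre = ?f (tight p) @ zs" "?f (surplus p) @ ?f ?rest = zs @ x # post"
    by blast
  then show "set (tight p) \<inter> set \<tau> \<subseteq> set pre"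
    by auto
  show "surplus p = [] \<or> set (surplus p) \<inter> set \<tau> = {} \<or> x \<in> set (surplus p) \<or> \<not> set pre \<subseteq> set (tight p)"
  proof (cases "?f (surplus p)")
    case Nil
    then show ?thesis
      by (auto simp: filter_empty_conv)
  next
    case (Cons u us)
    then have "u \<in> set (?f (surplus p))"
      by simp
    then have "u \<in> set (surplus p)"
      by simp
    moreover have "x = u \<or> u \<in> set zs"
      using zs(2) Cons by (cases zs) auto
    ultimately show ?thesis
      using zs(1) by (auto simp: set_surplus)
  qed
qed

lemma badness_eq_0: "badness p = 0 \<longleftrightarrow> surplus p = []"
proof
  assume "badness p = 0"
  show "surplus p = []"
  proof (rule ccontr)
    assume ne: "surplus p \<noteq> []"
    then obtain u where "u \<in> set (surplus p)"
      by (cases "surplus p") auto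
    then have u: "insert u (set (tight p)) \<in>
        {F. F \<subseteq> set (fst p) \<and> covered (snd p) F \<and> set (tight p) \<subseteq> F}"
      by (auto simp: set_surplus set_tight)
    have "0 < card {F. F \<subseteq> set (fst p) \<and> covered (snd p) F \<and> set (tight p) \<subseteq> F}"
      by (rule card_pos_if_mem[OF _ u]) simp
    then have "0 < badness p"
      using ne by (simp only: badness_def if_False)
    then show False
      using \<open>badness p = 0\<close> by simp
  qed
qed (simp add: badness_def)

text \<open>The sites at which a subdivision makes a bad piece less bad.\<close>

definition good_site :: "'v set \<Rightarrow> 'v piece \<Rightarrow> bool" where
  "good_site \<tau> p \<longleftrightarrow>
     \<tau> = set (fst p) \<or>
     (\<exists>b\<in>set (fst p). \<tau> = set (fst p) - {b} \<and>
        (b \<in> set (tight p) \<or> surplus p = [] \<or> (\<exists>u\<in>set (surplus p). u \<noteq> b)))"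

text \<open>The faces counted for the child are also counted for \<open>p\<close>, avoid
  \<open>x\<close> and contain \<open>pre\<close>; the vertex order makes the inclusion strict. The
  truncated subtraction also asserts that badness 0 is kept.\<close>

lemma badness_child:
  assumes p: "valid_piece A p" and w: "w \<notin> set (fst p)" and site: "good_site (set \<tau>) p"
    and split: "order \<tau> p = pre @ x # post"
  shows "badness (child \<tau> w p pre x) \<le> badness p - 1"
proof -
  let ?c = "child \<tau> w p pre x"
  let ?q = "set (fst p)" and ?q' = "insert w (set (fst p) - {x})"
  let ?\<Lambda> = "covered (snd p)" and ?\<Lambda>' = "covered (snd ?c)"
  let ?V = "set (tight p)" and ?V' = "set (tight ?c)"
  let ?B = "{F. F \<subseteq> ?q \<and> ?\<Lambda> F \<and> ?V \<subseteq> F}" and ?B' = "{F. F \<subseteq> ?q' \<and> ?\<Lambda>' F \<and> ?V' \<subseteq> F}"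
  have \<tau>q: "set \<tau> \<subseteq> ?q"
    using site by (auto simp: good_site_def)
  have ord: "set pre \<union> insert x (set post) = set \<tau>"
    using set_order[OF \<tau>q] split by auto
  have "distinct (pre @ x # post)"
    using distinct_order[of p \<tau>] p split by (simp add: valid_piece_def)
  then have x: "x \<in> set \<tau>" "x \<in> ?q" "x \<notin> set pre"
    using ord \<tau>q by auto
  have G: "\<forall>g\<in>set (snd p). set g \<subseteq> ?q" and top: "\<not> ?\<Lambda> ?q"
    using p by (simp_all add: valid_piece_def)
  note \<Lambda>' = covered_child[OF w G x(1,2), of _ pre]
  have V': "v \<in> ?V' \<longleftrightarrow> v \<in> ?q' \<and> ?\<Lambda>' (?q' - {v})" for v
    using set_tight[of ?c] by simp
  \<comment> \<open>The ridge opposite to an earlier vertex \<open>y\<close> is shared with the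
    child that omits \<open>y\<close>.\<close>
  have pre: "set pre \<subseteq> ?V'"
  proof
    fix y assume y: "y \<in> set pre"
    then have "y \<in> ?q'"
      using ord \<tau>q x(3) by auto
    moreover have "?\<Lambda>' (?q' - {y})"
      using y by (subst \<Lambda>') auto
    ultimately show "y \<in> ?V'"
      by (simp add: V')
  qed
  \<comment> \<open>For \<open>v\<close> outside the site, the ridge of the child opposite to
    \<open>v\<close> is a cone, and its base together with the site is the old ridge opposite to
    \<open>v\<close>.\<close>
  have far: "?V - set \<tau> \<subseteq> ?V'"
  proof
    fix v assume v: "v \<in> ?V - set \<tau>"
    then have "v \<in> ?q" "?\<Lambda> (?q - {v})" "v \<noteq> x" "v \<noteq> w"
      using x w by (auto simp: set_tight)
    moreover have "?q' - {v} - {w} \<union> set \<tau> = ?q - {v}"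
      using v w x \<tau>q by auto
    ultimately have "?\<Lambda>' (?q' - {v})"
      by (subst \<Lambda>') auto
    then show "v \<in> ?V'"
      using \<open>v \<in> ?q\<close> \<open>v \<noteq> x\<close> by (simp add: V')
  qed
  \<comment> \<open>The ridge of the child opposite to the new vertex is the old ridge opposite to
    \<open>x\<close>.\<close>
  have wV': "w \<in> ?V'" if "x \<in> ?V"
  proof -
    have "?\<Lambda> (?q - {x})"
      using that by (simp add: set_tight)
    moreover have "?q' - {w} = ?q - {x}"
      using w by auto
    ultimately have "?\<Lambda>' (?q' - {w})"
      using w by (subst \<Lambda>') auto
    then show ?thesis
      by (simp add: V')
  qed
  have B': "F \<in> ?B \<and> x \<notin> F \<and> set pre \<subseteq> F \<and> x \<notin> ?V" if F: "F \<in> ?B'" for F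
  proof -
    have F: "F \<subseteq> ?q'" "?\<Lambda>' F" "?V' \<subseteq> F"
      using that by auto
    have "\<not> F \<subseteq> insert w (?q - {y})" if "y \<in> set pre" for y
    proof -
      have "y \<in> F" "y \<noteq> w"
        using that pre F(3) w ord \<tau>q by blast+
      then show ?thesis
        by blast
    qed
    then have \<Lambda>F: "if w \<in> F then ?\<Lambda> (F - {w} \<union> set \<tau>) else ?\<Lambda> F"
      using F(2) \<Lambda>'[OF F(1)] by blast
    \<comment> \<open>Otherwise the base of \<open>F\<close> together with the site would be a
      removed face. At a facet this is the whole simplex. At a ridge it makes the opposite vertex
      \<open>b\<close> tight, hence a member of \<open>F\<close>, and again the whole simplex would
      be removed.\<close>
    have wF: "w \<notin> F"
    proof
      assume "w \<in> F"
      then have cov: "?\<Lambda> (F - {w} \<union> set \<tau>)"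
        using \<Lambda>F by simp
      consider "set \<tau> = ?q" | b where "b \<in> ?q" "set \<tau> = ?q - {b}"
        using site unfolding good_site_def by blast
      then show False
      proof cases
        case 1
        then have "F - {w} \<union> set \<tau> = ?q"
          using F(1) by auto
        then show False
          using cov top by simp
      next
        case b: 2
        have "b \<notin> F"
        proof
          assume "b \<in> F"
          then have "F - {w} \<union> set \<tau> = ?q"
            using F(1) b w by auto
          then show False
            using cov top by simp
        qed
        moreover have "?\<Lambda> (?q - {b})"
          using covered_mono[OF cov] b(2) by blast
        then have "b \<in> ?V - set \<tau>"
          using b by (auto simp: set_tight)
        then have "b \<in> F"
          using far F(3) by blast
        ultimately show False
          by simp
      qed
    qed
    then have "x \<notin> ?V"
      using wV' F(3) by blast
    then have "?V \<subseteq> F"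
      using order_prefix(1)[OF split] pre far F(3) by blast
    moreover have "F \<subseteq> ?q" "x \<notin> F"
      using F(1) wF x w by auto
    ultimately show ?thesis
      using \<Lambda>F wF pre F(3) \<open>x \<notin> ?V\<close> by auto
  qed
  have c_q: "set (fst ?c) = ?q'"
    by simp
  show ?thesis
  proof (cases "surplus p = []")
    case True
    \<comment> \<open>A surplus vertex \<open>u\<close> of the child would be surplus for
      \<open>p\<close>: the face spanned by \<open>u\<close> and the tight vertices of the child is
      counted there, so it is removed from \<open>p\<close>, and it contains
      \<open>?V\<close>.\<close>
    have "surplus ?c = []"
    proof (rule ccontr)
      assume "surplus ?c \<noteq> []"
      then obtain u where u: "u \<in> set (surplus ?c)"
        by (cases "surplus ?c") auto
      then have u: "u \<in> ?q'" "u \<notin> ?V'" "?\<Lambda>' (insert u ?V')"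
        unfolding set_surplus c_q by auto
      have "?V' \<subseteq> ?q'"
        using V' by blast
      then have "insert u ?V' \<in> ?B'"
        using u by auto
      note * = B'[OF this]
      have "?V \<subseteq> ?V'"
        using * order_prefix(1)[OF split] pre far by blast
      then have "u \<in> ?q" "u \<notin> ?V" "?\<Lambda> (insert u ?V)"
        using * u covered_mono[of "snd p" "insert u ?V'" "insert u ?V"] by auto
      then have "u \<in> set (surplus p)"
        by (simp add: set_surplus)
      then show False
        using True by simp
    qed
    then show ?thesis
      by (simp add: badness_def)
  next
    case False
    have fin: "finite ?B"
      by (rule finite_subset[of _ "Pow ?q"]) auto
    have sub: "?B' \<subseteq> ?B"
    proof
      fix F assume "F \<in> ?B'"
      then show "F \<in> ?B"
        by (rule B'[THEN conjunct1])
    qed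
    \<comment> \<open>The site contains a surplus vertex. Either \<open>x\<close> is surplus, and
      the face \<open>insert x ?V\<close> is lost because it contains \<open>x\<close>; or
      \<open>pre\<close> has a vertex that is not tight, and \<open>?V\<close> itself is
      lost.\<close>
    have less: "?B' \<subset> ?B" if "?B' \<noteq> {}"
    proof -
      have "\<exists>F. F \<in> ?B'"
        using that by (simp only: ex_in_conv not_False_eq_True)
      then obtain F where "F \<in> ?B'" ..
      from B'[OF this] have xV: "x \<notin> ?V"
        by (elim conjE)
      obtain u where u: "u \<in> set (surplus p)"
        using False by (cases "surplus p") auto
      then have uB: "insert u ?V \<in> ?B" "?V \<in> ?B"
        using covered_mono[of "snd p" "insert u ?V" ?V] by (auto simp: set_surplus set_tight)
      have Uq: "set (surplus p) \<subseteq> ?q - ?V"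
        by (auto simp: set_surplus)
      consider "set \<tau> = ?q"
        | b where "set \<tau> = ?q - {b}" "b \<in> ?V \<or> (\<exists>v\<in>set (surplus p). v \<noteq> b)"
        using site False unfolding good_site_def by blast
      then have "set (surplus p) \<inter> set \<tau> \<noteq> {}"
        by cases (use u Uq in blast)+
      then consider "x \<in> set (surplus p)" | "\<not> set pre \<subseteq> ?V"
        using order_prefix(2)[OF split xV] False by blast
      then show ?thesis
      proof cases
        case 1
        then have "insert x ?V \<in> ?B"
          by (auto simp: set_surplus set_tight)
        moreover have "insert x ?V \<notin> ?B'"
        proof
          assume "insert x ?V \<in> ?B'"
          from B'[OF this] have "x \<notin> insert x ?V"
            by (elim conjE)
          then show False
            by simp
        qed
        ultimately show ?thesis
          by (rule psubset_if_mem[OF sub])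
      next
        case 2
        have "?V \<notin> ?B'"
        proof
          assume "?V \<in> ?B'"
          from B'[OF this] have "set pre \<subseteq> ?V"
            by (elim conjE)
          then show False
            using 2 by simp
        qed
        then show ?thesis
          by (rule psubset_if_mem[OF sub uB(2)])
      qed
    qed
    have pos: "0 < card ?B"
    proof -
      obtain u where "u \<in> set (surplus p)"
        using False by (cases "surplus p") auto
      then have "insert u ?V \<in> ?B"
        by (auto simp: set_surplus set_tight)
      then show ?thesis
        by (rule card_pos_if_mem[OF fin])
    qed
    have "card ?B' < card ?B"
    proof (cases "?B' = {}")
      case True
      show ?thesis
        unfolding True using pos by simp
    next
      case False
      show ?thesis
        by (rule psubset_card_mono[OF fin less[OF False]])
    qed
    then have "card ?B' \<le> card ?B - 1"
      by arith
    then show ?thesis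
      using False unfolding badness_def c_q by simp
  qed
qed

lemma badness_split:
  assumes "valid_piece A p" "w \<notin> set (fst p)" "good_site (set \<tau>) p" "c \<in> set (split \<tau> w p)"
  shows "badness c \<le> badness p - 1"
proof -
  have "set \<tau> \<subseteq> set (fst p)"
    using assms(3) by (auto simp: good_site_def)
  then obtain x where x: "x \<in> set (order \<tau> p)"
    "c = child \<tau> w p (takeWhile (\<lambda>y. y \<noteq> x) (order \<tau> p)) x"
    using assms(4) by (auto simp: split_def)
  obtain pre post where split: "order \<tau> p = pre @ x # post"
    using x(1) by (meson split_list)
  moreover have "distinct (order \<tau> p)"
    using assms(1) by (simp add: distinct_order valid_piece_def)
  ultimately have "takeWhile (\<lambda>y. y \<noteq> x) (order \<tau> p) = pre"
    using takeWhile_neq_split by metis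
  then show ?thesis
    using badness_child[OF assms(1-3) split] x(2) by simp
qed

section \<open>Pieces without surplus vertices are tiles\<close>

definition tile_of :: "'v piece \<Rightarrow> 'v list \<times> 'v list list" where
  "tile_of p =
     (fst p, map (\<lambda>v. removeAll v (fst p)) (tight p) @
             (if covered (snd p) (set (tight p)) then [tight p] else []))"

lemma real_tile_of:
  "fst (real_tile id (tile_of p)) = set (fst p)"
  "snd (real_tile id (tile_of p)) =
    (\<lambda>v. set (fst p) - {v}) ` set (tight p) \<union>
    (if covered (snd p) (set (tight p)) then {set (tight p)} else {})"
  by (auto simp: real_tile_def tile_of_def image_image)

text \<open>A face missing some tight vertex lies in a removed ridge. A removed face containing all
  tight vertices can have no further vertex, as that vertex would be surplus.\<close>

lemma tile_of_covers:
  assumes "surplus p = []" "F \<subseteq> set (fst p)"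
  shows "(\<exists>\<omega>\<in>snd (real_tile id (tile_of p)). F \<subseteq> \<omega>) \<longleftrightarrow> covered (snd p) F"
proof -
  have none: "\<not> covered (snd p) (insert u (set (tight p)))"
    if "u \<in> set (fst p)" "u \<notin> set (tight p)" for u
    using that assms(1) set_surplus[of p] by auto
  show ?thesis
  proof (cases "set (tight p) \<subseteq> F")
    case True
    have "F = set (tight p)" if "covered (snd p) F"
    proof (rule ccontr)
      assume "F \<noteq> set (tight p)"
      then obtain u where u: "u \<in> F" "u \<notin> set (tight p)"
        using True by blast
      then show False
        using none[of u] assms(2) True covered_mono[OF that, of "insert u (set (tight p))"] by blast
    qed
    moreover have "\<not> F \<subseteq> set (fst p) - {v}" if "v \<in> set (tight p)" for v
      using True that by blast
    ultimately show ?thesis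
      unfolding real_tile_of using True by auto
  next
    case False
    then obtain v where v: "v \<in> set (tight p)" "v \<notin> F"
      by blast
    then have "F \<subseteq> set (fst p) - {v}" "covered (snd p) (set (fst p) - {v})"
      using assms(2) by (auto simp: set_tight)
    then show ?thesis
      unfolding real_tile_of using v(1) covered_mono by blast
  qed
qed

lemma tile_of_relative_simplex:
  assumes "valid_piece A p"
  shows "relative_simplex (real_tile id (tile_of p))"
proof -
  have "set (tight p) \<subset> set (fst p)" if "covered (snd p) (set (tight p))"
  proof -
    have "set (tight p) \<noteq> set (fst p)"
      using assms that by (auto simp: valid_piece_def)
    then show ?thesis
      by (auto simp: set_tight)
  qed
  then show ?thesis
    using assms unfolding relative_simplex_def real_tile_of
    by (auto simp: valid_piece_def set_tight)
qed

text \<open>The tight vertices span the least face of the basic tile, so removing that face too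
  gives a critical tile; its index is at most \<open>n\<close> because the whole simplex is not
  covered.\<close>

lemma basic_or_critical_tile_of:
  assumes "valid_piece A p"
  shows "\<exists>n k. basic_tile n k (real_tile id (tile_of p)) \<or> critical_tile n k (real_tile id (tile_of p))"
proof -
  let ?T = "real_tile id (tile_of p)" and ?q = "set (fst p)" and ?V = "set (tight p)"
  let ?R = "(\<lambda>v. ?q - {v}) ` ?V"
  obtain n where n: "card ?q = n + 1"
    using assms by (cases "fst p") (auto simp: valid_piece_def card_insert_if)
  have Vq: "?V \<subseteq> ?q"
    by (auto simp: set_tight)
  have "inj_on (\<lambda>v. ?q - {v}) ?V"
    using Vq by (auto simp: inj_on_def)
  then have basic: "basic_tile n (card ?V) (?q, ?R)"
    using n Vq by (auto simp: basic_tile_def card_image)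
  show ?thesis
  proof (cases "covered (snd p) ?V")
    case True
    then have "?V \<noteq> ?q"
      using assms by (auto simp: valid_piece_def)
    then have "card ?V < card ?q"
      using Vq by (intro psubset_card_mono) auto
    then have "card ?V \<le> n"
      using n by simp
    moreover have "?V \<in> tile_faces (?q, ?R)"
      using Vq by (auto simp: tile_faces_def)
    moreover have "snd ?T = insert ?V ?R"
      using True by (auto simp: real_tile_of)
    ultimately have "critical_tile n (card ?V) ?T"
      unfolding critical_tile_def real_tile_of(1) using basic by blast
    then show ?thesis
      by blast
  next
    case False
    then have "?T = (?q, ?R)"
      by (intro prod_eqI) (simp_all add: real_tile_of)
    then show ?thesis
      using basic by metis
  qed
qed

lemma valid_pieces_ex: "valid_pieces A ps \<Longrightarrow> p \<in> set ps \<Longrightarrow> \<exists>A. valid_piece A p"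
  by (induction ps arbitrary: A) auto

lemma h_shelling_if_no_surplus:
  assumes K: "simplicial_complex K" and L: "simplicial_complex L" "L \<subseteq> K"
    and ps: "valid_pieces (\<lambda>F. F \<in> L) ps" "carries K ps" "sorted_pieces ps"
    and good: "\<And>p. p \<in> set ps \<Longrightarrow> surplus p = []"
  shows "h_shelling K L (tiles_of id (map tile_of ps))"
proof -
  let ?t = "\<lambda>p. real_tile id (tile_of p)"
  have Ts: "tiles_of id (map tile_of ps) = map ?t ps"
    by (simp add: tiles_of_eq)
  have "shelled A (map ?t ps)" if "valid_pieces A ps" "\<And>p. p \<in> set ps \<Longrightarrow> surplus p = []" for A
    using that
  proof (induction ps arbitrary: A)
    case (Cons p ps)
    have p: "valid_piece A p" "surplus p = []"
      using Cons.prems by auto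
    then have "(\<exists>\<omega>\<in>snd (?t p). F \<subseteq> \<omega>) \<longleftrightarrow> A F" if "F \<subseteq> fst (?t p)" for F
      using that tile_of_covers[of p F] by (simp add: real_tile_of(1) valid_piece_def)
    moreover have "shelled (\<lambda>F. A F \<or> F \<subseteq> fst (?t p)) (map ?t ps)"
      using Cons by (simp only: real_tile_of(1) valid_pieces.simps list.set_intros)
    ultimately show ?case
      unfolding list.map shelled.simps using tile_of_relative_simplex[OF p(1)] by blast
  qed simp
  then have "shelling K L (map ?t ps)"
  proof (rule shelling_if_shelled[OF K L(1)])
    show "F \<in> K \<longleftrightarrow> F \<in> L \<or> (\<exists>T\<in>set (map ?t ps). F \<subseteq> fst T)" if "F \<noteq> {}" for F
      using ps(2) L(2) that by (auto simp: carries_def real_tile_of)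
    show "sorted_wrt (\<lambda>T T'. card (fst T') \<le> card (fst T)) (map ?t ps)"
      unfolding sorted_wrt_map real_tile_of(1)
      by (rule sorted_wrt_mono_rel[OF _ ps(3)[unfolded sorted_pieces_def]])
        (use valid_pieces_distinct[OF ps(1)] in \<open>simp add: distinct_card\<close>)
  qed (use ps(1) good in auto)
  moreover have "\<exists>n k. basic_tile n k (?t p) \<or> critical_tile n k (?t p)" if "p \<in> set ps" for p
    using valid_pieces_ex[OF ps(1) that] basic_or_critical_tile_of by blast
  ultimately show ?thesis
    unfolding h_shelling_def Ts by simp
qed

section \<open>Facets and ridges among the pieces\<close>

lemma valid_pieces_no_subset:
  assumes ps: "valid_pieces A ps" "sorted_pieces ps"
    and pq: "p \<in> set ps" "q \<in> set ps" "set (fst p) \<subseteq> set (fst q)"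
  shows "p = q"
proof (rule ccontr)
  assume "p \<noteq> q"
  obtain us vs where split: "ps = us @ p # vs"
    using pq(1) by (meson split_list)
  consider "q \<in> set us" | "q \<in> set vs"
    using pq(2) \<open>p \<noteq> q\<close> split by auto
  then show False
  proof cases
    case 1
    then show False
      using valid_pieces_splitD[OF ps(1)[unfolded split]] pq(3) by (auto simp: valid_piece_def)
  next
    case 2
    then have "length (fst q) \<le> length (fst p)"
      using ps(2) by (auto simp: sorted_pieces_def split sorted_wrt_append)
    moreover have "card (set (fst p)) = length (fst p)" "card (set (fst q)) = length (fst q)"
      using valid_pieces_distinct[OF ps(1)] pq by (auto simp: distinct_card)
    ultimately have eq: "set (fst p) = set (fst q)"
      using pq(3) by (metis List.finite_set card_seteq)
    obtain us' vs' where vs: "vs = us' @ q # vs'"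
      using 2 by (meson split_list)
    have "ps = (us @ p # us') @ q # vs'"
      by (simp add: split vs)
    then show False
      using valid_pieces_splitD[of A "us @ p # us'" q vs'] ps(1) eq by (auto simp: valid_piece_def)
  qed
qed

text \<open>An uncovered face of \<open>p\<close> is used by no piece before \<open>p\<close>. So
  all other pieces containing it come later.\<close>

lemma valid_pieces_face:
  assumes ps: "valid_pieces A ps" "sorted_pieces ps"
    and pq: "p \<in> set ps" "q \<in> set ps" "q \<noteq> p"
    and \<rho>: "\<rho> \<subseteq> set (fst p)" "\<rho> \<subseteq> set (fst q)" "\<not> covered (snd p) \<rho>"
  shows "covered (snd q) \<rho>" "length (fst q) \<le> length (fst p)"
proof -
  obtain us vs where split: "ps = us @ p # vs"
    using pq(1) by (meson split_list)
  have "q \<notin> set us"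
  proof
    assume "q \<in> set us"
    then have "covered (snd p) \<rho>"
      using valid_pieces_splitD[OF ps(1)[unfolded split]] \<rho> by (auto simp: valid_piece_def)
    then show False
      using \<rho>(3) by simp
  qed
  then have q: "q \<in> set vs"
    using pq split by auto
  then show "length (fst q) \<le> length (fst p)"
    using ps(2) by (auto simp: sorted_pieces_def split sorted_wrt_append)
  obtain us' vs' where vs: "vs = us' @ q # vs'"
    using q by (meson split_list)
  have "ps = (us @ p # us') @ q # vs'"
    by (simp add: split vs)
  then show "covered (snd q) \<rho>"
    using valid_pieces_splitD[of A "us @ p # us'" q vs'] ps(1) \<rho> by (auto simp: valid_piece_def)
qed

lemma carriesD: "carries K ps \<Longrightarrow> F \<in> K \<Longrightarrow> F \<noteq> {} \<Longrightarrow> \<exists>p\<in>set ps. F \<subseteq> set (fst p)"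
  by (simp add: carries_def)

lemma carriesI: "carries K ps \<Longrightarrow> p \<in> set ps \<Longrightarrow> F \<subseteq> set (fst p) \<Longrightarrow> F \<noteq> {} \<Longrightarrow> F \<in> K"
  by (auto simp: carries_def)

lemma facet_piece:
  assumes "carries K ps" "valid_pieces A ps" "\<sigma> \<in> facets K" "ps \<noteq> []"
  obtains q where "q \<in> set ps" "\<sigma> = set (fst q)"
proof -
  have \<sigma>: "\<sigma> \<in> K" "\<And>\<rho>. \<rho> \<in> K \<Longrightarrow> \<sigma> \<subseteq> \<rho> \<Longrightarrow> \<rho> = \<sigma>"
    using assms(3) by (auto simp: facets_def)
  have inK: "set (fst q) \<in> K" "set (fst q) \<noteq> {}" if "q \<in> set ps" for q
    using carriesI[OF assms(1) that] valid_pieces_distinct[OF assms(2) that] by auto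
  have "\<sigma> \<noteq> {}"
    using \<sigma>(2)[of "set (fst (hd ps))"] inK[of "hd ps"] assms(4) by auto
  then obtain q where "q \<in> set ps" "\<sigma> \<subseteq> set (fst q)"
    using carriesD[OF assms(1) \<sigma>(1)] by blast
  then show thesis
    using that \<sigma>(2) inK by blast
qed

lemma site_Facet:
  assumes "carries K ps" "valid_pieces A ps" "sorted_pieces ps" "p \<in> set ps"
  shows "set (fst p) \<in> sites Facet K"
proof -
  have p: "set (fst p) \<in> K" "fst p \<noteq> []"
    using carriesI[OF assms(1,4)] valid_pieces_distinct[OF assms(2,4)] by auto
  have "\<rho> = set (fst p)" if "\<rho> \<in> K" "set (fst p) \<subseteq> \<rho>" for \<rho>
  proof -
    have "\<rho> \<noteq> {}"
      using that p by auto
    then obtain q where q: "q \<in> set ps" "\<rho> \<subseteq> set (fst q)"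
      using carriesD[OF assms(1) \<open>\<rho> \<in> K\<close>] by blast
    then have "p = q"
      using \<open>set (fst p) \<subseteq> \<rho>\<close> by (intro valid_pieces_no_subset[OF assms(2,3,4)]) auto
    then show ?thesis
      using \<open>set (fst p) \<subseteq> \<rho>\<close> q(2) by blast
  qed
  then show ?thesis
    using p by (auto simp: facets_def)
qed

text \<open>Another facet containing the uncovered ridge comes later, so it is no larger than
  \<open>p\<close>; not being a face of \<open>p\<close>, it is larger than the ridge. This gives
  codimension one even in complexes that are not pure.\<close>

lemma site_Ridge:
  assumes ps: "carries K ps" "valid_pieces A ps" "sorted_pieces ps"
    and p: "p \<in> set ps" "a \<in> set (fst p)" "\<not> covered (snd p) (set (fst p) - {a})"
    and ne: "set (fst p) - {a} \<noteq> {}"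
  shows "set (fst p) - {a} \<in> sites Ridge K"
proof -
  let ?\<rho> = "set (fst p) - {a}"
  have "card \<sigma> = card ?\<rho> + 1" if \<sigma>: "\<sigma> \<in> facets K" "?\<rho> \<subseteq> \<sigma>" for \<sigma>
  proof -
    obtain q where q: "q \<in> set ps" "\<sigma> = set (fst q)"
      using facet_piece[OF ps(1,2) \<sigma>(1)] p(1) by (metis empty_iff list.set(1))
    have p1: "card (set (fst p)) = card ?\<rho> + 1"
      using p(2) by (metis List.finite_set Suc_eq_plus1 card.remove)
    show ?thesis
    proof (cases "q = p")
      case True
      then show ?thesis
        using p1 q by simp
    next
      case False
      have "length (fst q) \<le> length (fst p)"
        using valid_pieces_face(2)[OF ps(2,3) p(1) q(1) False _ _ p(3)] \<sigma>(2) q(2) by blast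
      then have le: "card \<sigma> \<le> card ?\<rho> + 1"
        using valid_pieces_distinct[OF ps(2)] p q p1 by (metis distinct_card)
      have "\<not> \<sigma> \<subseteq> set (fst p)"
        using valid_pieces_no_subset[OF ps(2,3) q(1) p(1)] False q(2) by blast
      then have "?\<rho> \<subset> \<sigma>"
        using \<sigma>(2) by blast
      then have "card ?\<rho> < card \<sigma>"
        using q(2) by (intro psubset_card_mono) auto
      then show ?thesis
        using le by simp
    qed
  qed
  moreover have "?\<rho> \<in> K"
    using carriesI[OF ps(1) p(1) _ ne] by blast
  ultimately show ?thesis
    using ne by (simp add: ridges_def)
qed

section \<open>The subdivision algorithm\<close>

text \<open>The omitted vertex is not tight, so the ridge is still present, and it differs from one
  surplus vertex, which therefore stays in the site.\<close>

definition chosen_site :: "site \<Rightarrow> 'v piece \<Rightarrow> 'v list" where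
  "chosen_site s p =
     (case s of
        Facet \<Rightarrow> fst p
      | Ridge \<Rightarrow> removeAll
          (hd (filter (\<lambda>a. a \<notin> set (tight p) \<and> a \<noteq> hd (surplus p)) (fst p))) (fst p))"

text \<open>The current pieces, the subdivisions made so far, and the index of the next new
  vertex.\<close>

type_synonym 'v state = "'v piece list \<times> ('v list \<times> 'v) list \<times> nat"

definition step :: "(nat \<Rightarrow> 'v) \<Rightarrow> 'v list \<Rightarrow> 'v state \<Rightarrow> 'v state" where
  "step fr \<tau> st =
     (concat (map (split \<tau> (fr (snd (snd st)))) (fst st)),
      fst (snd st) @ [(\<tau>, fr (snd (snd st)))], Suc (snd (snd st)))"

text \<open>A bad piece is passed over if it already contains a selected site, since that site will
  treat it as well.\<close>

definition select :: "site \<Rightarrow> 'v piece list \<Rightarrow> 'v piece list" where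
  "select s ps =
     fold (\<lambda>p acc. if surplus p \<noteq> [] \<and> (\<forall>q\<in>set acc. \<not> set (chosen_site s q) \<subseteq> set (fst p))
                   then acc @ [p] else acc) ps []"

definition round :: "site \<Rightarrow> (nat \<Rightarrow> 'v) \<Rightarrow> 'v state \<Rightarrow> 'v state" where
  "round s fr st = fold (\<lambda>p. step fr (chosen_site s p)) (select s (fst st)) st"

text \<open>A mixed sequence must use both kinds of sites even if no piece is bad. The first piece
  has the largest dimension; it is subdivided, and then a ridge of its first child that contains the
  new vertex and hence does not belong to \<open>L\<close>.\<close>

definition force :: "(nat \<Rightarrow> 'v) \<Rightarrow> 'v state \<Rightarrow> 'v state" where
  "force fr st =
     (if fst st = [] \<or> tl (fst (hd (fst st))) = [] then st
      else let st1 = step fr (fst (hd (fst st))) st; q = fst (hd (fst st1)) in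
        step fr (removeAll (hd (tl q)) q) st1)"

definition kind :: "mode \<Rightarrow> site" where
  "kind m = (if m = At_Ridges then Ridge else Facet)"

text \<open>A piece has at most \<open>Suc d\<close> vertices, so \<open>2 ^ Suc d\<close> bounds
  the badness at the start, and each round lowers every positive badness.\<close>

definition subdivide :: "nat \<Rightarrow> mode \<Rightarrow> (nat \<Rightarrow> 'v) \<Rightarrow> nat \<Rightarrow> 'v list list \<Rightarrow> 'v list list \<Rightarrow> 'v state" where
  "subdivide d m fr n xs ys =
     (let st = (initial ys (by_dim d xs), [], n) in
      ((round (kind m) fr) ^^ (2 ^ Suc d)) (if m = Mixed then force fr st else st))"

text \<open>If all vertices were tight or equal to one surplus vertex, the whole simplex would be
  covered.\<close>

lemma ridge_candidates:
  assumes p: "valid_piece A p" and bad: "surplus p \<noteq> []"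
  shows "filter (\<lambda>a. a \<notin> set (tight p) \<and> a \<noteq> hd (surplus p)) (fst p) \<noteq> []"
proof
  let ?u = "hd (surplus p)"
  assume "filter (\<lambda>a. a \<notin> set (tight p) \<and> a \<noteq> ?u) (fst p) = []"
  then have "set (fst p) \<subseteq> insert ?u (set (tight p))"
    by (auto simp: filter_empty_conv)
  moreover have "?u \<in> set (surplus p)"
    using bad by simp
  then have "covered (snd p) (insert ?u (set (tight p)))"
    by (simp add: set_surplus)
  ultimately have "covered (snd p) (set (fst p))"
    using covered_mono by blast
  then show False
    using p by (auto simp: valid_piece_def)
qed

lemma good_siteI:
  "b \<in> set (fst p) \<Longrightarrow> \<tau> = set (fst p) - {b} \<Longrightarrow> u \<in> set (surplus p) \<Longrightarrow> u \<noteq> b \<Longrightarrow> good_site \<tau> p"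
  by (auto simp: good_site_def)

lemma chosen_site:
  assumes p: "valid_piece A p" and bad: "surplus p \<noteq> []"
  shows "set (chosen_site s p) \<subseteq> set (fst p)" "good_site (set (chosen_site s p)) p"
    "\<not> covered (snd p) (set (chosen_site s p))" "chosen_site s p \<noteq> []"
    "case s of Facet \<Rightarrow> set (chosen_site s p) = set (fst p)
      | Ridge \<Rightarrow> \<exists>a\<in>set (fst p). set (chosen_site s p) = set (fst p) - {a}"
proof -
  have top: "\<not> covered (snd p) (set (fst p))"
    using p by (auto simp: valid_piece_def)
  have "set (chosen_site s p) \<subseteq> set (fst p) \<and> good_site (set (chosen_site s p)) p \<and>
    \<not> covered (snd p) (set (chosen_site s p)) \<and> chosen_site s p \<noteq> [] \<and>
    (case s of Facet \<Rightarrow> set (chosen_site s p) = set (fst p)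
      | Ridge \<Rightarrow> \<exists>a\<in>set (fst p). set (chosen_site s p) = set (fst p) - {a})"
  proof (cases s)
    case Facet
    then show ?thesis
      using top p by (simp add: chosen_site_def good_site_def valid_piece_def)
  next
    case Ridge
    let ?u = "hd (surplus p)"
    let ?as = "filter (\<lambda>a. a \<notin> set (tight p) \<and> a \<noteq> ?u) (fst p)"
    have u: "?u \<in> set (surplus p)"
      using bad by simp
    have "?as \<noteq> []"
      by (rule ridge_candidates[OF p bad])
    then have "hd ?as \<in> set ?as"
      by (rule hd_in_set)
    then have a: "hd ?as \<in> set (fst p)" "hd ?as \<notin> set (tight p)" "hd ?as \<noteq> ?u"
      unfolding set_filter by blast+
    have \<tau>: "set (chosen_site s p) = set (fst p) - {hd ?as}"
      by (simp add: chosen_site_def Ridge)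
    have "?u \<in> set (chosen_site s p)"
      unfolding \<tau> using u a by (simp add: set_surplus)
    moreover have "\<not> covered (snd p) (set (chosen_site s p))"
      unfolding \<tau> using a by (simp add: set_tight)
    moreover have "good_site (set (chosen_site s p)) p"
      by (rule good_siteI[OF a(1) \<tau> u a(3)[symmetric]])
    moreover have "\<exists>a\<in>set (fst p). set (chosen_site s p) = set (fst p) - {a}"
      using \<tau> a(1) by (rule bexI)
    moreover have "set (chosen_site s p) \<subseteq> set (fst p)"
      unfolding \<tau> by (rule Diff_subset)
    moreover have "chosen_site s p \<noteq> []"
      using \<open>?u \<in> set (chosen_site s p)\<close> by (metis empty_iff empty_set)
    ultimately show ?thesis
      by (simp add: Ridge)
  qed
  then show "set (chosen_site s p) \<subseteq> set (fst p)" "good_site (set (chosen_site s p)) p"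
    "\<not> covered (snd p) (set (chosen_site s p))" "chosen_site s p \<noteq> []"
    "case s of Facet \<Rightarrow> set (chosen_site s p) = set (fst p)
      | Ridge \<Rightarrow> \<exists>a\<in>set (fst p). set (chosen_site s p) = set (fst p) - {a}"
    by blast+
qed

section \<open>The sites selected for a round\<close>

lemma select_snoc:
  "select s (ps @ [p]) =
    (if surplus p \<noteq> [] \<and> (\<forall>q\<in>set (select s ps). \<not> set (chosen_site s q) \<subseteq> set (fst p))
     then select s ps @ [p] else select s ps)"
  by (simp add: select_def)

lemma select_subset: "set (select s ps) \<subseteq> {p \<in> set ps. surplus p \<noteq> []}"
  by (induction ps rule: rev_induct) (auto simp: select_snoc select_def[of s "[]"])

lemma length_select: "length (select s ps) \<le> length ps"
  by (induction ps rule: rev_induct) (auto simp: select_snoc select_def[of s "[]"])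

lemma select_complete:
  assumes "valid_pieces A ps" "p \<in> set ps" "surplus p \<noteq> []"
  shows "\<exists>q\<in>set (select s ps). set (chosen_site s q) \<subseteq> set (fst p)"
  using assms
proof (induction ps rule: rev_induct)
  case (snoc q ps)
  show ?case
  proof (cases "p = q")
    case True
    have "\<exists>A. valid_piece A p"
      using snoc.prems valid_pieces_ex by blast
    then have "set (chosen_site s p) \<subseteq> set (fst p)"
      using chosen_site(1) snoc.prems(3) by blast
    then show ?thesis
      using True snoc.prems(3) by (auto simp: select_snoc)
  next
    case False
    then show ?thesis
      using snoc by (auto simp: select_snoc valid_pieces_append)
  qed
qed simp

text \<open>One direction is the test made by \<open>select\<close>. The other holds because the
  site of a piece is not covered and so lies in no earlier piece.\<close>

lemma select_separate:
  assumes "valid_pieces A ps"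
  shows "\<forall>p\<in>set (select s ps). \<forall>q\<in>set (select s ps). p \<noteq> q \<longrightarrow>
    \<not> set (chosen_site s q) \<subseteq> set (fst p)" and "distinct (select s ps)"
proof -
  have "(\<forall>p\<in>set (select s ps). \<forall>q\<in>set (select s ps). p \<noteq> q \<longrightarrow>
    \<not> set (chosen_site s q) \<subseteq> set (fst p)) \<and> distinct (select s ps)"
    using assms
  proof (induction ps rule: rev_induct)
    case (snoc p ps)
    then have IH: "\<And>p q. p \<in> set (select s ps) \<Longrightarrow> q \<in> set (select s ps) \<Longrightarrow> p \<noteq> q \<Longrightarrow>
        \<not> set (chosen_site s q) \<subseteq> set (fst p)" and dist: "distinct (select s ps)"
      by (simp_all add: valid_pieces_append)
    show ?case
    proof (cases "surplus p \<noteq> [] \<and> (\<forall>q\<in>set (select s ps). \<not> set (chosen_site s q) \<subseteq> set (fst p))")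
      case True
      have p: "valid_piece (\<lambda>F. A F \<or> (\<exists>u\<in>set ps. F \<subseteq> set (fst u))) p"
        using snoc.prems by (simp add: valid_pieces_append)
      have new: "\<not> set (chosen_site s p) \<subseteq> set (fst q)" if "q \<in> set (select s ps)" for q
      proof
        assume "set (chosen_site s p) \<subseteq> set (fst q)"
        moreover have "q \<in> set ps"
          using that select_subset by blast
        ultimately have "covered (snd p) (set (chosen_site s p))"
          using p chosen_site(1)[OF p] True unfolding valid_piece_def by blast
        then show False
          using chosen_site(3)[OF p] True by blast
      qed
      have "p \<notin> set (select s ps)"
        using chosen_site(1)[OF p] new True by blast
      moreover have "select s (ps @ [p]) = select s ps @ [p]"
        using True by (simp add: select_snoc)
      ultimately show ?thesis
        using IH dist new True by auto
    next
      case False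
      then have "select s (ps @ [p]) = select s ps"
        by (auto simp: select_snoc)
      then show ?thesis
        using IH dist by auto
    qed
  qed (simp add: select_def)
  then show "\<forall>p\<in>set (select s ps). \<forall>q\<in>set (select s ps). p \<noteq> q \<longrightarrow>
    \<not> set (chosen_site s q) \<subseteq> set (fst p)" "distinct (select s ps)"
    by blast+
qed

text \<open>A round subdivides only at sites without new vertices. So a piece without new vertices is split
  into pieces with one new vertex, which may be split once more.\<close>

definition weight :: "'v set \<Rightarrow> nat \<Rightarrow> 'v piece \<Rightarrow> nat" where
  "weight W m p =
     (if set (fst p) \<inter> W = {} then m * m else if card (set (fst p) \<inter> W) = 1 then m else 1)"

text \<open>If the piece contains the site, which has no new vertices and codimension at most one,
  the piece has at most one new vertex. It is replaced by at most \<open>m\<close> children, each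
  with one new vertex more and a weight smaller by the factor \<open>m\<close>.\<close>

lemma weight_split:
  assumes "distinct (fst p)" "length (fst p) \<le> m" "w \<notin> set (fst p)" "w \<in> W" "set \<tau> \<inter> W = {}"
    and \<tau>: "set \<tau> \<subseteq> set (fst p) \<Longrightarrow> length (fst p) \<le> card (set \<tau>) + 1"
  shows "sum_list (map (weight W m) (split \<tau> w p)) \<le> weight W m p"
proof (cases "set \<tau> \<subseteq> set (fst p)")
  case True
  have len: "length (order \<tau> p) \<le> m"
  proof -
    have "length (order \<tau> p) = card (set \<tau>)"
      using distinct_order[OF assms(1)] set_order[OF True] by (metis distinct_card)
    also have "\<dots> \<le> card (set (fst p))"
      using True by (intro card_mono) auto
    also have "\<dots> \<le> m"
      using assms(1,2) by (simp add: distinct_card)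
    finally show ?thesis .
  qed
  have meet: "set (fst (child \<tau> w p e x)) \<inter> W = insert w (set (fst p) \<inter> W)" if "x \<in> set \<tau>" for e x
    using that assms(4,5) by auto
  have bound: "sum_list (map (weight W m) (split \<tau> w p)) \<le> m * k"
    if "\<And>e x. x \<in> set \<tau> \<Longrightarrow> weight W m (child \<tau> w p e x) \<le> k" for k
  proof -
    have "sum_list (map (weight W m) (split \<tau> w p)) \<le> sum_list (map (\<lambda>x. k) (order \<tau> p))"
      using True set_order[OF True] that by (simp add: split_def comp_def) (rule sum_list_mono, simp)
    also have "\<dots> \<le> m * k"
      using len by (simp add: sum_list_triv)
    finally show ?thesis .
  qed
  show ?thesis
  proof (cases "set (fst p) \<inter> W = {}")
    case True
    have "weight W m (child \<tau> w p e x) \<le> m" if "x \<in> set \<tau>" for e x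
      unfolding weight_def meet[OF that] using True by simp
    from bound[OF this] show ?thesis
      using True by (simp add: weight_def)
  next
    case False
    have "set (fst p) \<inter> W \<subseteq> set (fst p) - set \<tau>"
      using assms(5) by blast
    then have "card (set (fst p) \<inter> W) \<le> card (set (fst p) - set \<tau>)"
      by (intro card_mono) auto
    also have "\<dots> \<le> 1"
      using \<tau>[OF True] True assms(1) by (simp add: card_Diff_subset distinct_card)
    finally have card: "card (set (fst p) \<inter> W) = 1"
      using False by (simp add: le_Suc_eq)
    have "weight W m (child \<tau> w p e x) \<le> 1" if "x \<in> set \<tau>" for e x
      unfolding weight_def meet[OF that] using card assms(3) by simp
    from bound[OF this] show ?thesis
      using card False by (simp add: weight_def)
  qed
next
  case False
  then show ?thesis
    by (simp add: split_def)
qed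

lemma sum_list_map_concat:
  fixes f :: "'b \<Rightarrow> nat"
  shows "sum_list (map f (concat xss)) = sum_list (map (\<lambda>xs. sum_list (map f xs)) xss)"
  by (induction xss) auto

lemma weight_ge_1: "0 < m \<Longrightarrow> 1 \<le> weight W m p"
  by (simp add: weight_def)

definition set_steps :: "('v list \<times> 'v) list \<Rightarrow> ('v set \<times> 'v) list" where
  "set_steps = map (\<lambda>(xs, w). (set xs, w))"

section \<open>States reached by valid subdivisions\<close>

lemma valid_steps_snoc:
  assumes "valid_steps K ss steps" "\<tau> \<in> sites s (stellar_seq steps K)"
    "w \<notin> \<Union>(stellar_seq steps K)"
  shows "valid_steps K (ss @ [s]) (steps @ [(\<tau>, w)])"
  using assms by (induction K ss steps rule: valid_steps.induct) (auto simp: stellar_seq_def)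

lemma stellar_seq_snoc: "stellar_seq (steps @ [(\<tau>, w)]) K = stellar \<tau> w (stellar_seq steps K)"
  by (simp add: stellar_seq_def)

text \<open>The offset \<open>n0\<close> lets a program use the numbers above all vertices as new
  vertices, while an arbitrary infinite type supplies an injection with offset 0.\<close>

locale fresh_supply =
  fixes K L :: "'v set set" and fr :: "nat \<Rightarrow> 'v" and n0 :: nat
  assumes KL: "relative_complex K L" and inj: "inj_on fr {n0..}"
    and fresh: "\<And>n. n0 \<le> n \<Longrightarrow> fr n \<notin> \<Union>K"
begin

definition current :: "'v state \<Rightarrow> 'v set set" where
  "current st = stellar_seq (set_steps (fst (snd st))) K"

definition reached :: "site list \<Rightarrow> 'v state \<Rightarrow> bool" where
  "reached ss st \<longleftrightarrow>
     valid_steps K ss (set_steps (fst (snd st))) \<and> simplicial_complex (current st) \<and>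
     L \<subseteq> current st \<and> stellar_seq (set_steps (fst (snd st))) L = L \<and>
     carries (current st) (fst st) \<and> valid_pieces (\<lambda>F. F \<in> L) (fst st) \<and>
     sorted_pieces (fst st) \<and> n0 \<le> snd (snd st) \<and>
     \<Union>(current st) \<subseteq> \<Union>K \<union> fr ` {n0..<snd (snd st)}"

lemma reached_fresh:
  assumes "reached ss st" "snd (snd st) \<le> n"
  shows "fr n \<notin> \<Union>(current st)"
proof -
  have "n0 \<le> n" "n0 \<le> snd (snd st)"
    using assms by (auto simp: reached_def)
  then have "fr n \<notin> fr ` {n0..<snd (snd st)}"
    using assms(2) \<open>n0 \<le> n\<close> inj_onD[OF inj, of n] by fastforce
  then show ?thesis
    using assms(1) fresh[OF \<open>n0 \<le> n\<close>] unfolding reached_def by blast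
qed

lemma reached_piece:
  assumes "reached ss st" "p \<in> set (fst st)"
  shows "set (fst p) \<in> current st" "distinct (fst p)" "fst p \<noteq> []"
    "snd (snd st) \<le> n \<Longrightarrow> fr n \<notin> set (fst p)"
proof -
  show "distinct (fst p)" "fst p \<noteq> []"
    using assms valid_pieces_distinct unfolding reached_def by blast+
  then show "set (fst p) \<in> current st"
    using assms carriesI[of "current st" "fst st" p "set (fst p)"] by (simp add: reached_def)
  then show "snd (snd st) \<le> n \<Longrightarrow> fr n \<notin> set (fst p)"
    using reached_fresh[OF assms(1)] by blast
qed

lemma reached_step:
  assumes st: "reached ss st" and site: "set \<tau> \<in> sites s (current st)" and "set \<tau> \<notin> L"
  shows "reached (ss @ [s]) (step fr \<tau> st)"
proof -
  let ?w = "fr (snd (snd st))"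
  have \<tau>: "set \<tau> \<in> current st" "\<tau> \<noteq> []"
    using site by (cases s; auto simp: facets_def ridges_def)+
  have K': "simplicial_complex (current st)" and L: "simplicial_complex L"
    using st KL by (auto simp: reached_def relative_complex_def)
  have w: "?w \<notin> \<Union>(current st)"
    using reached_fresh[OF st] by simp
  have wL: "?w \<notin> \<Union>L"
    using w st unfolding reached_def by blast
  have steps: "set_steps (fst (snd (step fr \<tau> st))) = set_steps (fst (snd st)) @ [(set \<tau>, ?w)]"
    by (simp add: step_def set_steps_def)
  have cur: "current (step fr \<tau> st) = stellar (set \<tau>) ?w (current st)"
    unfolding current_def steps stellar_seq_snoc ..
  have pieces: "fst (step fr \<tau> st) = concat (map (split \<tau> ?w) (fst st))"
    by (simp add: step_def)
  have "\<not> set \<tau> \<subseteq> F" if "F \<in> L" for F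
    using L that assms(3) unfolding simplicial_complex_def by blast
  then have "L \<subseteq> current (step fr \<tau> st)"
    using st \<tau>(1) unfolding cur stellar_def reached_def by auto
  moreover have "valid_steps K (ss @ [s]) (set_steps (fst (snd (step fr \<tau> st))))"
    unfolding steps
    by (rule valid_steps_snoc) (use st site w in \<open>simp_all add: reached_def current_def\<close>)
  moreover have "stellar_seq (set_steps (fst (snd (step fr \<tau> st)))) L = L"
    using st assms(3) unfolding steps stellar_seq_snoc reached_def by (simp add: stellar_def)
  moreover have "carries (current (step fr \<tau> st)) (fst (step fr \<tau> st))"
    unfolding cur pieces
    by (rule carries_split[OF _ \<tau> w K']) (use st in \<open>simp add: reached_def\<close>)
  moreover have "valid_pieces (\<lambda>F. F \<in> L) (fst (step fr \<tau> st))"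
    unfolding step_def fst_conv
  proof (rule valid_pieces_split)
    show "valid_pieces (\<lambda>F. F \<in> L) (fst st)"
      using st by (simp add: reached_def)
    show "?w \<notin> set (fst p)" if "p \<in> set (fst st)" for p
      using reached_piece(4)[OF st that] by simp
    show "?w \<notin> set \<tau>"
      using w \<tau> by blast
    have "F - {?w} \<union> set \<tau> \<notin> L" for F
      using L assms(3) unfolding simplicial_complex_def by blast
    moreover have "?w \<notin> F" if "F \<in> L" for F
      using wL that by blast
    ultimately show "subdivides (set \<tau>) ?w (\<lambda>F. F \<in> L) (\<lambda>F. F \<in> L)"
      by (auto simp: subdivides_def)
  qed (rule \<tau>)
  moreover have "sorted_pieces (fst (step fr \<tau> st))"
    unfolding step_def fst_conv using st by (intro sorted_pieces_split) (auto simp: reached_def)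
  moreover have "\<Union>(current (step fr \<tau> st)) \<subseteq> \<Union>K \<union> fr ` {n0..<snd (snd (step fr \<tau> st))}"
  proof -
    have "{n0..<Suc (snd (snd st))} = insert (snd (snd st)) {n0..<snd (snd st)}"
      using st by (auto simp: reached_def)
    then show ?thesis
      using Union_stellar[of "set \<tau>" ?w "current st"] st unfolding cur reached_def
      by (simp add: step_def) blast
  qed
  moreover have "n0 \<le> snd (snd (step fr \<tau> st))"
    using st by (simp add: reached_def step_def)
  moreover have "simplicial_complex (current (step fr \<tau> st))"
    unfolding cur by (rule simplicial_complex_stellar[OF K'])
  ultimately show ?thesis
    unfolding reached_def by (intro conjI)
qed

text \<open>An uncovered face belongs neither to \<open>L\<close> nor to an earlier piece.\<close>

lemma reached_sites:
  assumes st: "reached ss st" and p: "p \<in> set (fst st)" "\<not> covered (snd p) (set \<tau>)" "\<tau> \<noteq> []"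
    and \<tau>: "case s of Facet \<Rightarrow> set \<tau> = set (fst p)
      | Ridge \<Rightarrow> \<exists>a\<in>set (fst p). set \<tau> = set (fst p) - {a}"
  shows "set \<tau> \<in> sites s (current st)" "set \<tau> \<notin> L"
proof -
  have st': "carries (current st) (fst st)" "valid_pieces (\<lambda>F. F \<in> L) (fst st)" "sorted_pieces (fst st)"
    using st by (auto simp: reached_def)
  have sub: "set \<tau> \<subseteq> set (fst p)"
    using \<tau> by (cases s) auto
  show "set \<tau> \<in> sites s (current st)"
  proof (cases s)
    case Facet
    then show ?thesis
      using site_Facet[OF st' p(1)] \<tau> by simp
  next
    case Ridge
    then obtain a where a: "a \<in> set (fst p)" "set \<tau> = set (fst p) - {a}"
      using \<tau> by auto
    have "set \<tau> \<noteq> {}"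
      using p(3) by simp
    then show ?thesis
      unfolding Ridge using site_Ridge[OF st' p(1) a(1)] p(2) unfolding a(2) by blast
  qed
  obtain us vs where split: "fst st = us @ p # vs"
    using p(1) by (meson split_list)
  have "valid_piece (\<lambda>F. F \<in> L \<or> (\<exists>u\<in>set us. F \<subseteq> set (fst u))) p"
    by (rule valid_pieces_splitD[OF st'(2)[unfolded split]])
  then show "set \<tau> \<notin> L"
    using p(2) sub unfolding valid_piece_def by blast
qed

text \<open>The invariant within a round, with \<open>us\<close> treated and \<open>vs\<close>
  waiting. A piece that has not improved is an original one without any treated site, so at the end
  of the round it cannot be bad. New vertices are those numbered from the start of this
  round.\<close>

definition mid_round :: "site list \<Rightarrow> site \<Rightarrow> nat \<Rightarrow> nat \<Rightarrow> 'v state \<Rightarrow> 'v piece list \<Rightarrow> 'v piece list \<Rightarrow> 'v state \<Rightarrow> bool" where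
  "mid_round ss s m r st0 us vs st \<longleftrightarrow>
     reached (ss @ replicate (length us) s) st \<and> set vs \<subseteq> set (fst st) \<and>
     (\<forall>q\<in>set (fst st). badness q \<le> r - 1 \<or>
        q \<in> set (fst st0) \<and> (\<forall>u\<in>set us. \<not> set (chosen_site s u) \<subseteq> set (fst q))) \<and>
     (\<forall>q\<in>set (fst st). badness q \<le> r \<and> length (fst q) \<le> m) \<and>
     sum_list (map (weight (fr ` {snd (snd st0)..}) m) (fst st)) \<le> m * m * length (fst st0) \<and>
     length (fst (snd st)) = length (fst (snd st0)) + length us \<and>
     snd (snd st0) \<le> snd (snd st)"

lemma mid_round_step:
  assumes st0: "reached ss st0" and sel: "select s (fst st0) = us @ p # vs"
    and mid: "mid_round ss s m r st0 us (p # vs) st"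
  shows "mid_round ss s m r st0 (us @ [p]) vs (step fr (chosen_site s p) st)"
proof -
  let ?\<tau> = "chosen_site s p" and ?w = "fr (snd (snd st))" and ?W = "fr ` {snd (snd st0)..}"
  let ?st = "step fr ?\<tau> st"
  have st: "reached (ss @ replicate (length us) s) st" and p: "p \<in> set (fst st)"
    and vs: "set vs \<subseteq> set (fst st)" and le: "snd (snd st0) \<le> snd (snd st)"
    and bad: "\<And>q. q \<in> set (fst st) \<Longrightarrow> badness q \<le> r \<and> length (fst q) \<le> m"
    using mid by (auto simp: mid_round_def)
  have st': "valid_pieces (\<lambda>F. F \<in> L) (fst st)" "sorted_pieces (fst st)"
    using st by (auto simp: reached_def)
  have p0: "p \<in> set (fst st0)" "surplus p \<noteq> []"
    using select_subset[of s "fst st0"] sel by auto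
  obtain A where A: "valid_piece A p"
    using valid_pieces_ex[OF st'(1) p] by blast
  note \<tau> = chosen_site[OF A p0(2), of s]
  have w: "?w \<notin> set (fst q)" if "q \<in> set (fst st)" for q
    using reached_piece(4)[OF st that] by simp
  \<comment> \<open>For any other piece around the site, the site is covered. A facet site excludes
    such a piece; for a ridge site the vertex opposite to it is tight.\<close>
  have near: "good_site (set ?\<tau>) q \<and> length (fst q) \<le> card (set ?\<tau>) + 1"
    if q: "q \<in> set (fst st)" "set ?\<tau> \<subseteq> set (fst q)" for q
  proof (cases "q = p")
    case True
    have "length (fst p) \<le> card (set ?\<tau>) + 1"
    proof (cases s)
      case Facet
      then have "set ?\<tau> = set (fst p)"
        using \<tau>(5) by simp
      then show ?thesis
        using reached_piece(2)[OF st p] by (simp add: distinct_card)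
    next
      case Ridge
      then obtain a where "a \<in> set (fst p)" "set ?\<tau> = set (fst p) - {a}"
        using \<tau>(5) by auto
      then show ?thesis
        using reached_piece(2)[OF st p] by (simp add: distinct_card)
    qed
    then show ?thesis
      using True \<tau>(2) by simp
  next
    case False
    have cov: "covered (snd q) (set ?\<tau>)" and len: "length (fst q) \<le> length (fst p)"
      using valid_pieces_face[OF st' p q(1) False \<tau>(1) q(2) \<tau>(3)] by auto
    show ?thesis
    proof (cases s)
      case Facet
      then have "set (fst p) \<subseteq> set (fst q)"
        using \<tau>(5) q(2) by simp
      then show ?thesis
        using valid_pieces_no_subset[OF st' p q(1)] False by blast
    next
      case Ridge
      then obtain a where a: "a \<in> set (fst p)" "set ?\<tau> = set (fst p) - {a}"
        using \<tau>(5) by auto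
      have dist: "distinct (fst p)" "distinct (fst q)"
        using reached_piece(2)[OF st] p q by auto
      then have card: "card (set ?\<tau>) + 1 = length (fst p)"
        using a by (metis List.finite_set Suc_eq_plus1 card.remove distinct_card)
      have "set (fst q) \<noteq> set ?\<tau>"
        using valid_pieces_no_subset[OF st' q(1) p] False a by blast
      then obtain b where b: "b \<in> set (fst q)" "b \<notin> set ?\<tau>"
        using q(2) by blast
      have "set ?\<tau> = set (fst q) - {b}"
      proof (rule card_subset_eq)
        have "card (set ?\<tau>) \<le> card (set (fst q) - {b})"
          using q(2) b by (intro card_mono) auto
        moreover have "card (set (fst q) - {b}) \<le> card (set ?\<tau>)"
          using b len card dist by (simp add: distinct_card)
        ultimately show "card (set ?\<tau>) = card (set (fst q) - {b})"
          by simp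
      qed (use q(2) b in auto)
      then have "good_site (set ?\<tau>) q"
        using cov b unfolding good_site_def by (auto simp: set_tight)
      then show ?thesis
        using len card by simp
    qed
  qed
  have children: "badness c \<le> badness q - 1" if q: "q \<in> set (fst st)" "set ?\<tau> \<subseteq> set (fst q)"
    "c \<in> set (split ?\<tau> ?w q)" for q c
  proof -
    obtain B where "valid_piece B q"
      using valid_pieces_ex[OF st'(1) q(1)] by blast
    then show ?thesis
      using badness_split[OF _ w[OF q(1)] _ q(3)] near[OF q(1,2)] by blast
  qed
  have pieces: "fst ?st = concat (map (split ?\<tau> ?w) (fst st))"
    by (simp add: step_def)
  have step_ok: "reached (ss @ replicate (length (us @ [p])) s) ?st"
  proof -
    have "reached ((ss @ replicate (length us) s) @ [s]) ?st"
      using reached_sites[OF st p \<tau>(3,4,5)] by (intro reached_step[OF st]) 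
    then show ?thesis
      by (simp add: replicate_append_same)
  qed
  \<comment> \<open>Selected sites are separate, so the waiting pieces are left untouched.\<close>
  have sep: "\<not> set ?\<tau> \<subseteq> set (fst q)" if "q \<in> set vs" for q
  proof -
    have "q \<noteq> p" "q \<in> set (select s (fst st0))" "p \<in> set (select s (fst st0))"
      using select_separate(2)[of "\<lambda>F. F \<in> L" "fst st0" s] st0 that sel by (auto simp: reached_def)
    then show ?thesis
      using select_separate(1)[of "\<lambda>F. F \<in> L" "fst st0" s] st0 by (auto simp: reached_def)
  qed
  have "q \<in> set (fst ?st)" if "q \<in> set vs" for q
    using sep[OF that] vs that unfolding pieces by (force simp: split_def)
  moreover have "badness c \<le> r - 1 \<or>
        c \<in> set (fst st0) \<and> (\<forall>u\<in>set (us @ [p]). \<not> set (chosen_site s u) \<subseteq> set (fst c))"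
    if "c \<in> set (fst ?st)" for c
  proof -
    obtain q where q: "q \<in> set (fst st)" "c \<in> set (split ?\<tau> ?w q)"
      using \<open>c \<in> set (fst ?st)\<close> unfolding pieces by auto
    show ?thesis
    proof (cases "set ?\<tau> \<subseteq> set (fst q)")
      case True
      then show ?thesis
        using children[OF q(1) True q(2)] bad[OF q(1)] by linarith
    next
      case False
      then have "c = q"
        using q(2) by (simp add: split_def)
      then show ?thesis
        using mid False q(1) unfolding mid_round_def by auto
    qed
  qed
  moreover have "badness c \<le> r \<and> length (fst c) \<le> m" if "c \<in> set (fst ?st)" for c
  proof -
    obtain q where q: "q \<in> set (fst st)" "c \<in> set (split ?\<tau> ?w q)"
      using \<open>c \<in> set (fst ?st)\<close> unfolding pieces by auto
    have "length (fst c) = length (fst q)"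
      using length_split[OF q(2)] reached_piece(2)[OF st q(1)] by simp
    moreover have "badness c \<le> badness q"
    proof (cases "set ?\<tau> \<subseteq> set (fst q)")
      case True
      then show ?thesis
        using children[OF q(1) True q(2)] by linarith
    next
      case False
      then show ?thesis
        using q(2) by (simp add: split_def)
    qed
    ultimately show ?thesis
      using bad[OF q(1)] by simp
  qed
  moreover have "sum_list (map (weight ?W m) (fst ?st)) \<le> m * m * length (fst st0)"
  proof -
    \<comment> \<open>The site consists of vertices of an original piece, hence of old ones.\<close>
    have "set ?\<tau> \<inter> ?W = {}"
      using \<tau>(1) reached_piece(4)[OF st0 p0(1)] by auto
    moreover have "?w \<in> ?W"
      using le by simp
    ultimately have "sum_list (map (weight ?W m) (split ?\<tau> ?w q)) \<le> weight ?W m q"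
      if "q \<in> set (fst st)" for q
      using reached_piece(2)[OF st that] bad[OF that] w[OF that] near[OF that] by (intro weight_split) auto
    then have "sum_list (map (\<lambda>q. sum_list (map (weight ?W m) (split ?\<tau> ?w q))) (fst st)) \<le>
        sum_list (map (weight ?W m) (fst st))"
      by (rule sum_list_mono)
    also have "\<dots> \<le> m * m * length (fst st0)"
      using mid by (simp add: mid_round_def)
    finally show ?thesis
      unfolding pieces by (simp add: sum_list_map_concat comp_def)
  qed
  ultimately show ?thesis
    unfolding mid_round_def using step_ok mid le by (auto simp: step_def mid_round_def)
qed

lemma mid_round:
  assumes st0: "reached ss st0" and bad: "\<And>q. q \<in> set (fst st0) \<Longrightarrow> badness q \<le> r \<and> length (fst q) \<le> m"
    and sel: "select s (fst st0) = us @ vs"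
  shows "mid_round ss s m r st0 us vs (fold (\<lambda>p. step fr (chosen_site s p)) us st0)"
  using sel
proof (induction us arbitrary: vs rule: rev_induct)
  case Nil
  \<comment> \<open>At the start of the round no piece has a new vertex, so all weights are
    maximal.\<close>
  have "weight (fr ` {snd (snd st0)..}) m q = m * m" if "q \<in> set (fst st0)" for q
    using reached_piece(4)[OF st0 that] by (auto simp: weight_def)
  then have "sum_list (map (weight (fr ` {snd (snd st0)..}) m) (fst st0)) = m * m * length (fst st0)"
    by (simp add: sum_list_triv cong: map_cong)
  then show ?case
    using st0 bad select_subset[of s "fst st0"] Nil by (auto simp: mid_round_def)
next
  case (snoc p us)
  then have "mid_round ss s m r st0 us (p # vs) (fold (\<lambda>p. step fr (chosen_site s p)) us st0)"
    by simp
  then show ?case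
    using mid_round_step[OF st0, of s us p vs] snoc.prems by simp
qed

lemma mid_round_length:
  assumes "mid_round ss s m r st0 us vs st" "0 < m"
  shows "length (fst st) \<le> m * m * length (fst st0)"
proof -
  have "length (fst st) = sum_list (map (\<lambda>q. 1) (fst st))"
    by (simp add: sum_list_triv)
  also have "\<dots> \<le> sum_list (map (weight (fr ` {snd (snd st0)..}) m) (fst st))"
    by (rule sum_list_mono) (rule weight_ge_1[OF assms(2)])
  also have "\<dots> \<le> m * m * length (fst st0)"
    using assms(1) by (simp add: mid_round_def)
  finally show ?thesis .
qed

lemma round_reached:
  assumes st0: "reached ss st0" and bad: "\<And>q. q \<in> set (fst st0) \<Longrightarrow> badness q \<le> r \<and> length (fst q) \<le> m"
  shows "\<exists>k. reached (ss @ replicate k s) (round s fr st0)"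
    and "q \<in> set (fst (round s fr st0)) \<Longrightarrow> badness q \<le> r - 1 \<and> length (fst q) \<le> m"
proof -
  have mid: "mid_round ss s m r st0 (select s (fst st0)) [] (round s fr st0)"
    unfolding round_def by (rule mid_round[OF st0 bad]) simp_all
  then show "\<exists>k. reached (ss @ replicate k s) (round s fr st0)"
    unfolding mid_round_def by blast
  assume q: "q \<in> set (fst (round s fr st0))"
  \<comment> \<open>Every bad original piece contains a selected site.\<close>
  have "badness q = 0" if "q \<in> set (fst st0)"
    "\<forall>u\<in>set (select s (fst st0)). \<not> set (chosen_site s u) \<subseteq> set (fst q)"
  proof -
    have "valid_pieces (\<lambda>F. F \<in> L) (fst st0)"
      using st0 by (simp add: reached_def)
    then show ?thesis
      using select_complete[of _ "fst st0" q s] that badness_eq_0 by blast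
  qed
  then show "badness q \<le> r - 1 \<and> length (fst q) \<le> m"
    using mid q unfolding mid_round_def by force
qed

lemma rounds_reached:
  assumes "reached ss st0" "\<And>q. q \<in> set (fst st0) \<Longrightarrow> badness q \<le> r \<and> length (fst q) \<le> m"
  shows "(\<exists>k. reached (ss @ replicate k s) ((round s fr ^^ j) st0)) \<and>
    (\<forall>q\<in>set (fst ((round s fr ^^ j) st0)). badness q \<le> r - j \<and> length (fst q) \<le> m)"
proof (induction j)
  case 0
  have "reached (ss @ replicate 0 s) st0"
    using assms(1) by simp
  then show ?case
    using assms(2) by (metis diff_zero funpow_0)
next
  case (Suc j)
  then obtain k where k: "reached (ss @ replicate k s) ((round s fr ^^ j) st0)"
    and bad: "\<And>q. q \<in> set (fst ((round s fr ^^ j) st0)) \<Longrightarrow> badness q \<le> r - j \<and> length (fst q) \<le> m"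
    by blast
  obtain k' where "reached ((ss @ replicate k s) @ replicate k' s) ((round s fr ^^ Suc j) st0)"
    using round_reached(1)[OF k bad] by auto
  then have "reached (ss @ replicate (k + k') s) ((round s fr ^^ Suc j) st0)"
    by (simp add: replicate_add)
  moreover have "\<forall>q\<in>set (fst ((round s fr ^^ Suc j) st0)). badness q \<le> r - Suc j \<and> length (fst q) \<le> m"
    using round_reached(2)[OF k bad] by simp
  ultimately show ?case
    by blast
qed

section \<open>Growth in a single step, and the forced mixture of sites\<close>

lemma step_bounds:
  assumes st: "reached ss st" and m: "\<And>q. q \<in> set (fst st) \<Longrightarrow> length (fst q) \<le> m"
  shows "\<forall>p\<in>set (fst (step fr \<tau> st)). length (fst p) \<le> m"
    and "length (fst (step fr \<tau> st)) \<le> Suc m * length (fst st)"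
proof -
  show "\<forall>p\<in>set (fst (step fr \<tau> st)). length (fst p) \<le> m"
  proof
    fix p assume "p \<in> set (fst (step fr \<tau> st))"
    then obtain q where q: "q \<in> set (fst st)" "p \<in> set (split \<tau> (fr (snd (snd st))) q)"
      by (auto simp: step_def)
    then show "length (fst p) \<le> m"
      using length_split[OF q(2) reached_piece(2)[OF st q(1)]] m[OF q(1)] by simp
  qed
  have "length (split \<tau> w q) \<le> Suc m" if q: "q \<in> set (fst st)" for q w
  proof (cases "set \<tau> \<subseteq> set (fst q)")
    case True
    have dist: "distinct (fst q)"
      by (rule reached_piece(2)[OF st q])
    have "length (order \<tau> q) = card (set \<tau>)"
      using distinct_order[OF dist] set_order[OF True] by (metis distinct_card)
    also have "\<dots> \<le> card (set (fst q))"
      using True by (intro card_mono) auto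
    also have "\<dots> \<le> m"
      using m[OF q] dist by (simp add: distinct_card)
    finally show ?thesis
      using True by (simp add: split_def)
  next
    case False
    then show ?thesis
      by (simp add: split_def)
  qed
  then have "sum_list (map (\<lambda>q. length (split \<tau> w q)) (fst st)) \<le> sum_list (map (\<lambda>q. Suc m) (fst st))" for w
    by (intro sum_list_mono)
  then show "length (fst (step fr \<tau> st)) \<le> Suc m * length (fst st)"
    by (simp add: step_def length_concat comp_def sum_list_triv mult.commute)
qed

lemma force_reached:
  assumes st: "reached [] st" and big: "\<sigma> \<in> current st" "2 \<le> card \<sigma>"
  shows "reached [Facet, Ridge] (force fr st)"
    and "\<exists>\<tau> \<tau>'. reached [Facet] (step fr \<tau> st) \<and> force fr st = step fr \<tau>' (step fr \<tau> st)"
    and "fst (step fr (fst (hd (fst st))) st) \<noteq> []"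
    and "tl (fst (hd (fst (step fr (fst (hd (fst st))) st)))) \<noteq> []"
proof -
  have st': "carries (current st) (fst st)" "valid_pieces (\<lambda>F. F \<in> L) (fst st)" "sorted_pieces (fst st)"
    using st by (auto simp: reached_def)
  obtain q where q: "q \<in> set (fst st)" "\<sigma> \<subseteq> set (fst q)"
    using carriesD[OF st'(1) big(1)] big(2) by fastforce
  then obtain p ps where ps: "fst st = p # ps"
    by (cases "fst st") auto
  have p: "p \<in> set (fst st)"
    by (simp add: ps)
  \<comment> \<open>The pieces come in decreasing dimension, so an edge anywhere gives the first
    piece at least two vertices.\<close>
  have "card \<sigma> \<le> length (fst q)"
    using q(2) by (meson card_length card_mono List.finite_set order_trans)
  also have "\<dots> \<le> length (fst p)"
    using st'(3) q(1) unfolding sorted_pieces_def ps by auto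
  finally have len: "2 \<le> length (fst p)"
    using big(2) by simp
  have dist: "distinct (fst p)"
    using reached_piece(2)[OF st p] .
  obtain A where A: "valid_piece A p"
    using valid_pieces_ex[OF st'(2) p] by blast
  have "\<not> covered (snd p) (set (fst p))" "fst p \<noteq> []"
    using A by (auto simp: valid_piece_def)
  then have site: "set (fst p) \<in> sites Facet (current st)" "set (fst p) \<notin> L"
    using reached_sites[OF st p, of "fst p" Facet] by auto
  let ?w = "fr (snd (snd st))"
  let ?st1 = "step fr (fst p) st"
  let ?q = "fst (hd (fst ?st1))"
  have st1: "reached [Facet] ?st1"
    using reached_step[OF st site] by simp
  obtain x xs where x: "order (fst p) p = x # xs"
    using set_order[of "fst p" p] \<open>fst p \<noteq> []\<close> by (cases "order (fst p) p") auto
  then have "x \<in> set (fst p)"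
    using set_order[of "fst p" p] by auto
  have "fst ?st1 = child (fst p) ?w p [] x # tl (fst ?st1)"
    unfolding step_def ps by (simp add: split_def x)
  then have hd1: "hd (fst ?st1) = child (fst p) ?w p [] x" "hd (fst ?st1) \<in> set (fst ?st1)"
    by (metis list.sel(1), metis list.sel(1) list.set_intros(1))
  then have q: "?q = ?w # removeAll x (fst p)"
    by simp
  have "length (removeAll x (fst p)) = length (fst p) - 1"
    using dist \<open>x \<in> set (fst p)\<close> by (metis distinct_remove1_removeAll length_remove1)
  then obtain a as where a: "removeAll x (fst p) = a # as"
    using len by (cases "removeAll x (fst p)") auto
  have "?w \<noteq> a"
  proof -
    have "a \<in> set (fst p)"
      using a by (metis DiffD1 list.set_intros(1) set_removeAll)
    then show ?thesis
      using reached_piece(4)[OF st p] by auto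
  qed
  let ?\<tau> = "removeAll (hd (tl ?q)) ?q"
  have "hd (tl ?q) = a" "a \<in> set ?q" "?w \<in> set ?q"
    by (simp_all only: q a list.sel list.set insert_iff simp_thms)
  then have \<tau>: "set ?\<tau> = set ?q - {a}" "?w \<in> set ?\<tau>" "a \<in> set ?q"
    using \<open>?w \<noteq> a\<close> by (simp_all only: set_removeAll Diff_iff singleton_iff simp_thms)
  have "?w \<notin> \<Union>L"
    using reached_fresh[OF st, of "snd (snd st)"] st unfolding reached_def by auto
  then have "set ?\<tau> \<notin> L"
    using \<tau>(2) by blast
  \<comment> \<open>The first piece has no predecessors, so being uncovered there just means not
    belonging to \<open>L\<close>.\<close>
  moreover have "valid_piece (\<lambda>F. F \<in> L) (hd (fst ?st1))"
    using st1 hd1(2) by (cases "fst ?st1") (auto simp: reached_def)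
  moreover have "set ?\<tau> \<subseteq> set ?q"
    unfolding \<tau>(1) by (rule Diff_subset)
  ultimately have cov: "\<not> covered (snd (hd (fst ?st1))) (set ?\<tau>)"
    unfolding valid_piece_def by blast
  have ne: "?\<tau> \<noteq> []"
    using \<tau>(2) by (metis empty_iff empty_set)
  have ridge: "\<exists>a\<in>set ?q. set ?\<tau> = set ?q - {a}"
    using \<tau>(1,3) by (rule bexI)
  have "reached ([Facet] @ [Ridge]) (step fr ?\<tau> ?st1)"
    by (rule reached_step[OF st1 reached_sites[OF st1 hd1(2) cov ne, where s = Ridge, unfolded site.case, OF ridge]])
  moreover have force: "force fr st = step fr ?\<tau> ?st1"
  proof -
    have "tl (fst p) \<noteq> []"
      using len by (cases "fst p") auto
    then show ?thesis
      by (simp add: force_def Let_def ps)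
  qed
  ultimately show "reached [Facet, Ridge] (force fr st)"
    by simp
  show "\<exists>\<tau> \<tau>'. reached [Facet] (step fr \<tau> st) \<and> force fr st = step fr \<tau>' (step fr \<tau> st)"
    using st1 force by blast
  show "fst (step fr (fst (hd (fst st))) st) \<noteq> []"
    "tl (fst (hd (fst (step fr (fst (hd (fst st))) st)))) \<noteq> []"
    using hd1(2) q a by (auto simp: ps)
qed

lemma force_bounds:
  assumes st: "reached [] st" and m: "\<And>q. q \<in> set (fst st) \<Longrightarrow> length (fst q) \<le> m"
    and big: "\<sigma> \<in> current st" "2 \<le> card \<sigma>"
  shows "\<forall>q\<in>set (fst (force fr st)). length (fst q) \<le> m"
    and "length (fst (force fr st)) \<le> Suc m * (Suc m * length (fst st))"
    and "length (fst (snd (force fr st))) \<le> length (fst (snd st)) + 2"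
proof -
  obtain \<tau> \<tau>' where 1: "reached [Facet] (step fr \<tau> st)" and 2: "force fr st = step fr \<tau>' (step fr \<tau> st)"
    using force_reached(2)[OF st big] by blast
  note b1 = step_bounds[OF st m, of \<tau>]
  have m1: "\<And>q. q \<in> set (fst (step fr \<tau> st)) \<Longrightarrow> length (fst q) \<le> m"
    using b1(1) by blast
  note b2 = step_bounds[OF 1 m1, of \<tau>']
  show "\<forall>q\<in>set (fst (force fr st)). length (fst q) \<le> m"
    unfolding 2 by (rule b2(1))
  have "length (fst (force fr st)) \<le> Suc m * length (fst (step fr \<tau> st))"
    unfolding 2 by (rule b2(2))
  also have "\<dots> \<le> Suc m * (Suc m * length (fst st))"
    by (rule mult_le_mono2[OF b1(2)])
  finally show "length (fst (force fr st)) \<le> Suc m * (Suc m * length (fst st))" .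
  show "length (fst (snd (force fr st))) \<le> length (fst (snd st)) + 2"
    unfolding 2 by (simp add: step_def)
qed

lemma initial_reached:
  assumes "\<And>\<sigma>. \<sigma> \<in> K \<Longrightarrow> card \<sigma> \<le> d + 1" "listing xs K" "listing ys L"
  shows "reached [] (initial ys (by_dim d xs), [], n0)"
    and "current (initial ys (by_dim d xs), [], n0) = K"
  using initial_pieces[OF KL assms] KL
  by (auto simp: reached_def current_def set_steps_def stellar_seq_def relative_complex_def)

lemma subdivide_reached:
  fixes d :: nat and m :: mode and xs ys :: "'v list list"
  assumes d: "\<And>\<sigma>. \<sigma> \<in> K \<Longrightarrow> card \<sigma> \<le> d + 1" and xs: "listing xs K" and ys: "listing ys L"
  defines "st \<equiv> subdivide d m fr n0 xs ys"
  shows "subdivision_seq m K (set_steps (fst (snd st)))"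
    and "h_shelling (stellar_seq (set_steps (fst (snd st))) K) (stellar_seq (set_steps (fst (snd st))) L)
      (tiles_of id (map tile_of (fst st)))"
proof -
  let ?st0 = "(initial ys (by_dim d xs), [], n0) :: 'v state"
  let ?st1 = "if m = Mixed then force fr ?st0 else ?st0"
  note init = initial_reached[OF d xs ys]
  have len0: "length (fst q) \<le> d + 1" if "q \<in> set (fst ?st0)" for q
    using reached_piece(1,2)[OF init(1) that] d[of "set (fst q)"] init(2) by (simp add: distinct_card)
  obtain ss where ss: "reached ss ?st1" "\<forall>q\<in>set (fst ?st1). length (fst q) \<le> d + 1"
    "set ss \<subseteq> {Facet, Ridge}" "m \<noteq> Mixed \<Longrightarrow> ss = []"
    "m = Mixed \<Longrightarrow> \<exists>\<sigma>\<in>K. 2 \<le> card \<sigma> \<Longrightarrow> ss = [Facet, Ridge]"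
  proof (cases "m = Mixed \<and> (\<exists>\<sigma>\<in>K. 2 \<le> card \<sigma>)")
    case True
    then obtain \<sigma> where \<sigma>: "\<sigma> \<in> current ?st0" "2 \<le> card \<sigma>"
      using init(2) by auto
    then show ?thesis
      using that[of "[Facet, Ridge]"] force_reached(1)[OF init(1) \<sigma>] force_bounds(1)[OF init(1) len0 \<sigma>] True
      by simp
  next
    case False
    \<comment> \<open>In mixed mode this is the case without edges: all pieces are single vertices,
      \<open>force\<close> does nothing, and the pattern makes no demand on the sites.\<close>
    have "?st1 = ?st0"
    proof (cases "m = Mixed")
      case True
      have "tl (fst p) = []" if "p \<in> set (fst ?st0)" for p
      proof -
        have "\<not> 2 \<le> card (set (fst p))"
          using False True reached_piece(1)[OF init(1) that] init(2) by auto
        then have "length (fst p) \<le> 1"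
          using reached_piece(2)[OF init(1) that] by (simp add: distinct_card)
        then show ?thesis
          by (cases "fst p") auto
      qed
      then have "fst ?st0 = [] \<or> tl (fst (hd (fst ?st0))) = []"
        by (metis hd_in_set)
      then show ?thesis
        unfolding force_def by simp
    qed simp
    then show ?thesis
      using that[of "[]"] init(1) len0 False by auto
  qed
  have bad: "badness q \<le> 2 ^ Suc d \<and> length (fst q) \<le> d + 1" if "q \<in> set (fst ?st1)" for q
  proof -
    have "length (fst q) \<le> d + 1"
      using ss(2) that by blast
    then have "badness q \<le> 2 ^ Suc d"
      using badness_le[of q] power_increasing[of "length (fst q)" "Suc d" "2 :: nat"] by linarith
    then show ?thesis
      using \<open>length (fst q) \<le> d + 1\<close> by blast
  qed
  have st: "st = (round (kind m) fr ^^ (2 ^ Suc d)) ?st1"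
    by (simp add: st_def subdivide_def)
  note rounds = rounds_reached[OF ss(1) bad, of "kind m" "2 ^ Suc d", folded st]
  obtain k where k: "reached (ss @ replicate k (kind m)) st"
    using rounds by blast
  have good: "surplus q = []" if "q \<in> set (fst st)" for q
    using rounds that badness_eq_0[of q] by auto
  have "site_pattern m K (ss @ replicate k (kind m))"
  proof (cases m)
    case Mixed
    then show ?thesis
      using ss(5) by (auto simp: kind_def)
  qed (use ss(4) in \<open>auto simp: kind_def\<close>)
  moreover have "valid_steps K (ss @ replicate k (kind m)) (set_steps (fst (snd st)))"
    using k by (simp add: reached_def)
  ultimately show "subdivision_seq m K (set_steps (fst (snd st)))"
    unfolding subdivision_seq_def by (intro exI conjI)
  have L: "stellar_seq (set_steps (fst (snd st))) L = L" "simplicial_complex L"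
    using k KL by (auto simp: reached_def relative_complex_def)
  show "h_shelling (stellar_seq (set_steps (fst (snd st))) K) (stellar_seq (set_steps (fst (snd st))) L)
      (tiles_of id (map tile_of (fst st)))"
    unfolding L(1) current_def[symmetric]
    by (rule h_shelling_if_no_surplus[OF _ L(2)]) (use k good in \<open>auto simp: reached_def\<close>)
qed

end

section \<open>Timed computability\<close>

text \<open>Only an upper bound of the time is tracked, so that costs may be rounded up when
  programs are combined.\<close>

definition evalb :: "exp list \<Rightarrow> val \<Rightarrow> exp \<Rightarrow> val \<Rightarrow> nat \<Rightarrow> bool" where
  "evalb P a e v T \<longleftrightarrow> (\<exists>t\<le>T. eval_exp P a e v t)"

lemma evalb_mono: "evalb P a e v T \<Longrightarrow> T \<le> T' \<Longrightarrow> evalb P a e v T'"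
  unfolding evalb_def by (meson order_trans)

lemma evalb_Arg: "evalb P a Arg a 1"
  unfolding evalb_def by (blast intro: eval_exp.intros)

lemma evalb_Const: "evalb P a (Const m) (Num m) 1"
  unfolding evalb_def by (blast intro: eval_exp.intros)

lemma evalb_Succ: "evalb P a e v T \<Longrightarrow> evalb P a (Succ e) (v_succ v) (T + 1)"
  unfolding evalb_def by (metis add_le_mono1 eval_exp.intros(3))

lemma evalb_First: "evalb P a e v T \<Longrightarrow> evalb P a (First e) (v_first v) (T + 1)"
  unfolding evalb_def by (metis add_le_mono1 eval_exp.intros(7))

lemma evalb_Second: "evalb P a e v T \<Longrightarrow> evalb P a (Second e) (v_second v) (T + 1)"
  unfolding evalb_def by (metis add_le_mono1 eval_exp.intros(8))

lemma evalb_IsCell: "evalb P a e v T \<Longrightarrow> evalb P a (IsCell e) (v_iscell v) (T + 1)"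
  unfolding evalb_def by (metis add_le_mono1 eval_exp.intros(9))

lemma evalb_Less:
  "evalb P a e v T \<Longrightarrow> evalb P a e' v' T' \<Longrightarrow> evalb P a (Less e e') (v_less v v') (T + T' + 1)"
  unfolding evalb_def by (metis add_le_mono add_le_mono1 eval_exp.intros(4))

lemma evalb_Same:
  "evalb P a e v T \<Longrightarrow> evalb P a e' v' T' \<Longrightarrow> evalb P a (Same e e') (v_same v v') (T + T' + 1)"
  unfolding evalb_def by (metis add_le_mono add_le_mono1 eval_exp.intros(5))

lemma evalb_MkCell:
  "evalb P a e v T \<Longrightarrow> evalb P a e' v' T' \<Longrightarrow> evalb P a (MkCell e e') (Cell v v') (T + T' + 1)"
  unfolding evalb_def by (metis add_le_mono add_le_mono1 eval_exp.intros(6))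

lemma evalb_IfNZ_true:
  "evalb P a e v T \<Longrightarrow> v \<noteq> Num 0 \<Longrightarrow> evalb P a e1 v' T' \<Longrightarrow>
    evalb P a (IfNZ e e1 e2) v' (T + T' + 1)"
  unfolding evalb_def by (metis add_le_mono add_le_mono1 eval_exp.intros(10))

lemma evalb_IfNZ_false:
  "evalb P a e (Num 0) T \<Longrightarrow> evalb P a e2 v' T' \<Longrightarrow> evalb P a (IfNZ e e1 e2) v' (T + T' + 1)"
  unfolding evalb_def by (metis add_le_mono add_le_mono1 eval_exp.intros(11))

lemma evalb_Call:
  "evalb P a e v T \<Longrightarrow> f < length P \<Longrightarrow> evalb P v (P ! f) v' T' \<Longrightarrow>
    evalb P a (Call f e) v' (T + T' + 1)"
  unfolding evalb_def by (metis add_le_mono add_le_mono1 eval_exp.intros(12))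

text \<open>Relocates the calls of a program, so that two lists of functions can be put one after
  the other.\<close>

primrec shift :: "nat \<Rightarrow> exp \<Rightarrow> exp" where
  "shift n Arg = Arg"
| "shift n (Const m) = Const m"
| "shift n (Succ e) = Succ (shift n e)"
| "shift n (Less e e') = Less (shift n e) (shift n e')"
| "shift n (Same e e') = Same (shift n e) (shift n e')"
| "shift n (MkCell e e') = MkCell (shift n e) (shift n e')"
| "shift n (First e) = First (shift n e)"
| "shift n (Second e) = Second (shift n e)"
| "shift n (IsCell e) = IsCell (shift n e)"
| "shift n (IfNZ e e1 e2) = IfNZ (shift n e) (shift n e1) (shift n e2)"
| "shift n (Call f e) = Call (f + n) (shift n e)"

lemma eval_exp_shift:
  "eval_exp Q a e v t \<Longrightarrow> eval_exp (P @ map (shift (length P)) Q @ R) a (shift (length P) e) v t"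
proof (induction rule: eval_exp.induct)
  case (12 a e v t f v' t')
  have "(P @ map (shift (length P)) Q @ R) ! (f + length P) = shift (length P) (Q ! f)"
    using 12 by (simp add: nth_append)
  then show ?case
    using 12 eval_exp.intros(12)[of "P @ map (shift (length P)) Q @ R" a "shift (length P) e" v t
        "f + length P" v' t'] by simp
qed (simp only: shift.simps, blast intro: eval_exp.intros)+

lemma evalb_shift:
  "evalb Q a e v T \<Longrightarrow> evalb (P @ map (shift (length P)) Q @ R) a (shift (length P) e) v T"
  unfolding evalb_def using eval_exp_shift by blast

lemma eval_exp_append: "eval_exp P a e v t \<Longrightarrow> eval_exp (P @ R) a e v t"
proof (induction rule: eval_exp.induct)
  case (12 a e v t f v' t')
  then show ?case
    using eval_exp.intros(12)[of "P @ R" a e v t f v' t'] by (simp add: nth_append)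
qed (blast intro: eval_exp.intros)+

lemma evalb_append: "evalb P a e v T \<Longrightarrow> evalb (P @ R) a e v T"
  unfolding evalb_def using eval_exp_append by blast

text \<open>The result is given by an expression over a list of functions, so that primitives
  combine by nesting. \<open>D\<close> serves as a precondition, and \<open>b\<close> gives the
  order of growth of the time: the square of the input size expresses quadratic time.\<close>

definition computable ::
    "('a \<Rightarrow> val) \<Rightarrow> ('b \<Rightarrow> val) \<Rightarrow> 'a set \<Rightarrow> ('a \<Rightarrow> nat) \<Rightarrow> ('a \<Rightarrow> 'b) \<Rightarrow> bool" where
  "computable ea eb D b f \<longleftrightarrow>
     (\<exists>P e c. \<forall>x\<in>D. evalb P (ea x) e (eb (f x)) (c * Suc (b x)))"

definition bounded_by :: "'a set \<Rightarrow> ('a \<Rightarrow> nat) \<Rightarrow> ('a \<Rightarrow> nat) \<Rightarrow> bool" where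
  "bounded_by D b f \<longleftrightarrow> (\<exists>k. \<forall>x\<in>D. f x \<le> k * Suc (b x))"

lemma bounded_by_const: "(\<And>x. x \<in> D \<Longrightarrow> f x \<le> m) \<Longrightarrow> bounded_by D b f"
  unfolding bounded_by_def by (rule exI[of _ m]) (metis le_add1 mult_Suc_right order_trans)

lemma bounded_byI: "(\<And>x. x \<in> D \<Longrightarrow> f x \<le> k * Suc (b x)) \<Longrightarrow> bounded_by D b f"
  unfolding bounded_by_def by blast

text \<open>Two computations are put over a common list of functions and a common constant.\<close>

lemma computableE2:
  assumes "computable ea eb D b f" "computable ea' ec D' b' g"
  obtains P e e' c where "\<And>x. x \<in> D \<Longrightarrow> evalb P (ea x) e (eb (f x)) (c * Suc (b x))"
    "\<And>x. x \<in> D' \<Longrightarrow> evalb P (ea' x) e' (ec (g x)) (c * Suc (b' x))"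
proof -
  obtain P e c where 1: "\<And>x. x \<in> D \<Longrightarrow> evalb P (ea x) e (eb (f x)) (c * Suc (b x))"
    using assms(1) unfolding computable_def by blast
  obtain P' e' c' where 2: "\<And>x. x \<in> D' \<Longrightarrow> evalb P' (ea' x) e' (ec (g x)) (c' * Suc (b' x))"
    using assms(2) unfolding computable_def by blast
  let ?P = "P @ map (shift (length P)) P'"
  have "evalb ?P (ea x) e (eb (f x)) (max c c' * Suc (b x))" if "x \<in> D" for x
    by (rule evalb_mono[OF evalb_append[OF 1[OF that]]]) (rule mult_le_mono1, simp)
  moreover have "evalb ?P (ea' x) (shift (length P) e') (ec (g x)) (max c c' * Suc (b' x))"
    if "x \<in> D'" for x
    by (rule evalb_mono[OF evalb_shift[OF 2[OF that], of P "[]", simplified append_Nil2]])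
      (rule mult_le_mono1, simp)
  ultimately show thesis
    using that by blast
qed

lemma computableI:
  "(\<And>x. x \<in> D \<Longrightarrow> evalb P (ea x) e (eb (f x)) (T x)) \<Longrightarrow> (\<And>x. x \<in> D \<Longrightarrow> T x \<le> c * Suc (b x)) \<Longrightarrow>
    computable ea eb D b f"
  unfolding computable_def using evalb_mono by blast

lemma computable_subset: "computable ea eb D b f \<Longrightarrow> D' \<subseteq> D \<Longrightarrow> computable ea eb D' b f"
  unfolding computable_def by blast

lemma computable_cong:
  "computable ea eb D b f \<Longrightarrow> (\<And>x. x \<in> D \<Longrightarrow> f x = g x) \<Longrightarrow> computable ea eb D b g"
  unfolding computable_def by metis

lemma computable_id: "computable ea ea D b (\<lambda>x. x)"
  by (rule computableI[where T = "\<lambda>_. 1" and c = 1]) (rule evalb_Arg, simp)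

lemma computable_op1:
  assumes "computable ea eb D b f"
    and op: "\<And>P a e v T. evalb P a e v T \<Longrightarrow> evalb P a (E e) (F v) (T + 1)"
    and g: "\<And>x. x \<in> D \<Longrightarrow> F (eb (f x)) = ec (g x)"
  shows "computable ea ec D b g"
proof -
  obtain P e c where *: "\<And>x. x \<in> D \<Longrightarrow> evalb P (ea x) e (eb (f x)) (c * Suc (b x))"
    using assms(1) unfolding computable_def by blast
  show ?thesis
  proof (rule computableI)
    show "evalb P (ea x) (E e) (ec (g x)) (c * Suc (b x) + 1)" if "x \<in> D" for x
      using op[OF *[OF that]] by (simp only: g[OF that])
    show "c * Suc (b x) + 1 \<le> (c + 1) * Suc (b x)" for x
      by simp
  qed
qed

lemma computable_op2:
  assumes "computable ea eb D b f" "computable ea eb' D b f'"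
    and op: "\<And>P a e e' v v' T T'. evalb P a e v T \<Longrightarrow> evalb P a e' v' T' \<Longrightarrow>
      evalb P a (E e e') (F v v') (T + T' + 1)"
    and g: "\<And>x. x \<in> D \<Longrightarrow> F (eb (f x)) (eb' (f' x)) = ec (g x)"
  shows "computable ea ec D b g"
proof -
  obtain P e e' c where *: "\<And>x. x \<in> D \<Longrightarrow> evalb P (ea x) e (eb (f x)) (c * Suc (b x))"
    "\<And>x. x \<in> D \<Longrightarrow> evalb P (ea x) e' (eb' (f' x)) (c * Suc (b x))"
    by (rule computableE2[OF assms(1,2)]) blast
  show ?thesis
  proof (rule computableI)
    show "evalb P (ea x) (E e e') (ec (g x)) (c * Suc (b x) + c * Suc (b x) + 1)" if "x \<in> D" for x
      using op[OF *(1)[OF that] *(2)[OF that]] by (simp only: g[OF that])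
    show "c * Suc (b x) + c * Suc (b x) + 1 \<le> (2 * c + 1) * Suc (b x)" for x
      by (simp add: algebra_simps)
  qed
qed

primrec quote :: "val \<Rightarrow> exp" where
  "quote (Num m) = Const m"
| "quote (Cell v w) = MkCell (quote v) (quote w)"

lemma computable_const: "computable ea eb D b (\<lambda>_. y)"
proof -
  have "\<exists>T. \<forall>a. evalb [] a (quote v) v T" for v
  proof (induction v)
    case (Num m)
    show ?case
      unfolding quote.simps using evalb_Const by blast
  next
    case (Cell v w)
    then show ?case
      unfolding quote.simps using evalb_MkCell by meson
  qed
  then obtain T where T: "\<And>a. evalb [] a (quote (eb y)) (eb y) T"
    by blast
  show ?thesis
    by (rule computableI[where P = "[]" and e = "quote (eb y)" and T = "\<lambda>_. T" and c = T])
      (rule T, simp)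
qed

lemma computable_pair:
  assumes "computable ea eb D b f" "computable ea ec D b g"
  shows "computable ea (enc_pair eb ec) D b (\<lambda>x. (f x, g x))"
  by (rule computable_op2[OF assms, of MkCell Cell]) (erule (1) evalb_MkCell, simp)

lemma enc_pair_eq: "enc_pair e e' z = Cell (e (fst z)) (e' (snd z))"
  by (cases z) simp

text \<open>The second expression becomes a new function, since it must see the intermediate value
  as its argument.\<close>

lemma computable_comp:
  assumes "computable ea eb D b f" "computable eb ec D' b' g" "\<And>x. x \<in> D \<Longrightarrow> f x \<in> D'"
    and "bounded_by D b (\<lambda>x. b' (f x))"
  shows "computable ea ec D b (\<lambda>x. g (f x))"
proof -
  obtain P e e' c where *: "\<And>x. x \<in> D \<Longrightarrow> evalb P (ea x) e (eb (f x)) (c * Suc (b x))"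
    "\<And>x. x \<in> D' \<Longrightarrow> evalb P (eb x) e' (ec (g x)) (c * Suc (b' x))"
    by (rule computableE2[OF assms(1,2)]) blast
  obtain k where k: "\<And>x. x \<in> D \<Longrightarrow> b' (f x) \<le> k * Suc (b x)"
    using assms(4) unfolding bounded_by_def by blast
  let ?P = "P @ [e']"
  show ?thesis
  proof (rule computableI)
    fix x assume x: "x \<in> D"
    have "evalb ?P (eb (f x)) (?P ! length P) (ec (g (f x))) (c * Suc (b' (f x)))"
      using evalb_append[OF *(2)[OF assms(3)[OF x]]] by simp
    from evalb_Call[OF evalb_append[OF *(1)[OF x]] _ this]
    show "evalb ?P (ea x) (Call (length P) e) (ec (g (f x)))
        (c * Suc (b x) + c * Suc (b' (f x)) + 1)"
      by simp
    have "c * b' (f x) \<le> c * (k * Suc (b x))"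
      using k[OF x] by (rule mult_le_mono2)
    then show "c * Suc (b x) + c * Suc (b' (f x)) + 1 \<le> (c + c + c * k + 1) * Suc (b x)"
      by (simp add: algebra_simps)
  qed
qed

lemma computable_fst:
  assumes "computable ea (enc_pair e1 e2) D b f"
  shows "computable ea e1 D b (\<lambda>x. fst (f x))"
  by (rule computable_op1[OF assms, of First v_first]) (erule evalb_First, simp add: enc_pair_eq)

lemma computable_snd:
  assumes "computable ea (enc_pair e1 e2) D b f"
  shows "computable ea e2 D b (\<lambda>x. snd (f x))"
  by (rule computable_op1[OF assms, of Second v_second]) (erule evalb_Second, simp add: enc_pair_eq)

definition enc_bool :: "bool \<Rightarrow> val" where
  "enc_bool q = Num (if q then 1 else 0)"

text \<open>Each branch is required only where it is taken, which makes partial operations such as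
  \<open>hd\<close> usable.\<close>

lemma computable_if:
  assumes "computable ea enc_bool D b q" "computable ea eb {x \<in> D. q x} b f"
    and "computable ea eb {x \<in> D. \<not> q x} b g"
  shows "computable ea eb D b (\<lambda>x. if q x then f x else g x)"
proof -
  obtain P e1 e2 c where *: "\<And>x. x \<in> {x \<in> D. q x} \<Longrightarrow> evalb P (ea x) e1 (eb (f x)) (c * Suc (b x))"
    "\<And>x. x \<in> {x \<in> D. \<not> q x} \<Longrightarrow> evalb P (ea x) e2 (eb (g x)) (c * Suc (b x))"
    by (rule computableE2[OF assms(2,3)]) blast
  obtain Q e c' where q: "\<And>x. x \<in> D \<Longrightarrow> evalb Q (ea x) e (enc_bool (q x)) (c' * Suc (b x))"
    using assms(1) unfolding computable_def by blast
  let ?P = "P @ map (shift (length P)) Q"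
  show ?thesis
  proof (rule computableI)
    fix x assume x: "x \<in> D"
    have 1: "evalb ?P (ea x) (shift (length P) e) (enc_bool (q x)) (c' * Suc (b x))"
      using evalb_shift[OF q[OF x], of P "[]"] by simp
    show "evalb ?P (ea x) (IfNZ (shift (length P) e) e1 e2) (eb (if q x then f x else g x))
        (c' * Suc (b x) + c * Suc (b x) + 1)"
    proof (cases "q x")
      case True
      then show ?thesis
        using evalb_IfNZ_true[OF 1 _ evalb_append[OF *(1)]] x by (simp add: enc_bool_def)
    next
      case False
      then show ?thesis
        using evalb_IfNZ_false[OF _ evalb_append[OF *(2)]] 1 x by (simp add: enc_bool_def)
    qed
    show "c' * Suc (b x) + c * Suc (b x) + 1 \<le> (c' + c + 1) * Suc (b x)"
      by (simp add: algebra_simps)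
  qed
qed

lemma computable_conj:
  assumes "computable ea enc_bool D b p" "computable ea enc_bool D b q"
  shows "computable ea enc_bool D b (\<lambda>x. p x \<and> q x)"
proof -
  have "computable ea enc_bool D b (\<lambda>x. if p x then q x else False)"
    by (rule computable_if[OF assms(1) computable_subset[OF assms(2)] computable_const]) auto
  then show ?thesis
    by (rule computable_cong) simp
qed

lemma computable_disj:
  assumes "computable ea enc_bool D b p" "computable ea enc_bool D b q"
  shows "computable ea enc_bool D b (\<lambda>x. p x \<or> q x)"
proof -
  have "computable ea enc_bool D b (\<lambda>x. if p x then True else q x)"
    by (rule computable_if[OF assms(1) computable_const computable_subset[OF assms(2)]]) auto
  then show ?thesis
    by (rule computable_cong) simp
qed

lemma computable_not:
  assumes "computable ea enc_bool D b p"
  shows "computable ea enc_bool D b (\<lambda>x. \<not> p x)"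
proof -
  have "computable ea enc_bool D b (\<lambda>x. if p x then False else True)"
    by (rule computable_if[OF assms(1) computable_const computable_const])
  then show ?thesis
    by (rule computable_cong) simp
qed

lemma computable_Suc:
  assumes "computable ea Num D b f"
  shows "computable ea Num D b (\<lambda>x. Suc (f x))"
  by (rule computable_op1[OF assms, of Succ v_succ]) (erule evalb_Succ, simp)

lemma computable_eq:
  assumes "computable ea Num D b f" "computable ea Num D b g"
  shows "computable ea enc_bool D b (\<lambda>x. f x = g x)"
  by (rule computable_op2[OF assms, of Same v_same]) (erule (1) evalb_Same, simp add: enc_bool_def)

lemma computable_less:
  assumes "computable ea Num D b f" "computable ea Num D b g"
  shows "computable ea enc_bool D b (\<lambda>x. f x < g x)"
  by (rule computable_op2[OF assms, of Less v_less]) (erule (1) evalb_Less, simp add: enc_bool_def)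

lemma computable_Cons:
  assumes "computable ea ee D b f" "computable ea (enc_list ee) D b g"
  shows "computable ea (enc_list ee) D b (\<lambda>x. f x # g x)"
  by (rule computable_op2[OF assms, of MkCell Cell]) (erule (1) evalb_MkCell, simp)

lemma computable_null:
  assumes "computable ea (enc_list ee) D b f"
  shows "computable ea enc_bool D b (\<lambda>x. f x = [])"
proof -
  have "v_iscell (enc_list ee xs) = enc_bool (xs \<noteq> [])" for xs
    by (cases xs) (simp_all add: enc_bool_def)
  then have "computable ea enc_bool D b (\<lambda>x. f x \<noteq> [])"
    by (intro computable_op1[OF assms, of IsCell v_iscell] evalb_IsCell)
  from computable_not[OF this] show ?thesis
    by simp
qed

lemma computable_hd:
  assumes "computable ea (enc_list ee) D b f" "\<And>x. x \<in> D \<Longrightarrow> f x \<noteq> []"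
  shows "computable ea ee D b (\<lambda>x. hd (f x))"
proof -
  have "v_first (enc_list ee xs) = ee (hd xs)" if "xs \<noteq> []" for xs
    using that by (cases xs) simp_all
  then show ?thesis
    using assms(2) by (intro computable_op1[OF assms(1), of First v_first] evalb_First) auto
qed

lemma computable_tl:
  assumes "computable ea (enc_list ee) D b f"
  shows "computable ea (enc_list ee) D b (\<lambda>x. tl (f x))"
proof -
  have "v_second (enc_list ee xs) = enc_list ee (tl xs)" for xs
    by (cases xs) simp_all
  then show ?thesis
    by (intro computable_op1[OF assms, of Second v_second] evalb_Second)
qed

text \<open>The common frame of both folds, for a function \<open>k\<close> that takes parameter,
  accumulator and list. The number 30 is a generous bound for the fixed costs of one
  iteration.\<close>

lemma computable_loop:
  assumes l: "computable ea (enc_list ee) D b l" and h: "computable ea es D b h"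
    and loop: "\<And>x. x \<in> D \<Longrightarrow>
      evalb Q (Cell (Cell (ea x) (es (h x))) (enc_list ee (l x))) (Q ! k) (es (r x))
        ((c * Suc (B x) + 30) * Suc (length (l x)))"
    and k: "k < length Q"
    and time: "bounded_by D b (\<lambda>x. Suc (length (l x)) * Suc (B x))"
  shows "computable ea es D b r"
proof -
  have args: "computable ea (enc_pair (enc_pair ea es) (enc_list ee)) D b (\<lambda>x. ((x, h x), l x))"
    by (intro computable_pair computable_id h l)
  have "computable (enc_pair (enc_pair ea es) (enc_list ee)) es ((\<lambda>x. ((x, h x), l x)) ` D)
      (\<lambda>z. Suc (length (snd z)) * Suc (B (fst (fst z)))) (\<lambda>z. r (fst (fst z)))"
  proof (rule computableI)
    fix z assume "z \<in> (\<lambda>x. ((x, h x), l x)) ` D"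
    then obtain x where x: "x \<in> D" "z = ((x, h x), l x)"
      by blast
    show "evalb Q (enc_pair (enc_pair ea es) (enc_list ee) z) (Call k Arg) (es (r (fst (fst z))))
        (1 + (c * Suc (B (fst (fst z))) + 30) * Suc (length (snd z)) + 1)"
      using evalb_Call[OF evalb_Arg k loop[OF x(1)]] by (simp add: x(2))
    show "1 + (c * Suc (B (fst (fst z))) + 30) * Suc (length (snd z)) + 1 \<le>
        (c + 32) * Suc (Suc (length (snd z)) * Suc (B (fst (fst z))))"
      by (simp add: algebra_simps)
  qed
  from computable_comp[OF args this] show ?thesis
    using time by simp
qed

text \<open>\<open>J\<close> is the loop invariant: it holds for the parameter, the next element and
  the accumulator computed from the elements behind it. \<open>B\<close> bounds the cost of one
  iteration in terms of the parameter alone.\<close>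

lemma computable_foldr:
  assumes step: "computable (enc_pair ea (enc_pair ee es)) es J bs
      (\<lambda>z. g (fst z) (fst (snd z)) (snd (snd z)))"
    and l: "computable ea (enc_list ee) D b l" and h: "computable ea es D b h"
    and J: "\<And>x us y vs. x \<in> D \<Longrightarrow> l x = us @ y # vs \<Longrightarrow> (x, y, foldr (g x) vs (h x)) \<in> J"
    and bs: "\<And>z. z \<in> J \<Longrightarrow> bs z \<le> B (fst z)"
    and time: "bounded_by D b (\<lambda>x. Suc (length (l x)) * Suc (B x))"
  shows "computable ea es D b (\<lambda>x. foldr (g x) (l x) (h x))"
proof -
  obtain P e c where *: "\<And>z. z \<in> J \<Longrightarrow> evalb P (enc_pair ea (enc_pair ee es) z) e
      (es (g (fst z) (fst (snd z)) (snd (snd z)))) (c * Suc (bs z))"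
    using step unfolding computable_def by blast
  let ?k = "length P"
  define body where "body = IfNZ (IsCell (Second Arg))
      (Call ?k (MkCell (First (First Arg)) (MkCell (First (Second Arg))
        (Call (Suc ?k) (MkCell (First Arg) (Second (Second Arg)))))))
      (Second (First Arg))"
  let ?Q = "P @ [e, body]"
  have Q: "?Q ! ?k = e" "?Q ! Suc ?k = body"
    by (simp_all add: nth_append)
  note body_cong = arg_cong[OF body_def, of "\<lambda>e. evalb _ _ e _ _", THEN iffD2]
  show ?thesis
  proof (rule computable_loop[OF l h _ _ time])
    fix x assume x: "x \<in> D"
    have "evalb ?Q (Cell (Cell (ea x) (es (h x))) (enc_list ee vs)) body
        (es (foldr (g x) vs (h x))) ((c * Suc (B x) + 30) * Suc (length vs))"
      if "l x = us @ vs" for us vs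
      using that
    proof (induction vs arbitrary: us)
      case Nil
      let ?a = "Cell (Cell (ea x) (es (h x))) (Num 0)"
      have "evalb ?Q ?a (IsCell (Second Arg)) (Num 0) (1 + 1 + 1)"
        using evalb_IsCell[OF evalb_Second[OF evalb_Arg[of ?Q ?a]]] by simp
      moreover have "evalb ?Q ?a (Second (First Arg)) (es (h x)) (1 + 1 + 1)"
        using evalb_Second[OF evalb_First[OF evalb_Arg[of ?Q ?a]]] by simp
      ultimately have "evalb ?Q ?a body (es (h x)) ((1 + 1 + 1) + (1 + 1 + 1) + 1)"
        by (intro body_cong evalb_IfNZ_false)
      then show ?case
        by (simp add: evalb_mono)
    next
      case (Cons y vs)
      let ?T = "c * Suc (B x) + 30"
      let ?a = "Cell (Cell (ea x) (es (h x))) (Cell (ee y) (enc_list ee vs))"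
      let ?r = "foldr (g x) vs (h x)"
      have IH: "evalb ?Q (Cell (Cell (ea x) (es (h x))) (enc_list ee vs)) (?Q ! Suc ?k)
          (es ?r) (?T * Suc (length vs))"
        unfolding Q using Cons.IH[of "us @ [y]"] Cons.prems by simp
      have 1: "evalb ?Q ?a (IsCell (Second Arg)) (Num 1) (1 + 1 + 1)"
        using evalb_IsCell[OF evalb_Second[OF evalb_Arg[of ?Q ?a]]] by simp
      have "evalb ?Q ?a (First Arg) (Cell (ea x) (es (h x))) (1 + 1)"
        using evalb_First[OF evalb_Arg[of ?Q ?a]] by simp
      moreover have "evalb ?Q ?a (Second (Second Arg)) (enc_list ee vs) (1 + 1 + 1)"
        using evalb_Second[OF evalb_Second[OF evalb_Arg[of ?Q ?a]]] by simp
      ultimately have "evalb ?Q ?a (MkCell (First Arg) (Second (Second Arg)))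
          (Cell (Cell (ea x) (es (h x))) (enc_list ee vs)) ((1 + 1) + (1 + 1 + 1) + 1)"
        by (rule evalb_MkCell)
      then have rec: "evalb ?Q ?a (Call (Suc ?k) (MkCell (First Arg) (Second (Second Arg)))) (es ?r)
          ((1 + 1) + (1 + 1 + 1) + 1 + ?T * Suc (length vs) + 1)"
        using IH by (intro evalb_Call) simp_all
      have fx: "evalb ?Q ?a (First (First Arg)) (ea x) (1 + 1 + 1)"
        using evalb_First[OF evalb_First[OF evalb_Arg[of ?Q ?a]]] by simp
      have fy: "evalb ?Q ?a (First (Second Arg)) (ee y) (1 + 1 + 1)"
        using evalb_First[OF evalb_Second[OF evalb_Arg[of ?Q ?a]]] by simp
      have z: "(x, y, ?r) \<in> J"
        by (rule J[OF x Cons.prems])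
      have "c * Suc (bs (x, y, ?r)) \<le> c * Suc (B x)"
        using bs[OF z] by (intro mult_le_mono2) simp
      then have call: "evalb ?Q (Cell (ea x) (Cell (ee y) (es ?r))) (?Q ! ?k) (es (g x y ?r)) (c * Suc (B x))"
        unfolding Q using evalb_mono[OF evalb_append[OF *[OF z], of "[e, body]"]] by simp
      have "evalb ?Q ?a body (es (g x y ?r))
          ((1 + 1 + 1) + ((1 + 1 + 1) + ((1 + 1 + 1) +
            ((1 + 1) + (1 + 1 + 1) + 1 + ?T * Suc (length vs) + 1) + 1) + 1 + c * Suc (B x) + 1) + 1)"
        by (rule body_cong, rule evalb_IfNZ_true[OF 1 _ evalb_Call[OF evalb_MkCell[OF fx evalb_MkCell[OF fy rec]] _ call]], simp_all)
      then show ?case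
        by (simp add: evalb_mono)
    qed
    from this[of "[]" "l x"]
    show "evalb ?Q (Cell (Cell (ea x) (es (h x))) (enc_list ee (l x))) (?Q ! Suc ?k)
        (es (foldr (g x) (l x) (h x))) ((c * Suc (B x) + 30) * Suc (length (l x)))"
      unfolding Q by simp
  qed simp
qed

text \<open>The tail-recursive counterpart: the accumulator now depends on the elements already
  consumed.\<close>

lemma computable_fold:
  assumes step: "computable (enc_pair ea (enc_pair ee es)) es J bs
      (\<lambda>z. g (fst z) (fst (snd z)) (snd (snd z)))"
    and l: "computable ea (enc_list ee) D b l" and h: "computable ea es D b h"
    and J: "\<And>x us y vs. x \<in> D \<Longrightarrow> l x = us @ y # vs \<Longrightarrow> (x, y, fold (g x) us (h x)) \<in> J"
    and bs: "\<And>z. z \<in> J \<Longrightarrow> bs z \<le> B (fst z)"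
    and time: "bounded_by D b (\<lambda>x. Suc (length (l x)) * Suc (B x))"
  shows "computable ea es D b (\<lambda>x. fold (g x) (l x) (h x))"
proof -
  obtain P e c where *: "\<And>z. z \<in> J \<Longrightarrow> evalb P (enc_pair ea (enc_pair ee es) z) e
      (es (g (fst z) (fst (snd z)) (snd (snd z)))) (c * Suc (bs z))"
    using step unfolding computable_def by blast
  let ?k = "length P"
  define body where "body = IfNZ (IsCell (Second Arg))
      (Call (Suc ?k) (MkCell
        (MkCell (First (First Arg))
          (Call ?k (MkCell (First (First Arg)) (MkCell (First (Second Arg)) (Second (First Arg))))))
        (Second (Second Arg))))
      (Second (First Arg))"
  let ?Q = "P @ [e, body]"
  have Q: "?Q ! ?k = e" "?Q ! Suc ?k = body"
    by (simp_all add: nth_append)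
  note body_cong = arg_cong[OF body_def, of "\<lambda>e. evalb _ _ e _ _", THEN iffD2]
  show ?thesis
  proof (rule computable_loop[OF l h _ _ time])
    fix x assume x: "x \<in> D"
    have "evalb ?Q (Cell (Cell (ea x) (es (fold (g x) us (h x)))) (enc_list ee vs)) body
        (es (fold (g x) (l x) (h x))) ((c * Suc (B x) + 30) * Suc (length vs))"
      if "l x = us @ vs" for us vs
      using that
    proof (induction vs arbitrary: us)
      case Nil
      let ?a = "Cell (Cell (ea x) (es (fold (g x) us (h x)))) (Num 0)"
      have "evalb ?Q ?a (IsCell (Second Arg)) (Num 0) (1 + 1 + 1)"
        using evalb_IsCell[OF evalb_Second[OF evalb_Arg[of ?Q ?a]]] by simp
      moreover have "evalb ?Q ?a (Second (First Arg)) (es (fold (g x) us (h x))) (1 + 1 + 1)"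
        using evalb_Second[OF evalb_First[OF evalb_Arg[of ?Q ?a]]] by simp
      ultimately have "evalb ?Q ?a body (es (fold (g x) us (h x))) ((1 + 1 + 1) + (1 + 1 + 1) + 1)"
        by (intro body_cong evalb_IfNZ_false)
      then show ?case
        using Nil by (simp add: evalb_mono)
    next
      case (Cons y vs)
      let ?T = "c * Suc (B x) + 30"
      let ?s = "fold (g x) us (h x)"
      let ?a = "Cell (Cell (ea x) (es ?s)) (Cell (ee y) (enc_list ee vs))"
      have IH: "evalb ?Q (Cell (Cell (ea x) (es (g x y ?s))) (enc_list ee vs)) (?Q ! Suc ?k)
          (es (fold (g x) (l x) (h x))) (?T * Suc (length vs))"
        unfolding Q using Cons.IH[of "us @ [y]"] Cons.prems by simp
      have 1: "evalb ?Q ?a (IsCell (Second Arg)) (Num 1) (1 + 1 + 1)"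
        using evalb_IsCell[OF evalb_Second[OF evalb_Arg[of ?Q ?a]]] by simp
      have fx: "evalb ?Q ?a (First (First Arg)) (ea x) (1 + 1 + 1)"
        using evalb_First[OF evalb_First[OF evalb_Arg[of ?Q ?a]]] by simp
      have fs: "evalb ?Q ?a (Second (First Arg)) (es ?s) (1 + 1 + 1)"
        using evalb_Second[OF evalb_First[OF evalb_Arg[of ?Q ?a]]] by simp
      have fy: "evalb ?Q ?a (First (Second Arg)) (ee y) (1 + 1 + 1)"
        using evalb_First[OF evalb_Second[OF evalb_Arg[of ?Q ?a]]] by simp
      have fv: "evalb ?Q ?a (Second (Second Arg)) (enc_list ee vs) (1 + 1 + 1)"
        using evalb_Second[OF evalb_Second[OF evalb_Arg[of ?Q ?a]]] by simp
      have z: "(x, y, ?s) \<in> J"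
        by (rule J[OF x Cons.prems])
      have "c * Suc (bs (x, y, ?s)) \<le> c * Suc (B x)"
        using bs[OF z] by (intro mult_le_mono2) simp
      then have call: "evalb ?Q (Cell (ea x) (Cell (ee y) (es ?s))) (?Q ! ?k) (es (g x y ?s)) (c * Suc (B x))"
        unfolding Q using evalb_mono[OF evalb_append[OF *[OF z], of "[e, body]"]] by simp
      have new: "evalb ?Q ?a
          (Call ?k (MkCell (First (First Arg)) (MkCell (First (Second Arg)) (Second (First Arg)))))
          (es (g x y ?s)) ((1 + 1 + 1) + ((1 + 1 + 1) + (1 + 1 + 1) + 1) + 1 + c * Suc (B x) + 1)"
        by (rule evalb_Call[OF evalb_MkCell[OF fx evalb_MkCell[OF fy fs]] _ call]) simp
      have "evalb ?Q ?a body (es (fold (g x) (l x) (h x)))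
          ((1 + 1 + 1) + (((1 + 1 + 1) +
            ((1 + 1 + 1) + ((1 + 1 + 1) + (1 + 1 + 1) + 1) + 1 + c * Suc (B x) + 1) + 1) +
            (1 + 1 + 1) + 1 + ?T * Suc (length vs) + 1) + 1)"
        by (rule body_cong, rule evalb_IfNZ_true[OF 1 _ evalb_Call[OF evalb_MkCell[OF evalb_MkCell[OF fx new] fv] _ IH]], simp_all)
      then show ?case
        by (simp add: evalb_mono)
    qed
    from this[of "[]" "l x"]
    show "evalb ?Q (Cell (Cell (ea x) (es (h x))) (enc_list ee (l x))) (?Q ! Suc ?k)
        (es (fold (g x) (l x) (h x))) ((c * Suc (B x) + 30) * Suc (length (l x)))"
      unfolding Q by simp
  qed simp
qed

section \<open>Computing with lists\<close>

lemma bounded_by_Suc: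
  assumes "bounded_by D b f"
  shows "bounded_by D b (\<lambda>x. Suc (f x) * Suc m)"
proof -
  obtain k where "\<And>x. x \<in> D \<Longrightarrow> f x \<le> k * Suc (b x)"
    using assms unfolding bounded_by_def by blast
  then have "Suc (f x) * Suc m \<le> (Suc k * Suc m) * Suc (b x)" if "x \<in> D" for x
  proof -
    have "Suc (f x) \<le> Suc k * Suc (b x)"
      using \<open>\<And>x. x \<in> D \<Longrightarrow> f x \<le> k * Suc (b x)\<close>[OF that] by simp
    then have "Suc (f x) * Suc m \<le> Suc k * Suc (b x) * Suc m"
      by (rule mult_le_mono1)
    then show ?thesis
      by (simp only: mult.assoc mult.commute[of "Suc (b x)"])
  qed
  then show ?thesis
    by (rule bounded_byI)
qed

lemma bounded_by_self: "bounded_by D b b"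
  by (rule bounded_byI[of _ _ 1]) simp

lemma bounded_by_mono: "bounded_by D b g \<Longrightarrow> (\<And>x. x \<in> D \<Longrightarrow> f x \<le> g x) \<Longrightarrow> bounded_by D b f"
  unfolding bounded_by_def by (meson order_trans)

lemma bounded_by_append:
  assumes "bounded_by D b (\<lambda>x. length (f x))" "bounded_by D b (\<lambda>x. length (g x))"
  shows "bounded_by D b (\<lambda>x. length (f x @ g x))"
proof -
  obtain k l where "\<And>x. x \<in> D \<Longrightarrow> length (f x) \<le> k * Suc (b x)" "\<And>x. x \<in> D \<Longrightarrow> length (g x) \<le> l * Suc (b x)"
    using assms unfolding bounded_by_def by blast
  then have "length (f x @ g x) \<le> (k + l) * Suc (b x)" if "x \<in> D" for x
    unfolding length_append add_mult_distrib using that by (intro add_mono)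
  then show ?thesis
    by (rule bounded_byI)
qed

lemma bounded_by_map: "bounded_by D b (\<lambda>x. length (l x)) \<Longrightarrow> bounded_by D b (\<lambda>x. length (map (h x) (l x)))"
  by simp

lemma bounded_by_filter:
  "bounded_by D b (\<lambda>x. length (l x)) \<Longrightarrow> bounded_by D b (\<lambda>x. length (filter (h x) (l x)))"
  by (erule bounded_by_mono) simp

lemma computable_fst_id: "computable (enc_pair e1 e2) e1 D b fst"
  using computable_fst[OF computable_id] .

lemma computable_snd_id: "computable (enc_pair e1 e2) e2 D b snd"
  using computable_snd[OF computable_id] .

lemma computable_comp2:
  assumes "computable ea e1 D b f" "computable ea e2 D b g"
    and "computable (enc_pair e1 e2) ec D' b' h" "\<And>x. x \<in> D \<Longrightarrow> (f x, g x) \<in> D'"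
    and "bounded_by D b (\<lambda>x. b' (f x, g x))"
  shows "computable ea ec D b (\<lambda>x. h (f x, g x))"
  by (rule computable_comp[OF computable_pair[OF assms(1,2)] assms(3)]) (use assms(4,5) in auto)

lemma computable_foldr_const:
  assumes step: "computable (enc_pair ea (enc_pair ee es)) es
      {z. fst z \<in> D \<and> fst (snd z) \<in> set (l (fst z))} (\<lambda>_. 0)
      (\<lambda>z. g (fst z) (fst (snd z)) (snd (snd z)))"
    and "computable ea (enc_list ee) D b l" "computable ea es D b h"
    and "bounded_by D b (\<lambda>x. length (l x))"
  shows "computable ea es D b (\<lambda>x. foldr (g x) (l x) (h x))"
  by (rule computable_foldr[OF step assms(2,3), of "\<lambda>_. 0"])
    (use bounded_by_Suc[OF assms(4), of 0] in auto)

lemma computable_step: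
  assumes "computable (enc_pair ea ee) ec {z. fst z \<in> D \<and> snd z \<in> set (l (fst z))} (\<lambda>_. 0)
      (\<lambda>z. g (fst z) (snd z))"
  shows "computable (enc_pair ea (enc_pair ee es)) ec
      {z. fst z \<in> D \<and> fst (snd z) \<in> set (l (fst z))} (\<lambda>_. 0) (\<lambda>z. g (fst z) (fst (snd z)))"
proof -
  have "computable (enc_pair ea (enc_pair ee es)) (enc_pair ea ee)
      {z. fst z \<in> D \<and> fst (snd z) \<in> set (l (fst z))} (\<lambda>_. 0) (\<lambda>z. (fst z, fst (snd z)))"
    by (rule computable_pair computable_fst computable_snd computable_id computable_fst_id computable_snd_id)+
  from computable_comp[OF this assms] show ?thesis
    by (simp add: bounded_by_const)
qed

lemma computable_map:
  assumes "computable (enc_pair ea ee) ec {z. fst z \<in> D \<and> snd z \<in> set (l (fst z))} (\<lambda>_. 0)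
      (\<lambda>z. g (fst z) (snd z))"
    and "computable ea (enc_list ee) D b l" "bounded_by D b (\<lambda>x. length (l x))"
  shows "computable ea (enc_list ec) D b (\<lambda>x. map (g x) (l x))"
proof -
  have "computable ea (enc_list ec) D b (\<lambda>x. foldr (\<lambda>y ys. g x y # ys) (l x) [])"
    by (rule computable_foldr_const computable_Cons computable_step assms computable_const computable_snd computable_id computable_fst_id computable_snd_id)+
  moreover have "foldr (\<lambda>y ys. g x y # ys) xs [] = map (g x) xs" for x xs
    by (induction xs) auto
  ultimately show ?thesis
    by simp
qed

lemma computable_filter:
  assumes "computable (enc_pair ea ee) enc_bool {z. fst z \<in> D \<and> snd z \<in> set (l (fst z))} (\<lambda>_. 0)
      (\<lambda>z. p (fst z) (snd z))"
    and "computable ea (enc_list ee) D b l" "bounded_by D b (\<lambda>x. length (l x))"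
  shows "computable ea (enc_list ee) D b (\<lambda>x. filter (p x) (l x))"
proof -
  have "computable ea (enc_list ee) D b (\<lambda>x. foldr (\<lambda>y ys. if p x y then y # ys else ys) (l x) [])"
    by (rule computable_foldr_const computable_if computable_Cons computable_step assms computable_const computable_fst computable_snd computable_id computable_fst_id computable_snd_id)+
  moreover have "foldr (\<lambda>y ys. if p x y then y # ys else ys) xs [] = filter (p x) xs" for x xs
    by (induction xs) auto
  ultimately show ?thesis
    by simp
qed

lemma computable_takeWhile:
  assumes "computable (enc_pair ea ee) enc_bool {z. fst z \<in> D \<and> snd z \<in> set (l (fst z))} (\<lambda>_. 0)
      (\<lambda>z. p (fst z) (snd z))"
    and "computable ea (enc_list ee) D b l" "bounded_by D b (\<lambda>x. length (l x))"
  shows "computable ea (enc_list ee) D b (\<lambda>x. takeWhile (p x) (l x))"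
proof -
  have "computable ea (enc_list ee) D b (\<lambda>x. foldr (\<lambda>y ys. if p x y then y # ys else []) (l x) [])"
    by (rule computable_foldr_const computable_if computable_Cons computable_step assms computable_const computable_fst computable_snd computable_id computable_fst_id computable_snd_id)+
  moreover have "foldr (\<lambda>y ys. if p x y then y # ys else []) xs [] = takeWhile (p x) xs" for x xs
    by (induction xs) auto
  ultimately show ?thesis
    by simp
qed

lemma computable_bex:
  assumes "computable (enc_pair ea ee) enc_bool {z. fst z \<in> D \<and> snd z \<in> set (l (fst z))} (\<lambda>_. 0)
      (\<lambda>z. p (fst z) (snd z))"
    and "computable ea (enc_list ee) D b l" "bounded_by D b (\<lambda>x. length (l x))"
  shows "computable ea enc_bool D b (\<lambda>x. \<exists>y\<in>set (l x). p x y)"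
proof -
  have "computable ea enc_bool D b (\<lambda>x. foldr (\<lambda>y a. p x y \<or> a) (l x) False)"
    by (rule computable_foldr_const computable_disj computable_step assms computable_const computable_snd computable_id computable_fst_id computable_snd_id)+
  moreover have "foldr (\<lambda>y a. p x y \<or> a) xs False \<longleftrightarrow> (\<exists>y\<in>set xs. p x y)" for x xs
    by (induction xs) auto
  ultimately show ?thesis
    by simp
qed

lemma computable_ball:
  assumes "computable (enc_pair ea ee) enc_bool {z. fst z \<in> D \<and> snd z \<in> set (l (fst z))} (\<lambda>_. 0)
      (\<lambda>z. p (fst z) (snd z))"
    and "computable ea (enc_list ee) D b l" "bounded_by D b (\<lambda>x. length (l x))"
  shows "computable ea enc_bool D b (\<lambda>x. \<forall>y\<in>set (l x). p x y)"
  using computable_not[OF computable_bex[OF computable_not[OF assms(1)] assms(2,3)]] by simp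

lemma computable_append:
  assumes "computable ea (enc_list ee) D b f" "computable ea (enc_list ee) D b g"
    and "bounded_by D b (\<lambda>x. length (f x))"
  shows "computable ea (enc_list ee) D b (\<lambda>x. f x @ g x)"
proof -
  have "computable ea (enc_list ee) D b (\<lambda>x. foldr (\<lambda>y ys. y # ys) (f x) (g x))"
    by (rule computable_foldr_const computable_Cons assms computable_fst computable_snd computable_id computable_fst_id computable_snd_id)+
  moreover have "foldr (\<lambda>y ys. y # ys) xs zs = xs @ zs" for xs zs :: "'b list"
    by (induction xs) auto
  ultimately show ?thesis
    by simp
qed

lemma computable_length:
  assumes "computable ea (enc_list ee) D b f" "bounded_by D b (\<lambda>x. length (f x))"
  shows "computable ea Num D b (\<lambda>x. length (f x))"
proof -
  have "computable ea Num D b (\<lambda>x. foldr (\<lambda>y n. Suc n) (f x) 0)"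
    by (rule computable_foldr_const computable_Suc assms computable_snd computable_id computable_fst_id computable_snd_id computable_const)+
  moreover have "foldr (\<lambda>y n. Suc n) xs 0 = length xs" for xs :: "'b list"
    by (induction xs) auto
  ultimately show ?thesis
    by simp
qed

lemma computable_concat:
  assumes l: "computable ea (enc_list (enc_list ee)) D b l" "bounded_by D b (\<lambda>x. length (l x))"
    and m: "\<And>x y. x \<in> D \<Longrightarrow> y \<in> set (l x) \<Longrightarrow> length y \<le> m"
  shows "computable ea (enc_list ee) D b (\<lambda>x. concat (l x))"
proof -
  have "computable ea (enc_list ee) D b (\<lambda>x. foldr (\<lambda>y ys. y @ ys) (l x) [])"
  proof (rule computable_foldr[where J = "{z. fst z \<in> D \<and> fst (snd z) \<in> set (l (fst z))}"
        and bs = "\<lambda>_. m" and B = "\<lambda>_. m"])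
    show "computable (enc_pair ea (enc_pair (enc_list ee) (enc_list ee))) (enc_list ee)
        {z. fst z \<in> D \<and> fst (snd z) \<in> set (l (fst z))} (\<lambda>_. m) (\<lambda>z. fst (snd z) @ snd (snd z))"
      by (rule computable_append computable_fst computable_snd computable_id computable_fst_id computable_snd_id bounded_by_const[where m = m] | (use m in auto)[1])+
  qed (use l bounded_by_Suc computable_const in auto)
  moreover have "foldr (\<lambda>y ys. y @ ys) xs [] = concat xs" for xs :: "'b list list"
    by (induction xs) auto
  ultimately show ?thesis
    by simp
qed

text \<open>For a fixed bound \<open>m\<close> on the length, the at most \<open>2 ^ m\<close>
  sublists cost only a constant factor.\<close>

lemma computable_subseqs:
  assumes l: "computable ea (enc_list ee) D b l" and m: "\<And>x. x \<in> D \<Longrightarrow> length (l x) \<le> m"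
  shows "computable ea (enc_list (enc_list ee)) D b (\<lambda>x. subseqs (l x))"
proof -
  let ?J = "{z. fst z \<in> D \<and> length (snd (snd z)) \<le> 2 ^ m}"
  have foldr: "foldr (\<lambda>y yss. map (Cons y) yss @ yss) xs [[]] = subseqs xs" for xs :: "'b list"
    by (induction xs) (auto simp: Let_def)
  have "computable ea (enc_list (enc_list ee)) D b
      (\<lambda>x. foldr (\<lambda>y yss. map (Cons y) yss @ yss) (l x) [[]])"
  proof (rule computable_foldr[where J = ?J and bs = "\<lambda>_. 0" and B = "\<lambda>_. 0"])
    show "computable (enc_pair ea (enc_pair ee (enc_list (enc_list ee)))) (enc_list (enc_list ee))
        ?J (\<lambda>_. 0) (\<lambda>z. map (Cons (fst (snd z))) (snd (snd z)) @ snd (snd z))"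
      by (rule computable_append computable_map computable_Cons computable_fst computable_snd computable_id computable_fst_id computable_snd_id bounded_by_const[where m = "2 ^ m"] | (auto)[1])+
    show "(x, y, foldr (\<lambda>y yss. map (Cons y) yss @ yss) vs [[]]) \<in> ?J"
      if "x \<in> D" "l x = us @ y # vs" for x us y vs
    proof -
      have "length vs \<le> m"
        using m[OF that(1)] that(2) by simp
      then show ?thesis
        using that(1) by (simp add: foldr length_subseqs)
    qed
    show "bounded_by D b (\<lambda>x. Suc (length (l x)) * Suc 0)"
      by (rule bounded_by_const[of _ _ "Suc m"]) (use m in simp)
  qed (use l computable_const in auto)
  then show ?thesis
    by (simp add: foldr)
qed

section \<open>Computing with simplices and pieces\<close>

lemma computable_member:
  assumes "computable ea Num D b v" "computable ea enc_simplex D b l"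
    and "\<And>x. x \<in> D \<Longrightarrow> length (l x) \<le> m"
  shows "computable ea enc_bool D b (\<lambda>x. v x \<in> set (l x))"
proof -
  have "computable (enc_pair Num enc_simplex) enc_bool {q. length (snd q) \<le> m} (\<lambda>_. 0)
      (\<lambda>q. \<exists>y\<in>set (snd q). fst q = y)"
    by (rule computable_bex computable_eq computable_fst computable_snd computable_id computable_fst_id computable_snd_id bounded_by_const[where m = m] | (auto)[1])+
  from computable_comp2[OF assms(1,2) this] show ?thesis
    using assms(3) by (simp add: bounded_by_const Bex_def)
qed

lemma computable_subset_simplex:
  assumes "computable ea enc_simplex D b f" "computable ea enc_simplex D b g"
    and "\<And>x. x \<in> D \<Longrightarrow> length (f x) \<le> m \<and> length (g x) \<le> m"
  shows "computable ea enc_bool D b (\<lambda>x. set (f x) \<subseteq> set (g x))"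
proof -
  have "computable (enc_pair enc_simplex enc_simplex) enc_bool
      {q. length (fst q) \<le> m \<and> length (snd q) \<le> m} (\<lambda>_. 0) (\<lambda>q. \<forall>v\<in>set (fst q). v \<in> set (snd q))"
    by (rule computable_ball computable_member[where m = m] computable_fst computable_snd computable_id computable_fst_id computable_snd_id bounded_by_const[where m = m] | (auto)[1])+
  from computable_comp2[OF assms(1,2) this] show ?thesis
    using assms(3) by (simp add: bounded_by_const subset_iff Ball_def)
qed

lemma computable_removeAll:
  assumes "computable ea Num D b v" "computable ea enc_simplex D b l"
    and "\<And>x. x \<in> D \<Longrightarrow> length (l x) \<le> m"
  shows "computable ea enc_simplex D b (\<lambda>x. removeAll (v x) (l x))"
proof -
  have "computable (enc_pair Num enc_simplex) enc_simplex {q. length (snd q) \<le> m} (\<lambda>_. 0)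
      (\<lambda>q. filter (\<lambda>y. fst q \<noteq> y) (snd q))"
    by (rule computable_filter computable_not computable_eq computable_fst computable_snd computable_id computable_fst_id computable_snd_id bounded_by_const[where m = m] | (auto)[1])+
  from computable_comp2[OF assms(1,2) this] show ?thesis
    using assms(3) by (simp add: bounded_by_const removeAll_filter_not_eq)
qed

lemma computable_covered:
  assumes "computable ea enc_complex D b G" "computable ea enc_simplex D b F"
    and "\<And>x. x \<in> D \<Longrightarrow> (\<forall>g\<in>set (G x). length g \<le> m) \<and> length (F x) \<le> m"
    and "bounded_by D b (\<lambda>x. length (G x))"
  shows "computable ea enc_bool D b (\<lambda>x. covered (G x) (set (F x)))"
proof -
  have "computable (enc_pair enc_complex enc_simplex) enc_bool
      {q. (\<forall>g\<in>set (fst q). length g \<le> m) \<and> length (snd q) \<le> m} (\<lambda>q. length (fst q))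
      (\<lambda>q. \<exists>g\<in>set (fst q). set (snd q) \<subseteq> set g)"
    by (rule computable_bex computable_subset_simplex[where m = m] computable_fst computable_snd computable_id computable_fst_id computable_snd_id bounded_by_self | (auto)[1])+
  from computable_comp2[OF assms(1,2) this] show ?thesis
    using assms(3,4) by (simp add: covered_def)
qed

lemma length_removeAll_le: "length (removeAll v xs) \<le> length xs"
  by (simp add: removeAll_filter_not_eq)

abbreviation enc_piece :: "nat piece \<Rightarrow> val" where
  "enc_piece \<equiv> enc_pair enc_simplex enc_complex"

text \<open>On such pieces all single operations take constant time. The bound \<open>2 ^ m\<close>
  is the one guaranteed by \<open>normal\<close>.\<close>

definition small :: "nat \<Rightarrow> nat piece set" where
  "small m = {p. length (fst p) \<le> m \<and> length (snd p) \<le> 2 ^ m \<and> (\<forall>g\<in>set (snd p). length g \<le> m)}"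

lemma computable_covered_small:
  assumes "computable ea enc_piece D b p" "computable ea enc_simplex D b F"
    and "\<And>x. x \<in> D \<Longrightarrow> p x \<in> small m \<and> length (F x) \<le> Suc m"
  shows "computable ea enc_bool D b (\<lambda>x. covered (snd (p x)) (set (F x)))"
proof (rule computable_covered)
  show "computable ea enc_complex D b (\<lambda>x. snd (p x))"
    by (rule computable_snd assms(1))+
  show "bounded_by D b (\<lambda>x. length (snd (p x)))"
    by (rule bounded_by_const[of _ _ "2 ^ m"]) (use assms(3) in \<open>auto simp: small_def\<close>)
  show "(\<forall>g\<in>set (snd (p x)). length g \<le> Suc m) \<and> length (F x) \<le> Suc m" if "x \<in> D" for x
    using assms(3)[OF that] by (auto simp: small_def intro: le_SucI)
qed (rule assms)

lemma length_tight: "length (tight p) \<le> length (fst p)"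
  by (simp add: tight_def)

lemma length_surplus: "length (surplus p) \<le> length (fst p)"
  by (simp add: surplus_def)

lemma computable_tight:
  assumes "computable ea enc_piece D b p" "\<And>x. x \<in> D \<Longrightarrow> p x \<in> small m"
  shows "computable ea enc_simplex D b (\<lambda>x. tight (p x))"
proof -
  have "computable enc_piece enc_simplex (small m) (\<lambda>_. 0)
      (\<lambda>p. filter (\<lambda>v. covered (snd p) (set (removeAll v (fst p)))) (fst p))"
    by (rule computable_filter computable_covered_small[where m = m] computable_removeAll[where m = m] computable_fst computable_snd computable_id computable_fst_id computable_snd_id bounded_by_const[where m = m] | (auto simp: small_def intro: le_SucI order_trans[OF length_removeAll_le])[1])+
  from computable_comp[OF assms(1) this] show ?thesis
    using assms(2) by (simp add: tight_def bounded_by_const)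
qed

lemma computable_surplus:
  assumes "computable ea enc_piece D b p" "\<And>x. x \<in> D \<Longrightarrow> p x \<in> small m"
  shows "computable ea enc_simplex D b (\<lambda>x. surplus (p x))"
proof -
  have "computable enc_piece enc_simplex (small m) (\<lambda>_. 0)
      (\<lambda>p. filter (\<lambda>u. u \<notin> set (tight p) \<and> covered (snd p) (set (u # tight p))) (fst p))"
    by (rule computable_filter computable_conj computable_not computable_member[where m = m] computable_covered_small[where m = m] computable_Cons computable_tight[where m = m] computable_fst computable_snd computable_id computable_fst_id computable_snd_id bounded_by_const[where m = m] | (auto simp: small_def intro: order_trans[OF length_tight])[1])+
  from computable_comp[OF assms(1) this] show ?thesis
    using assms(2) by (simp add: surplus_def bounded_by_const)
qed

lemma length_order: "length (order \<tau> p) \<le> 3 * length (fst p)"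
proof -
  have "length (order \<tau> p) \<le> length (tight p) + (length (surplus p) + length (fst p))"
    unfolding order_def by (rule order_trans[OF length_filter_le]) simp
  then show ?thesis
    using length_tight[of p] length_surplus[of p] by simp
qed

lemma small_lengths:
  assumes "p \<in> small m"
  shows "length (fst p) \<le> m" "length (tight p) \<le> m" "length (surplus p) \<le> m"
  using assms length_tight[of p] length_surplus[of p] by (auto simp: small_def)

lemma computable_order:
  assumes "computable ea enc_simplex D b \<tau>" "computable ea enc_piece D b p"
    and "\<And>x. x \<in> D \<Longrightarrow> length (\<tau> x) \<le> m \<and> p x \<in> small m"
  shows "computable ea enc_simplex D b (\<lambda>x. order (\<tau> x) (p x))"
proof -
  let ?P = "\<lambda>q x. x \<in> set (fst q)"
  have "computable (enc_pair enc_simplex enc_piece) enc_simplex {q. length (fst q) \<le> m \<and> snd q \<in> small m}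
      (\<lambda>_. 0) (\<lambda>q. filter (?P q) (tight (snd q)) @ filter (?P q) (surplus (snd q)) @
        filter (\<lambda>x. ?P q x \<and> x \<notin> set (tight (snd q)) \<and> x \<notin> set (surplus (snd q))) (fst (snd q)))"
    by (rule computable_filter computable_append computable_conj computable_not
        computable_member[where m = m] computable_tight[where m = m] computable_surplus[where m = m]
        computable_fst computable_snd computable_id computable_fst_id computable_snd_id bounded_by_const[where m = m] |
        (auto dest: small_lengths intro: order_trans[OF length_filter_le])[1])+
  from computable_comp2[OF assms(1,2) this] show ?thesis
    using assms(3) by (simp add: order_def bounded_by_const conj_ac)
qed

lemma length_subseq_le: "s \<in> set (subseqs q) \<Longrightarrow> length s \<le> length q"
  by (induction q arbitrary: s) (auto simp: Let_def intro: le_SucI)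

text \<open>Here \<open>G\<close> may be long, as in \<open>initial\<close>, where it grows with the
  number of facets. There are at most \<open>2 ^ m\<close> coverage tests, each linear in the length
  of \<open>G\<close>.\<close>

lemma computable_normal:
  assumes "computable ea enc_simplex D b q" "computable ea enc_complex D b G"
    and "\<And>x. x \<in> D \<Longrightarrow> length (q x) \<le> m \<and> (\<forall>g\<in>set (G x). length g \<le> m)"
    and "bounded_by D b (\<lambda>x. length (G x))"
  shows "computable ea enc_complex D b (\<lambda>x. normal (q x) (G x))"
proof -
  let ?D = "{q :: nat piece. length (fst q) \<le> m \<and> (\<forall>g\<in>set (snd q). length g \<le> m)}"
  let ?g = "\<lambda>q s acc. if covered (snd q) (set s) then s # acc else acc"
  have loop: "computable enc_piece enc_complex ?D (\<lambda>q. length (snd q))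
      (\<lambda>q. foldr (?g q) (subseqs (fst q)) [])"
  proof (rule computable_foldr)
    show "computable (enc_pair enc_piece (enc_pair enc_simplex enc_complex)) enc_complex
        {z. fst z \<in> ?D \<and> fst (snd z) \<in> set (subseqs (fst (fst z)))} (\<lambda>z. length (snd (fst z)))
        (\<lambda>z. ?g (fst z) (fst (snd z)) (snd (snd z)))"
      by (rule computable_if computable_covered[where m = m] computable_Cons computable_fst computable_snd
          computable_id bounded_by_self | (auto intro: order_trans[OF length_subseq_le])[1]
          | (rule bounded_byI[where k = 1], simp))+
    show "bounded_by ?D (\<lambda>q. length (snd q))
        (\<lambda>q. Suc (length (subseqs (fst q))) * Suc (length (snd q)))"
      by (rule bounded_byI[of _ _ "Suc (2 ^ m)"], rule mult_le_mono1) (simp add: length_subseqs)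
    show "computable enc_piece enc_complex ?D (\<lambda>q. length (snd q)) (\<lambda>q. subseqs (fst q))"
      by (rule computable_subseqs[where m = m] computable_fst computable_id | (auto)[1])+
  qed (auto intro: computable_const)
  have "foldr (?g p) ss [] = filter (\<lambda>s. covered (snd p) (set s)) ss" for p ss
    by (induction ss) auto
  then have "computable enc_piece enc_complex ?D (\<lambda>q. length (snd q)) (\<lambda>q. normal (fst q) (snd q))"
    by (intro computable_cong[OF loop]) (simp only: normal_def)
  from computable_comp2[OF assms(1,2) this] show ?thesis
    using assms(3,4) by simp
qed

lemma computable_child:
  assumes "computable ea enc_simplex D b \<tau>" "computable ea Num D b w" "computable ea enc_piece D b p"
    and "computable ea enc_simplex D b e" "computable ea Num D b x"
    and "\<And>z. z \<in> D \<Longrightarrow> length (\<tau> z) \<le> m \<and> p z \<in> small m \<and> length (e z) \<le> 3 * m"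
  shows "computable ea enc_piece D b (\<lambda>z. child (\<tau> z) (w z) (p z) (e z) (x z))"
proof -
  let ?D = "{q. length (fst q) \<le> m \<and> fst (snd (snd q)) \<in> small m \<and>
    length (fst (snd (snd (snd q)))) \<le> 3 * m} :: (nat list \<times> nat \<times> nat piece \<times> nat list \<times> nat) set"
  have "computable (enc_pair enc_simplex (enc_pair Num (enc_pair enc_piece (enc_pair enc_simplex Num))))
      enc_piece ?D (\<lambda>_. 0)
      (\<lambda>q. child (fst q) (fst (snd q)) (fst (snd (snd q))) (fst (snd (snd (snd q)))) (snd (snd (snd (snd q)))))"
    unfolding child_def
    by (rule computable_pair computable_normal[where m = "Suc m"] computable_append
        computable_map computable_filter computable_subset_simplex[where m = m]
        computable_removeAll[where m = m] computable_Cons computable_fst computable_snd computable_id computable_fst_id computable_snd_id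
        bounded_by_append bounded_by_map bounded_by_filter bounded_by_const[where m = "2 ^ m + 3 * m"] |
        (auto simp: small_def intro: le_SucI order_trans[OF length_removeAll_le])[1])+
  from computable_comp[OF computable_pair[OF assms(1) computable_pair[OF assms(2)
      computable_pair[OF assms(3) computable_pair[OF assms(4,5)]]]] this]
  show ?thesis
    using assms(6) by (simp add: bounded_by_const)
qed

lemma length_order_small: "p \<in> small m \<Longrightarrow> length (order \<tau> p) \<le> 3 * m"
  using length_order[of \<tau> p] small_lengths(1)[of p m] by simp

lemma computable_split:
  assumes "computable ea enc_simplex D b \<tau>" "computable ea Num D b w" "computable ea enc_piece D b p"
    and "\<And>z. z \<in> D \<Longrightarrow> length (\<tau> z) \<le> m \<and> p z \<in> small m"
  shows "computable ea (enc_list enc_piece) D b (\<lambda>z. split (\<tau> z) (w z) (p z))"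
proof -
  let ?D = "{q. length (fst q) \<le> m \<and> snd (snd q) \<in> small m} :: (nat list \<times> nat \<times> nat piece) set"
  have "computable (enc_pair enc_simplex (enc_pair Num enc_piece)) (enc_list enc_piece) ?D (\<lambda>_. 0)
      (\<lambda>q. split (fst q) (fst (snd q)) (snd (snd q)))"
    unfolding split_def
    by (rule computable_if computable_subset_simplex[where m = m] computable_map
        computable_child[where m = m] computable_takeWhile computable_not computable_eq
        computable_order[where m = m] computable_Cons computable_fst computable_snd computable_id computable_fst_id computable_snd_id
        computable_const bounded_by_const[where m = "3 * m"] |
        (auto dest: small_lengths
          intro: length_order_small order_trans[OF length_takeWhile_le length_order_small])[1])+
  from computable_comp[OF computable_pair[OF assms(1) computable_pair[OF assms(2,3)]] this]
  show ?thesis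
    using assms(4) by (simp add: bounded_by_const)
qed

lemma computable_tile_of:
  assumes "computable ea enc_piece D b p" "\<And>z. z \<in> D \<Longrightarrow> p z \<in> small m"
  shows "computable ea enc_piece D b (\<lambda>z. tile_of (p z))"
proof -
  have "computable enc_piece enc_piece (small m) (\<lambda>_. 0) tile_of"
    unfolding tile_of_def
    by (rule computable_pair computable_append computable_if computable_map
        computable_removeAll[where m = m] computable_covered_small[where m = m] computable_tight[where m = m]
        computable_Cons computable_const computable_fst computable_snd computable_id computable_fst_id computable_snd_id
        bounded_by_const[where m = m] | (auto dest: small_lengths intro: le_SucI)[1])+
  from computable_comp[OF assms(1) this] show ?thesis
    using assms(2) by (simp add: bounded_by_const)
qed

text \<open>The pieces for which both uses of \<open>hd\<close> in \<open>chosen_site\<close> meet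
  nonempty lists.\<close>

definition sites_computable :: "nat \<Rightarrow> nat piece set" where
  "sites_computable m = {p \<in> small m. surplus p \<noteq> [] \<and> (\<exists>A. valid_piece A p)}"

lemma computable_chosen_site:
  assumes "computable ea enc_piece D b p" "\<And>z. z \<in> D \<Longrightarrow> p z \<in> sites_computable m"
  shows "computable ea enc_simplex D b (\<lambda>z. chosen_site s (p z))"
proof -
  have "computable enc_piece enc_simplex (sites_computable m) (\<lambda>_. 0) (chosen_site s)"
  proof (cases s)
    case Facet
    then show ?thesis
      unfolding chosen_site_def by (simp add: computable_fst_id)
  next
    case Ridge
    have "computable enc_piece enc_simplex (sites_computable m) (\<lambda>_. 0)
        (\<lambda>p. removeAll (hd (filter (\<lambda>a. a \<notin> set (tight p) \<and> a \<noteq> hd (surplus p)) (fst p))) (fst p))"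
      by (rule computable_removeAll[where m = m] computable_hd computable_filter computable_conj computable_not
          computable_eq computable_member[where m = m] computable_tight[where m = m]
          computable_surplus[where m = m] computable_fst computable_snd computable_id computable_fst_id computable_snd_id
          bounded_by_const[where m = m] |
          (auto simp: sites_computable_def dest: small_lengths ridge_candidates)[1])+
    then show ?thesis
      by (rule computable_cong) (simp add: chosen_site_def Ridge)
  qed
  from computable_comp[OF assms(1) this] show ?thesis
    using assms(2) by (simp add: bounded_by_const)
qed

section \<open>Running time of the subdivision algorithm\<close>

abbreviation enc_state :: "nat state \<Rightarrow> val" where
  "enc_state \<equiv> enc_pair (enc_list enc_piece) (enc_pair (enc_list (enc_pair enc_simplex Num)) Num)"

definition size_state :: "'v state \<Rightarrow> nat" where
  "size_state st = length (fst st) + length (fst (snd st))"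

lemma length_split_small: "p \<in> small m \<Longrightarrow> length (split \<tau> w p) \<le> 3 * m + 1"
  using length_order_small[of p m \<tau>] by (simp add: split_def)

lemma computable_step_state:
  assumes "computable ea enc_simplex D b \<tau>" "computable ea enc_state D b st"
    and "\<And>x. x \<in> D \<Longrightarrow> length (\<tau> x) \<le> m \<and> set (fst (st x)) \<subseteq> small m"
    and "bounded_by D b (\<lambda>x. size_state (st x))"
  shows "computable ea enc_state D b (\<lambda>x. step (\<lambda>n. n) (\<tau> x) (st x))"
proof -
  have "computable (enc_pair enc_simplex enc_state) enc_state
      {q. length (fst q) \<le> m \<and> set (fst (snd q)) \<subseteq> small m} (\<lambda>q. size_state (snd q))
      (\<lambda>q. step (\<lambda>n. n) (fst q) (snd q))"
    unfolding step_def
    by (rule computable_pair computable_concat[where m = "3 * m + 1"] computable_map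
        computable_split[where m = m] computable_append computable_Cons computable_Suc computable_const
        computable_fst computable_snd computable_id computable_fst_id computable_snd_id bounded_by_map |
        (rule bounded_byI[where k = 1], simp add: size_state_def) |
        (use length_split_small in auto)[1])+
  from computable_comp2[OF assms(1,2) this] show ?thesis
    using assms(3,4) by simp
qed

lemma length_chosen_site: "length (chosen_site s p) \<le> length (fst p)"
  by (cases s) (simp_all add: chosen_site_def length_removeAll_le)

text \<open>Accounts for linearly many iterations of linear cost.\<close>

lemma square_bound: "Suc n * Suc (c * n) \<le> (2 * c + 2) * Suc (n\<^sup>2)" for n c :: nat
proof -
  have n: "n \<le> n * n"
    by (cases n) auto
  then have "c * n \<le> c * (n * n)"
    by (rule mult_le_mono2)
  moreover have "Suc n * Suc (c * n) = 1 + n + c * n + c * (n * n)"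
    by (simp add: algebra_simps)
  moreover have "(2 * c + 2) * Suc (n\<^sup>2) = 2 * c + 2 + 2 * (c * (n * n)) + 2 * (n * n)"
    by (simp add: power2_eq_square algebra_simps)
  ultimately show ?thesis
    using n by linarith
qed

text \<open>Each piece is compared with the sites selected so far, which are no more numerous than
  the pieces.\<close>

lemma computable_select:
  "computable (enc_list enc_piece) (enc_list enc_piece)
    {ps. (\<exists>A. valid_pieces A ps) \<and> set ps \<subseteq> small m} (\<lambda>ps. (length ps)\<^sup>2) (select s)"
proof -
  let ?D = "{ps. (\<exists>A. valid_pieces A ps) \<and> set ps \<subseteq> small m}"
  let ?J = "{z. fst z \<in> ?D \<and> fst (snd z) \<in> small m \<and> set (snd (snd z)) \<subseteq> sites_computable m \<and>
    length (snd (snd z)) \<le> length (fst z)}"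
  let ?g = "\<lambda>ps p acc. if surplus p \<noteq> [] \<and> (\<forall>q\<in>set acc. \<not> set (chosen_site s q) \<subseteq> set (fst p))
    then acc @ [p] else acc"
  have "computable (enc_list enc_piece) (enc_list enc_piece) ?D (\<lambda>ps. (length ps)\<^sup>2)
      (\<lambda>ps. fold (?g ps) ps [])"
  proof (rule computable_fold)
    show "computable (enc_pair (enc_list enc_piece) (enc_pair enc_piece (enc_list enc_piece)))
        (enc_list enc_piece) ?J (\<lambda>z. length (fst z)) (\<lambda>z. ?g (fst z) (fst (snd z)) (snd (snd z)))"
      by (rule computable_if computable_conj computable_not computable_null computable_ball
          computable_surplus[where m = m] computable_subset_simplex[where m = m]
          computable_chosen_site[where m = m] computable_append computable_Cons computable_const
          computable_fst computable_snd computable_id computable_fst_id computable_snd_id |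
          (rule bounded_byI[where k = 1], simp) |
          (auto simp: sites_computable_def dest: small_lengths
            intro: order_trans[OF length_chosen_site])[1])+
    show "(ps, p, fold (?g ps) us []) \<in> ?J" if "ps \<in> ?D" "ps = us @ p # vs" for ps us p vs
    proof -
      have "fold (?g ps) us [] = select s us"
        by (simp add: select_def)
      moreover have "q \<in> sites_computable m" if "q \<in> set (select s us)" for q
      proof -
        have q: "q \<in> set ps" "surplus q \<noteq> []"
          using select_subset[of s us] that \<open>ps = us @ p # vs\<close> by auto
        then show ?thesis
          using \<open>ps \<in> ?D\<close> valid_pieces_ex[of _ ps q] by (auto simp: sites_computable_def)
      qed
      ultimately show ?thesis
        using that length_select[of s us] by auto
    qed
    show "bounded_by ?D (\<lambda>ps. (length ps)\<^sup>2) (\<lambda>ps. Suc (length ps) * Suc (length ps))"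
      by (rule bounded_byI[of _ _ 4]) (use square_bound[of _ 1] in simp)
  qed (auto intro: computable_id computable_const)
  then show ?thesis
    by (rule computable_cong) (simp add: select_def)
qed

lemma small_child:
  assumes "p \<in> small m" "distinct (fst p)" "x \<in> set (fst p)"
  shows "child \<tau> w p e x \<in> small m"
proof -
  let ?q = "w # removeAll x (fst p)"
  have "length ?q = length (fst p)"
    using assms(2,3) by (simp add: distinct_remove1_removeAll[symmetric] length_remove1)
      (metis One_nat_def Suc_pred length_pos_if_in_set)
  then have q: "length ?q \<le> m"
    using assms(1) by (simp add: small_def)
  have "length (normal ?q G) \<le> 2 ^ m" for G
  proof -
    have "length (normal ?q G) \<le> length (subseqs ?q)"
      unfolding normal_def by (rule length_filter_le)
    also have "\<dots> \<le> 2 ^ m"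
      unfolding length_subseqs using q by (intro power_increasing) auto
    finally show ?thesis .
  qed
  moreover have "length g \<le> m" if "g \<in> set (normal ?q G)" for g G
    using that q length_subseq_le[of g ?q] by (auto simp: normal_def)
  ultimately show ?thesis
    using q by (simp add: small_def child_def)
qed

lemma small_split:
  assumes "p \<in> small m" "distinct (fst p)"
  shows "set (split \<tau> w p) \<subseteq> small m"
proof (cases "set \<tau> \<subseteq> set (fst p)")
  case True
  then show ?thesis
    using small_child[OF assms] set_order[OF True] by (auto simp: split_def)
next
  case False
  then show ?thesis
    using assms by (simp add: split_def)
qed

lemma small_normal:
  assumes "length q \<le> m"
  shows "(q, normal q G) \<in> small m"
proof -
  have "length (normal q G) \<le> length (subseqs q)"
    unfolding normal_def by (rule length_filter_le)
  also have "\<dots> \<le> 2 ^ m"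
    unfolding length_subseqs using assms by (intro power_increasing) auto
  finally show ?thesis
    using assms length_subseq_le[of _ q] by (force simp: small_def normal_def)
qed

lemma small_step:
  assumes F: "fresh_supply K L (\<lambda>n. n) n0" and "fresh_supply.reached K L (\<lambda>n. n) n0 ss st"
    and "set (fst st) \<subseteq> small m"
  shows "set (fst (step (\<lambda>n. n) \<tau> st)) \<subseteq> small m"
proof -
  interpret fresh_supply K L "\<lambda>n. n" n0
    by (rule F)
  have "set (split \<tau> w p) \<subseteq> small m" if "p \<in> set (fst st)" for w p
    using small_split reached_piece(2)[OF assms(2) that] assms(3) that by blast
  then show ?thesis
    unfolding step_def by auto
qed

text \<open>The complexes are quantified inside because the program may depend on \<open>m\<close>
  only.\<close>

definition good_states :: "nat \<Rightarrow> nat state set" where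
  "good_states m = {st. set (fst st) \<subseteq> small m \<and>
     (\<exists>K L n0 ss. fresh_supply K L (\<lambda>n. n) n0 \<and> fresh_supply.reached K L (\<lambda>n. n) n0 ss st)}"

text \<open>Within a round the pieces multiply at most by \<open>m * m\<close>, and each selected
  piece records one subdivision; together this gives the factor \<open>m * m + 1\<close>.\<close>

lemma mid_round_good:
  fixes st0 :: "nat state"
  assumes st0: "st0 \<in> good_states m" and m: "0 < m" and sel: "select s (fst st0) = us @ vs"
  defines "st \<equiv> fold (\<lambda>p. step (\<lambda>n. n) (chosen_site s p)) us st0"
  shows "st \<in> good_states m" "size_state st \<le> (m * m + 1) * size_state st0"
proof -
  obtain K L n0 ss where F: "fresh_supply K L (\<lambda>n. n) n0"
    and ss: "fresh_supply.reached K L (\<lambda>n. n) n0 ss st0" and small: "set (fst st0) \<subseteq> small m"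
    using st0 unfolding good_states_def by blast
  interpret fresh_supply K L "\<lambda>n. n" n0
    by (rule F)
  have bad: "badness q \<le> 2 ^ m \<and> length (fst q) \<le> m" if "q \<in> set (fst st0)" for q
  proof -
    have len: "length (fst q) \<le> m"
      using small that by (auto simp: small_def)
    then have "(2 :: nat) ^ length (fst q) \<le> 2 ^ m"
      by (intro power_increasing) auto
    then show ?thesis
      using badness_le[of q] len by linarith
  qed
  have mid: "mid_round ss s m (2 ^ m) st0 us vs (fold (\<lambda>p. step (\<lambda>n. n) (chosen_site s p)) us st0)"
    if "select s (fst st0) = us @ vs" for us vs
    by (rule mid_round[OF ss _ that]) (rule bad)
  have "set (fst (fold (\<lambda>p. step (\<lambda>n. n) (chosen_site s p)) us st0)) \<subseteq> small m"
    if "select s (fst st0) = us @ vs" for us vs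
    using that
  proof (induction us arbitrary: vs rule: rev_induct)
    case (snoc p us)
    then have sel: "select s (fst st0) = us @ p # vs"
      by simp
    obtain ss where "reached ss (fold (\<lambda>p. step (\<lambda>n. n) (chosen_site s p)) us st0)"
      using mid[OF sel] unfolding mid_round_def by blast
    then show ?case
      using small_step[OF F _ snoc.IH[OF sel]] by simp
  qed (use small in simp)
  then have "set (fst st) \<subseteq> small m"
    using sel by (simp add: st_def)
  moreover have st: "mid_round ss s m (2 ^ m) st0 us vs st"
    unfolding st_def by (rule mid[OF sel])
  then have "\<exists>ss. reached ss st"
    unfolding mid_round_def by blast
  ultimately show "st \<in> good_states m"
    unfolding good_states_def using F by blast
  have "length us \<le> length (fst st0)"
    using length_select[of s "fst st0"] sel by simp
  then have "length (fst (snd st)) \<le> length (fst st0) + length (fst (snd st0))"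
    using st by (simp add: mid_round_def)
  moreover have "length (fst st) \<le> m * m * length (fst st0)"
    by (rule mid_round_length[OF st m])
  ultimately have "size_state st \<le> m * m * length (fst st0) + (length (fst st0) + length (fst (snd st0)))"
    unfolding size_state_def by (rule add_mono[rotated])
  also have "\<dots> \<le> (m * m + 1) * size_state st0"
    by (simp add: size_state_def algebra_simps)
  finally show "size_state st \<le> (m * m + 1) * size_state st0" .
qed

text \<open>Linearly many sites, each of them costing one pass over a state whose size remains
  linear.\<close>

lemma computable_round:
  assumes m: "0 < m"
  shows "computable enc_state enc_state (good_states m) (\<lambda>st. (size_state st)\<^sup>2) (round s (\<lambda>n. n))"
proof -
  let ?J = "{z. fst z \<in> good_states m \<and> fst (snd z) \<in> sites_computable m \<and>
    set (fst (snd (snd z))) \<subseteq> small m \<and>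
    size_state (snd (snd z)) \<le> (m * m + 1) * size_state (fst z)} :: (nat state \<times> nat piece \<times> nat state) set"
  let ?g = "\<lambda>st0 p. step (\<lambda>n. n) (chosen_site s p)"
  have valid: "\<exists>A. valid_pieces A (fst st)" if st: "st \<in> good_states m" for st
  proof -
    obtain K L n0 ss where F: "fresh_supply K L (\<lambda>n. n) n0"
      and ss: "fresh_supply.reached K L (\<lambda>n. n) n0 ss st"
      using st unfolding good_states_def by blast
    interpret fresh_supply K L "\<lambda>n. n" n0
      by (rule F)
    have "valid_pieces (\<lambda>F. F \<in> L) (fst st)"
      using ss by (simp add: reached_def)
    then show ?thesis
      by (rule exI[of "\<lambda>A. valid_pieces A (fst st)" "\<lambda>F. F \<in> L"])
  qed
  have "computable enc_state enc_state (good_states m) (\<lambda>st. (size_state st)\<^sup>2)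
      (\<lambda>st. fold (?g st) (select s (fst st)) st)"
  proof (rule computable_fold)
    show "computable (enc_pair enc_state (enc_pair enc_piece enc_state)) enc_state ?J
        (\<lambda>z. size_state (snd (snd z))) (\<lambda>z. ?g (fst z) (fst (snd z)) (snd (snd z)))"
    proof (rule computable_step_state)
      show "length (chosen_site s (fst (snd z))) \<le> m \<and> set (fst (snd (snd z))) \<subseteq> small m"
        if "z \<in> ?J" for z
      proof -
        have "fst (snd z) \<in> small m"
          using that by (auto simp: sites_computable_def)
        then show ?thesis
          using that small_lengths(1) length_chosen_site[of s "fst (snd z)"] by fastforce
      qed
    qed (rule computable_chosen_site[where m = m] computable_fst computable_snd computable_id bounded_by_self
        | simp)+
    show "computable enc_state (enc_list enc_piece) (good_states m) (\<lambda>st. (size_state st)\<^sup>2)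
        (\<lambda>st. select s (fst st))"
    proof (rule computable_comp[OF computable_fst_id computable_select])
      show "fst st \<in> {ps. (\<exists>A. valid_pieces A ps) \<and> set ps \<subseteq> small m}" if "st \<in> good_states m" for st
        using valid[OF that] that by (simp add: good_states_def)
      show "bounded_by (good_states m) (\<lambda>st. (size_state st)\<^sup>2) (\<lambda>st. (length (fst st))\<^sup>2)"
        by (rule bounded_byI[of _ _ 1]) (simp add: size_state_def power_mono le_SucI)
    qed
    show "(st, p, fold (?g st) us st) \<in> ?J"
      if "st \<in> good_states m" "select s (fst st) = us @ p # vs" for st us p vs
    proof -
      have p: "p \<in> set (fst st)" "surplus p \<noteq> []"
        using select_subset[of s "fst st"] that(2) by auto
      obtain A where "valid_pieces A (fst st)"
        using valid[OF \<open>st \<in> good_states m\<close>] by blast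
      then have "p \<in> sites_computable m"
        using p that(1) valid_pieces_ex[of A "fst st" p] by (auto simp: sites_computable_def good_states_def)
      then show ?thesis
        using mid_round_good[OF that(1) m that(2)] that(1) by (simp add: good_states_def)
    qed
    show "size_state (snd (snd z)) \<le> (m * m + 1) * size_state (fst z)" if "z \<in> ?J" for z
      using that by simp
    show "bounded_by (good_states m) (\<lambda>st. (size_state st)\<^sup>2)
        (\<lambda>st. Suc (length (select s (fst st))) * Suc ((m * m + 1) * size_state st))"
    proof (rule bounded_byI)
      fix st :: "nat state"
      have "length (select s (fst st)) \<le> size_state st"
        using length_select[of s "fst st"] by (simp add: size_state_def)
      then have "Suc (length (select s (fst st))) * Suc ((m * m + 1) * size_state st) \<le>
          Suc (size_state st) * Suc ((m * m + 1) * size_state st)"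
        by (intro mult_le_mono1) simp
      also have "\<dots> \<le> (2 * (m * m + 1) + 2) * Suc ((size_state st)\<^sup>2)"
        by (rule square_bound)
      finally show "Suc (length (select s (fst st))) * Suc ((m * m + 1) * size_state st) \<le>
          (2 * (m * m + 1) + 2) * Suc ((size_state st)\<^sup>2)" .
    qed
  qed (rule computable_id)
  then show ?thesis
    by (rule computable_cong) (simp add: round_def)
qed

lemma round_good:
  assumes "st \<in> good_states m" "0 < m"
  shows "round s (\<lambda>n. n) st \<in> good_states m"
    "size_state (round s (\<lambda>n. n) st) \<le> (m * m + 1) * size_state st"
  using mid_round_good[OF assms, of s "select s (fst st)" "[]"] by (simp_all add: round_def)

lemma rounds_good:
  assumes "st \<in> good_states m" "0 < m"
  shows "(round s (\<lambda>n. n) ^^ j) st \<in> good_states m \<and>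
    size_state ((round s (\<lambda>n. n) ^^ j) st) \<le> (m * m + 1) ^ j * size_state st"
proof (induction j)
  case (Suc j)
  then have "size_state ((round s (\<lambda>n. n) ^^ Suc j) st) \<le>
      (m * m + 1) * size_state ((round s (\<lambda>n. n) ^^ j) st)"
    using round_good(2)[OF _ assms(2)] by simp
  also have "\<dots> \<le> (m * m + 1) * ((m * m + 1) ^ j * size_state st)"
    using Suc by (intro mult_le_mono2) simp
  also have "\<dots> = (m * m + 1) ^ Suc j * size_state st"
    by (simp only: power_Suc mult.assoc)
  finally show ?case
    using Suc round_good(1)[OF _ assms(2)] by simp
qed (use assms in simp)

lemma bounded_by_square:
  assumes "\<And>x. x \<in> D \<Longrightarrow> f x \<le> k * g x"
  shows "bounded_by D (\<lambda>x. (g x)\<^sup>2) (\<lambda>x. (f x)\<^sup>2)"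
proof (rule bounded_byI)
  fix x assume "x \<in> D"
  then have "(f x)\<^sup>2 \<le> (k * g x)\<^sup>2"
    using assms by (intro power_mono) auto
  then show "(f x)\<^sup>2 \<le> k\<^sup>2 * Suc ((g x)\<^sup>2)"
    by (simp add: power_mult_distrib)
qed

text \<open>The number \<open>j\<close> is fixed, so the rounds are composed one by one, each
  enlarging the state by a constant factor.\<close>

lemma computable_rounds:
  assumes m: "0 < m"
  shows "computable enc_state enc_state (good_states m) (\<lambda>st. (size_state st)\<^sup>2) (round s (\<lambda>n. n) ^^ j)"
proof (induction j)
  case 0
  have "round s (\<lambda>n. n) ^^ 0 = (\<lambda>st. st)"
    by auto
  then show ?case
    by (simp only: computable_id)
next
  case (Suc j)
  have "computable enc_state enc_state (good_states m) (\<lambda>st. (size_state st)\<^sup>2)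
      (\<lambda>st. round s (\<lambda>n. n) ((round s (\<lambda>n. n) ^^ j) st))"
  proof (rule computable_comp[OF Suc computable_round[OF m]])
    show "bounded_by (good_states m) (\<lambda>st. (size_state st)\<^sup>2)
        (\<lambda>st. (size_state ((round s (\<lambda>n. n) ^^ j) st))\<^sup>2)"
      by (rule bounded_by_square[of _ _ "(m * m + 1) ^ j"]) (use rounds_good[OF _ m] in blast)
  qed (use rounds_good[OF _ m] in blast)
  then show ?case
    by (rule computable_cong) simp
qed

definition start_states :: "nat \<Rightarrow> nat state set" where
  "start_states m = {st. set (fst st) \<subseteq> small m \<and>
     (\<exists>K L n0. fresh_supply K L (\<lambda>n. n) n0 \<and> fresh_supply.reached K L (\<lambda>n. n) n0 [] st)}"

lemma start_states_force:
  assumes st: "st \<in> start_states m" and big: "fst st \<noteq> []" "tl (fst (hd (fst st))) \<noteq> []"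
  defines "st1 \<equiv> step (\<lambda>n. n) (fst (hd (fst st))) st"
  shows "fst st1 \<noteq> []" "tl (fst (hd (fst st1))) \<noteq> []" "set (fst st1) \<subseteq> small m"
    "size_state st1 \<le> (m + 3) * size_state st"
    "force (\<lambda>n. n) st \<in> good_states m" "size_state (force (\<lambda>n. n) st) \<le> (Suc m * Suc m + 3) * size_state st"
proof -
  obtain K L n0 where F: "fresh_supply K L (\<lambda>n. n) n0" and small: "set (fst st) \<subseteq> small m"
    and reach: "fresh_supply.reached K L (\<lambda>n. n) n0 [] st"
    using st unfolding start_states_def by blast
  interpret fresh_supply K L "\<lambda>n. n" n0
    by (rule F)
  have p: "hd (fst st) \<in> set (fst st)"
    using big(1) by simp
  have "2 \<le> length (fst (hd (fst st)))"
    using big(2) by (cases "fst (hd (fst st))") (auto simp: Suc_le_eq)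
  then have \<sigma>: "set (fst (hd (fst st))) \<in> current st" "2 \<le> card (set (fst (hd (fst st))))"
    using reached_piece(1,2)[OF reach p] by (simp_all add: distinct_card)
  note force = force_reached[OF reach \<sigma>]
  show "fst st1 \<noteq> []" "tl (fst (hd (fst st1))) \<noteq> []"
    using force(3,4) by (simp_all add: st1_def)
  show "set (fst st1) \<subseteq> small m"
    unfolding st1_def by (rule small_step[OF F reach small])
  have len: "length (fst q) \<le> m" if "q \<in> set (fst st)" for q
    using small that by (auto simp: small_def)
  have pos: "1 \<le> length (fst st)"
    using big(1) by (cases "fst st") auto
  have "length (fst st1) \<le> Suc m * length (fst st)" "length (fst (snd st1)) \<le> length (fst (snd st)) + 1"
    using step_bounds(2)[OF reach len] by (simp_all add: st1_def step_def)
  then show "size_state st1 \<le> (m + 3) * size_state st"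
    using pos by (simp add: size_state_def algebra_simps)
  obtain \<tau> \<tau>' where 1: "reached [Facet] (step (\<lambda>n. n) \<tau> st)"
    and 2: "force (\<lambda>n. n) st = step (\<lambda>n. n) \<tau>' (step (\<lambda>n. n) \<tau> st)"
    using force(2) by blast
  have "set (fst (force (\<lambda>n. n) st)) \<subseteq> small m"
    unfolding 2 by (rule small_step[OF F 1 small_step[OF F reach small]])
  then show "force (\<lambda>n. n) st \<in> good_states m"
    unfolding good_states_def using F force(1) by blast
  have "size_state (force (\<lambda>n. n) st) \<le> Suc m * (Suc m * length (fst st)) + (length (fst (snd st)) + 2)"
    unfolding size_state_def using force_bounds(2,3)[OF reach len \<sigma>] by (rule add_mono)
  also have "\<dots> \<le> (Suc m * Suc m + 3) * size_state st"
    using pos by (simp add: size_state_def algebra_simps)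
  finally show "size_state (force (\<lambda>n. n) st) \<le> (Suc m * Suc m + 3) * size_state st" .
qed

lemma force_good:
  assumes "st \<in> start_states m"
  shows "force (\<lambda>n. n) st \<in> good_states m" "size_state (force (\<lambda>n. n) st) \<le> (Suc m * Suc m + 3) * size_state st"
proof -
  have "force (\<lambda>n. n) st \<in> good_states m \<and> size_state (force (\<lambda>n. n) st) \<le> (Suc m * Suc m + 3) * size_state st"
  proof (cases "fst st = [] \<or> tl (fst (hd (fst st))) = []")
    case True
    then have "force (\<lambda>n. n) st = st"
      by (simp add: force_def)
    then show ?thesis
      using assms by (auto simp: start_states_def good_states_def)
  next
    case False
    then show ?thesis
      using start_states_force(5,6)[OF assms] by blast
  qed
  then show "force (\<lambda>n. n) st \<in> good_states m"
    "size_state (force (\<lambda>n. n) st) \<le> (Suc m * Suc m + 3) * size_state st"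
    by blast+
qed

lemma computable_force:
  "computable enc_state enc_state (start_states m) size_state (force (\<lambda>n. n))"
proof -
  \<comment> \<open>The test of \<open>force\<close> is written as a conditional, so that
    \<open>hd\<close> is computed for nonempty lists only; \<open>computable_disj\<close> would ask
    for both disjuncts everywhere.\<close>
  let ?big = "{st \<in> start_states m. \<not> (if fst st = [] then True else tl (fst (hd (fst st))) = [])}"
  let ?D1 = "{st. fst st \<noteq> [] \<and> tl (fst (hd (fst st))) \<noteq> [] \<and> set (fst st) \<subseteq> small m} :: nat state set"
  have small: "length (fst (hd ps)) \<le> m" if "ps \<noteq> []" "set ps \<subseteq> small m" for ps
    using that hd_in_set[of ps] small_lengths(1)[of "hd ps" m] by blast
  have first: "computable enc_state enc_state ?big size_state (\<lambda>st. step (\<lambda>n. n) (fst (hd (fst st))) st)"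
    by (rule computable_step_state[where m = m] computable_hd computable_fst computable_snd computable_id
        computable_fst_id bounded_by_self |
        (use small in \<open>auto simp: start_states_def split: if_splits\<close>)[1])+
  have second: "computable enc_state enc_state ?D1 size_state
      (\<lambda>st. step (\<lambda>n. n) (removeAll (hd (tl (fst (hd (fst st))))) (fst (hd (fst st)))) st)"
    by (rule computable_step_state[where m = m] computable_removeAll[where m = m] computable_hd computable_tl
        computable_fst computable_snd computable_id computable_fst_id bounded_by_self |
        (use small in \<open>auto intro: order_trans[OF length_removeAll_le]\<close>)[1])+
  let ?st1 = "\<lambda>st. step (\<lambda>n. n) (fst (hd (fst st))) st"
  have forced: "computable enc_state enc_state ?big size_state
      (\<lambda>st. step (\<lambda>n. n) (removeAll (hd (tl (fst (hd (fst (?st1 st)))))) (fst (hd (fst (?st1 st))))) (?st1 st))"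
  proof (rule computable_comp[OF first second])
    show "?st1 st \<in> ?D1" if "st \<in> ?big" for st
      using that start_states_force(1,2,3)[of st m] by (auto split: if_splits)
    show "bounded_by ?big size_state (\<lambda>st. size_state (?st1 st))"
    proof (rule bounded_byI)
      fix st assume "st \<in> ?big"
      then have "size_state (?st1 st) \<le> (m + 3) * size_state st"
        using start_states_force(4)[of st m] by (auto split: if_splits)
      also have "\<dots> \<le> (m + 3) * Suc (size_state st)"
        by simp
      finally show "size_state (?st1 st) \<le> (m + 3) * Suc (size_state st)" .
    qed
  qed
  have cond: "computable enc_state enc_bool (start_states m) size_state
      (\<lambda>st. if fst st = [] then True else tl (fst (hd (fst st))) = [])"
    by (rule computable_if computable_null computable_tl computable_hd computable_fst computable_const
        computable_id computable_fst_id | simp)+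
  have "computable enc_state enc_state (start_states m) size_state
      (\<lambda>st. if (if fst st = [] then True else tl (fst (hd (fst st))) = []) then st else
        step (\<lambda>n. n) (removeAll (hd (tl (fst (hd (fst (?st1 st)))))) (fst (hd (fst (?st1 st))))) (?st1 st))"
    by (rule computable_if[OF cond computable_id forced])
  then show ?thesis
    by (rule computable_cong) (auto simp: force_def Let_def)
qed

lemma initial_eq_fold:
  "fold (\<lambda>x s. (x # fst s, snd s @ [(x, normal x (fst s))])) xs (zs, ps) =
    (rev xs @ zs, ps @ initial zs xs)"
  by (induction xs arbitrary: zs ps) simp_all

lemma computable_by_dim:
  assumes xs: "computable ea enc_complex D b xs" and m: "\<And>x. x \<in> D \<Longrightarrow> \<forall>y\<in>set (xs x). length y \<le> m"
    and len: "bounded_by D b (\<lambda>x. length (xs x))"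
  shows "computable ea enc_complex D b (\<lambda>x. by_dim d (xs x))"
proof -
  have one: "computable enc_complex enc_complex {ys. \<forall>y\<in>set ys. length y \<le> m} length
      (filter (\<lambda>y. length y = c))" for c
    by (rule computable_filter computable_eq computable_length computable_const computable_id
        computable_snd_id bounded_by_self bounded_by_const[where m = m] | (auto)[1])+
  have filter: "computable ea enc_complex D b (\<lambda>x. filter (\<lambda>y. length y = c) (xs x))" for c
    by (rule computable_comp[OF xs one]) (use m len in auto)
  have "computable ea enc_complex D b (\<lambda>x. concat (map (\<lambda>c. filter (\<lambda>y. length y = c) (xs x)) cs))" for cs
  proof (induction cs)
    case (Cons c cs)
    then show ?case
      using computable_append[OF filter Cons bounded_by_filter[OF len]] by simp
  qed (simp add: computable_const)
  then show ?thesis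
    unfolding by_dim_def .
qed

lemma length_by_dim: "length (by_dim d xs) \<le> Suc d * length xs"
proof -
  have "length (concat (map (\<lambda>c. filter (\<lambda>x. length x = c) xs) cs)) \<le> length cs * length xs" for cs
    by (induction cs) (auto intro: add_mono)
  then show ?thesis
    unfolding by_dim_def using length_rev[of "[1..<Suc (Suc d)]"] by (metis diff_Suc_1 length_upt)
qed

lemma length_initial: "length (initial zs xs) = length xs"
  by (induction zs xs rule: initial.induct) auto

lemma initial_small: "\<forall>x\<in>set xs. length x \<le> m \<Longrightarrow> set (initial zs xs) \<subseteq> small m"
  by (induction zs xs rule: initial.induct) (auto simp: small_normal)

text \<open>Each facet is compared with all earlier ones and with those of \<open>L\<close>, and its
  piece is appended at the end. Both costs are linear per facet.\<close>

lemma computable_initial: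
  assumes "computable ea enc_complex D b zs" "computable ea enc_complex D b xs"
    and m: "\<And>x. x \<in> D \<Longrightarrow> \<forall>y\<in>set (zs x) \<union> set (xs x). length y \<le> m"
    and len: "bounded_by D b (\<lambda>x. (length (zs x) + length (xs x))\<^sup>2)"
  shows "computable ea (enc_list enc_piece) D b (\<lambda>x. initial (zs x) (xs x))"
proof -
  let ?D = "{q. \<forall>y\<in>set (fst q) \<union> set (snd q). length y \<le> m} :: (nat list list \<times> nat list list) set"
  let ?n = "\<lambda>q. length (fst q) + length (snd q) :: nat"
  let ?es = "enc_pair enc_complex (enc_list enc_piece)"
  let ?J = "{z. length (fst (snd z)) \<le> m \<and> (\<forall>y\<in>set (fst (snd (snd z))). length y \<le> m) \<and>
    length (fst (snd (snd z))) + length (snd (snd (snd z))) \<le> 2 * ?n (fst z)}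
    :: ((nat list list \<times> nat list list) \<times> nat list \<times> nat list list \<times> nat piece list) set"
  let ?g = "\<lambda>x s. (x # fst s, snd s @ [(x, normal x (fst s))])"
  have "computable (enc_pair enc_complex enc_complex) ?es ?D (\<lambda>q. (?n q)\<^sup>2)
      (\<lambda>q. fold ?g (snd q) (fst q, []))"
  proof (rule computable_fold[where J = ?J and bs = "\<lambda>z. length (fst (snd (snd z))) + length (snd (snd (snd z)))"
        and B = "\<lambda>q. 2 * ?n q"])
    show "computable (enc_pair (enc_pair enc_complex enc_complex) (enc_pair enc_simplex ?es)) ?es ?J
        (\<lambda>z. length (fst (snd (snd z))) + length (snd (snd (snd z)))) (\<lambda>z. ?g (fst (snd z)) (snd (snd z)))"
      by (rule computable_pair computable_Cons computable_append computable_normal[where m = m]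
          computable_const computable_fst computable_snd computable_id |
          (rule bounded_byI[where k = 1], simp) | (auto)[1])+
    show "(q, x, fold ?g us (fst q, [])) \<in> ?J" if "q \<in> ?D" "snd q = us @ x # vs" for q us x vs
      unfolding initial_eq_fold using that by (auto simp: length_initial)
    show "bounded_by ?D (\<lambda>q. (?n q)\<^sup>2) (\<lambda>q. Suc (length (snd q)) * Suc (2 * ?n q))"
    proof (rule bounded_byI)
      fix q :: "nat list list \<times> nat list list"
      have "Suc (length (snd q)) * Suc (2 * ?n q) \<le> Suc (?n q) * Suc (2 * ?n q)"
        by (rule mult_le_mono1) simp
      also have "\<dots> \<le> (2 * 2 + 2) * Suc ((?n q)\<^sup>2)"
        by (rule square_bound)
      finally show "Suc (length (snd q)) * Suc (2 * ?n q) \<le> (2 * 2 + 2) * Suc ((?n q)\<^sup>2)" .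
    qed
  qed (rule computable_pair computable_fst_id computable_snd_id computable_const | simp)+
  from computable_snd[OF this]
  have "computable (enc_pair enc_complex enc_complex) (enc_list enc_piece) ?D (\<lambda>q. (?n q)\<^sup>2)
      (\<lambda>q. initial (fst q) (snd q))"
    by (simp add: initial_eq_fold)
  from computable_comp2[OF assms(1,2) this] show ?thesis
    using m len by simp
qed

text \<open>The new vertices are counted upwards from this number.\<close>

definition above :: "nat list list \<Rightarrow> nat" where
  "above xs = fold (\<lambda>v a. if v < a then a else Suc v) (concat xs) 0"

lemma fold_above:
  fixes vs :: "nat list"
  shows "a \<le> fold (\<lambda>v a. if v < a then a else Suc v) vs a"
    and "v \<in> set vs \<Longrightarrow> v < fold (\<lambda>v a. if v < a then a else Suc v) vs a"
proof -
  show le: "a \<le> fold (\<lambda>v a. if v < a then a else Suc v) vs a" for vs and a :: nat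
  proof (induction vs arbitrary: a)
    case (Cons v vs)
    have "a \<le> (if v < a then a else Suc v)"
      by simp
    also have "\<dots> \<le> fold (\<lambda>v a. if v < a then a else Suc v) (v # vs) a"
      unfolding fold_Cons comp_apply by (rule Cons.IH)
    finally show ?case .
  qed simp
  show "v \<in> set vs \<Longrightarrow> v < fold (\<lambda>v a. if v < a then a else Suc v) vs a"
  proof (induction vs arbitrary: a)
    case (Cons u vs)
    show ?case
    proof (cases "v = u")
      case True
      have "v < (if v < a then a else Suc v)"
        by simp
      also have "\<dots> \<le> fold (\<lambda>v a. if v < a then a else Suc v) (u # vs) a"
        unfolding fold_Cons comp_apply True by (rule le)
      finally show ?thesis .
    next
      case False
      then have "v \<in> set vs"
        using Cons.prems by simp
      then show ?thesis
        unfolding fold_Cons comp_apply by (rule Cons.IH)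
    qed
  qed simp
qed

lemma above: "x \<in> set xs \<Longrightarrow> v \<in> set x \<Longrightarrow> v < above xs"
  unfolding above_def by (rule fold_above(2)) auto

lemma computable_above:
  assumes "computable ea enc_complex D b xs" "\<And>x. x \<in> D \<Longrightarrow> \<forall>y\<in>set (xs x). length y \<le> m"
    and "bounded_by D b (\<lambda>x. length (xs x))"
  shows "computable ea Num D b (\<lambda>x. above (xs x))"
proof -
  let ?D = "{xs. \<forall>y\<in>set xs. length y \<le> m} :: nat list list set"
  have len: "length (concat xs) \<le> m * length xs" if "xs \<in> ?D" for xs
    using that by (induction xs) auto
  have bound: "bounded_by ?D length (\<lambda>xs. length (concat xs))"
  proof (rule bounded_byI)
    show "length (concat xs) \<le> m * Suc (length xs)" if "xs \<in> ?D" for xs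
      using len[OF that] by simp
  qed
  have "computable enc_complex Num ?D length (\<lambda>xs. fold (\<lambda>v a. if v < a then a else Suc v) (concat xs) 0)"
  proof (rule computable_fold[where J = UNIV and bs = "\<lambda>_. 0" and B = "\<lambda>_. 0"])
    show "computable (enc_pair enc_complex (enc_pair Num Num)) Num UNIV (\<lambda>_. 0)
        (\<lambda>z. if fst (snd z) < snd (snd z) then snd (snd z) else Suc (fst (snd z)))"
      by (rule computable_if computable_less computable_Suc computable_fst computable_snd computable_id)+
    show "computable enc_complex enc_simplex ?D length concat"
      by (rule computable_concat[where m = m] computable_id bounded_by_self | simp)+
  qed (use computable_const bounded_by_Suc[OF bound, of 0] in auto)
  then have "computable enc_complex Num ?D length above"
    by (rule computable_cong) (simp add: above_def)
  from computable_comp[OF assms(1) this] show ?thesis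
    using assms(2,3) by simp
qed

definition inputs :: "nat \<Rightarrow> (nat list list \<times> nat list list) set" where
  "inputs d = {q. \<exists>K L. relative_complex K L \<and> (\<forall>\<sigma>\<in>K. card \<sigma> \<le> d + 1) \<and>
     listing (fst q) K \<and> listing (snd q) L}"

lemma length_listing: "listing xs K \<Longrightarrow> length xs = card (facets K)"
  unfolding listing_def by (metis distinct_card length_map)

text \<open>A facet of \<open>L\<close> is a face of some facet of \<open>K\<close>, which has at
  most \<open>2 ^ Suc d\<close> faces. So the time can be measured by the facets of \<open>K\<close>
  alone.\<close>

lemma inputs_bounds:
  assumes "q \<in> inputs d"
  shows "\<forall>y\<in>set (fst q) \<union> set (snd q). length y \<le> Suc d"
    and "length (snd q) \<le> 2 ^ Suc d * length (fst q)"
proof -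
  obtain K L where KL: "relative_complex K L" and d: "\<And>\<sigma>. \<sigma> \<in> K \<Longrightarrow> card \<sigma> \<le> d + 1"
    and xs: "listing (fst q) K" and ys: "listing (snd q) L"
    using assms unfolding inputs_def by blast
  have K: "simplicial_complex K" and "L \<subseteq> K"
    using KL by (auto simp: relative_complex_def)
  have "length y \<le> Suc d" if "listing zs M" "M \<subseteq> K" "y \<in> set zs" for zs M y
  proof -
    have "set y \<in> facets M" "distinct y"
      using that by (auto simp: listing_def)
    then have "card (set y) \<le> d + 1"
      using d that(2) by (auto simp: facets_def)
    then show ?thesis
      using \<open>distinct y\<close> by (simp add: distinct_card)
  qed
  then show "\<forall>y\<in>set (fst q) \<union> set (snd q). length y \<le> Suc d"
    using xs ys \<open>L \<subseteq> K\<close> by blast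
  have "finite K"
    using K unfolding simplicial_complex_def by blast
  then have finK: "finite (facets K)"
    by (rule finite_subset[rotated]) (auto simp: facets_def)
  have "facets L \<subseteq> (\<Union>\<sigma>\<in>facets K. Pow \<sigma>)"
  proof
    fix F assume "F \<in> facets L"
    then have "F \<in> K"
      using \<open>L \<subseteq> K\<close> by (auto simp: facets_def)
    then show "F \<in> (\<Union>\<sigma>\<in>facets K. Pow \<sigma>)"
      using in_complex_iff_facet[OF K, of F] by simp
  qed
  moreover have "finite \<sigma>" if "\<sigma> \<in> facets K" for \<sigma>
    using K that unfolding simplicial_complex_def facets_def by blast
  then have "finite (\<Union>\<sigma>\<in>facets K. Pow \<sigma>)"
    using finK by simp
  ultimately have "card (facets L) \<le> card (\<Union>\<sigma>\<in>facets K. Pow \<sigma>)"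
    by (intro card_mono)
  also have "\<dots> \<le> (\<Sum>\<sigma>\<in>facets K. card (Pow \<sigma>))"
    by (rule card_UN_le[OF finK])
  also have "\<dots> \<le> (\<Sum>\<sigma>\<in>facets K. 2 ^ Suc d)"
  proof (rule sum_mono)
    fix \<sigma> assume "\<sigma> \<in> facets K"
    then have "\<sigma> \<in> K" "finite \<sigma>"
      using K unfolding facets_def simplicial_complex_def by blast+
    then show "card (Pow \<sigma>) \<le> 2 ^ Suc d"
      using d[of \<sigma>] by (simp add: card_Pow del: power_Suc)
  qed
  finally show "length (snd q) \<le> 2 ^ Suc d * length (fst q)"
    using length_listing[OF xs] length_listing[OF ys] by (simp add: mult.commute)
qed

lemma computable_initial_inputs:
  "computable (enc_pair enc_complex enc_complex) (enc_list enc_piece) (inputs d) (\<lambda>q. (length (fst q))\<^sup>2)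
    (\<lambda>q. initial (snd q) (by_dim d (fst q)))"
proof (rule computable_initial[where m = "Suc d"])
  have "length (fst q) \<le> 1 * Suc ((length (fst q))\<^sup>2)" for q :: "nat list list \<times> nat list list"
    by (cases "length (fst q)") (auto simp: power2_eq_square)
  then show "computable (enc_pair enc_complex enc_complex) enc_complex (inputs d) (\<lambda>q. (length (fst q))\<^sup>2)
      (\<lambda>q. by_dim d (fst q))"
    using inputs_bounds(1)[of _ d]
    by (intro computable_by_dim[where m = "Suc d"] computable_fst_id bounded_byI[of _ _ 1]) auto
  show "\<forall>y\<in>set (snd q) \<union> set (by_dim d (fst q)). length y \<le> Suc d" if "q \<in> inputs d" for q
    using inputs_bounds(1)[OF that] by (auto simp: set_by_dim)
  show "bounded_by (inputs d) (\<lambda>q. (length (fst q))\<^sup>2) (\<lambda>q. (length (snd q) + length (by_dim d (fst q)))\<^sup>2)"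
  proof (rule bounded_by_square)
    fix q assume "q \<in> inputs d"
    then have "length (snd q) + length (by_dim d (fst q)) \<le> 2 ^ Suc d * length (fst q) + Suc d * length (fst q)"
      using inputs_bounds(2) length_by_dim by (intro add_mono)
    then show "length (snd q) + length (by_dim d (fst q)) \<le> (2 ^ Suc d + Suc d) * length (fst q)"
      by (simp only: add_mult_distrib)
  qed
qed (rule computable_snd_id)

lemma fresh_supply_above:
  assumes KL: "relative_complex K L" and xs: "listing xs K"
  shows "fresh_supply K L (\<lambda>n. n) (above xs)"
proof
  have K: "simplicial_complex K"
    using KL by (auto simp: relative_complex_def)
  show "n \<notin> \<Union>K" if "above xs \<le> n" for n
  proof
    assume "n \<in> \<Union>K"
    then obtain F where "F \<in> K" "n \<in> F"
      by blast
    then obtain x where "x \<in> set xs" "n \<in> set x"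
      using covered_listing[OF K xs, of F] by (auto simp: covered_def)
    then show False
      using above that by (metis leD)
  qed
qed (use KL in auto)

lemma start_state:
  fixes q :: "nat list list \<times> nat list list"
  assumes "q \<in> inputs d"
  defines "st \<equiv> (initial (snd q) (by_dim d (fst q)), [], above (fst q))"
  shows "st \<in> start_states (Suc d)" "size_state st \<le> Suc d * length (fst q)"
proof -
  obtain K L where KL: "relative_complex K L" and d: "\<And>\<sigma>. \<sigma> \<in> K \<Longrightarrow> card \<sigma> \<le> d + 1"
    and xs: "listing (fst q) K" and ys: "listing (snd q) L"
    using assms unfolding inputs_def by blast
  interpret fresh_supply K L "\<lambda>n. n" "above (fst q)"
    by (rule fresh_supply_above[OF KL xs])
  have "reached [] st"
    unfolding st_def by (rule initial_reached(1)[OF d xs ys])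
  moreover have "set (fst st) \<subseteq> small (Suc d)"
    unfolding st_def fst_conv by (rule initial_small) (simp add: set_by_dim)
  ultimately show "st \<in> start_states (Suc d)"
    unfolding start_states_def using fresh_supply_axioms by blast
  show "size_state st \<le> Suc d * length (fst q)"
    using length_by_dim[of d "fst q"] by (simp add: size_state_def st_def length_initial)
qed

lemma start_states_good: "start_states m \<subseteq> good_states m"
  unfolding start_states_def good_states_def by blast

text \<open>Each stage enlarges the state by a factor depending on \<open>d\<close> only. So all
  states have size linear in the number of facets, and no stage exceeds quadratic time.\<close>

lemma computable_subdivide:
  "computable (enc_pair enc_complex enc_complex) (enc_pair enc_steps (enc_tiles Num)) (inputs d)
    (\<lambda>q. (length (fst q))\<^sup>2)
    (\<lambda>q. let st = subdivide d m (\<lambda>n. n) (above (fst q)) (fst q) (snd q) in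
      (fst (snd st), map tile_of (fst st)))"
proof -
  let ?e = "enc_pair enc_complex enc_complex" and ?b = "\<lambda>q :: nat list list \<times> nat list list. (length (fst q))\<^sup>2"
  let ?start = "\<lambda>q. (initial (snd q) (by_dim d (fst q)), [], above (fst q)) :: nat state"
  \<comment> \<open>The growth factor of \<open>force_good\<close> for
    \<open>m = Suc d\<close>.\<close>
  let ?c = "Suc (Suc d) * Suc (Suc d) + 3" and ?D = "good_states (Suc d)"
  let ?force = "\<lambda>st. if m = Mixed then force (\<lambda>n. n) st else st"
  let ?rounds = "round (kind m) (\<lambda>n. n) ^^ (2 ^ Suc d) :: nat state \<Rightarrow> nat state"
  have square: "bounded_by (inputs d) ?b (\<lambda>q. (f q)\<^sup>2)" if "\<And>q. q \<in> inputs d \<Longrightarrow> f q \<le> k * length (fst q)" for f k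
    by (rule bounded_by_square[OF that])
  have linear: "bounded_by (inputs d) ?b f" if "\<And>q. q \<in> inputs d \<Longrightarrow> f q \<le> k * length (fst q)" for f k
  proof (rule bounded_byI)
    fix q assume "q \<in> inputs d"
    then have "f q \<le> k * length (fst q)"
      by (rule that)
    also have "\<dots> \<le> k * Suc (?b q)"
      by (rule mult_le_mono2) (cases "length (fst q)"; simp add: power2_eq_square)
    finally show "f q \<le> k * Suc (?b q)" .
  qed
  have start: "computable ?e enc_state (inputs d) ?b ?start"
    by (rule computable_pair computable_initial_inputs computable_const computable_above[where m = "Suc d"]
        computable_fst_id linear[where k = 1] | (use inputs_bounds(1)[of _ d] in auto)[1])+
  have forced: "?force (?start q) \<in> ?D \<and> size_state (?force (?start q)) \<le> (?c * Suc d) * length (fst q)"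
    if "q \<in> inputs d" for q
  proof (cases "m = Mixed")
    case True
    have "size_state (force (\<lambda>n. n) (?start q)) \<le> ?c * size_state (?start q)"
      by (rule force_good(2)[OF start_state(1)[OF that]])
    also have "\<dots> \<le> ?c * (Suc d * length (fst q))"
      by (rule mult_le_mono2[OF start_state(2)[OF that]])
    finally show ?thesis
      using True force_good(1)[OF start_state(1)[OF that]] by (simp only: if_True mult.assoc simp_thms)
  next
    case False
    have "size_state (?start q) \<le> 1 * (Suc d * length (fst q))"
      using start_state(2)[OF that] by simp
    also have "\<dots> \<le> ?c * (Suc d * length (fst q))"
      by (rule mult_le_mono1) simp
    finally show ?thesis
      using False start_state(1)[OF that] start_states_good by (auto simp only: if_False mult.assoc)
  qed
  have force: "computable ?e enc_state (inputs d) ?b (\<lambda>q. ?force (?start q))"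
  proof (cases "m = Mixed")
    case True
    have "computable ?e enc_state (inputs d) ?b (\<lambda>q. force (\<lambda>n. n) (?start q))"
      by (rule computable_comp[OF start computable_force start_state(1)]) (auto intro: linear[OF start_state(2)])
    then show ?thesis
      using True by simp
  next
    case False
    then show ?thesis
      using start by simp
  qed
  have rounds: "computable ?e enc_state (inputs d) ?b (\<lambda>q. ?rounds (?force (?start q)))"
    by (rule computable_comp[OF force computable_rounds[of "Suc d"]])
      (use forced square[of "\<lambda>q. size_state (?force (?start q))" "?c * Suc d"] in blast)+
  have "computable enc_state (enc_pair enc_steps (enc_tiles Num)) ?D size_state
      (\<lambda>st. (fst (snd st), map tile_of (fst st)))"
    unfolding enc_steps_def enc_tiles_def
    by (rule computable_pair computable_map computable_tile_of[where m = "Suc d"]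
        computable_fst computable_snd computable_id computable_fst_id computable_snd_id |
        (rule bounded_byI[where k = 1], simp add: size_state_def) | (auto simp: good_states_def)[1])+
  from computable_comp[OF rounds this]
  have "computable ?e (enc_pair enc_steps (enc_tiles Num)) (inputs d) ?b
      (\<lambda>q. (fst (snd (?rounds (?force (?start q)))), map tile_of (fst (?rounds (?force (?start q))))))"
  proof this
    fix q assume q: "q \<in> inputs d"
    show "?rounds (?force (?start q)) \<in> ?D"
      using rounds_good[of "?force (?start q)" "Suc d"] forced[OF q] by blast
  next
    show "bounded_by (inputs d) ?b (\<lambda>q. size_state (?rounds (?force (?start q))))"
    proof (rule linear)
      fix q assume q: "q \<in> inputs d"
      let ?k = "(Suc d * Suc d + 1) ^ (2 ^ Suc d)"
      have "size_state (?rounds (?force (?start q))) \<le> ?k * size_state (?force (?start q))"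
        using rounds_good[of "?force (?start q)" "Suc d"] forced[OF q] by blast
      also have "\<dots> \<le> ?k * ((?c * Suc d) * length (fst q))"
        using forced[OF q] by (intro mult_le_mono2) blast
      finally show "size_state (?rounds (?force (?start q))) \<le> (?k * (?c * Suc d)) * length (fst q)"
        by (simp only: mult.assoc)
    qed
  qed
  then show ?thesis
    by (rule computable_cong) (simp add: subdivide_def Let_def)
qed

section \<open>Running time of the barycentric subdivision\<close>

lemma length_perms:
  assumes "length \<sigma> \<le> m"
  shows "length (perms n \<sigma>) \<le> Suc m ^ n"
  using assms
proof (induction n arbitrary: \<sigma>)
  case (Suc n)
  have "length (concat (map (\<lambda>v. map (Cons v) (perms n (removeAll v \<sigma>))) vs)) \<le> length vs * Suc m ^ n" for vs
  proof (induction vs)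
    case (Cons v vs)
    have "length (perms n (removeAll v \<sigma>)) \<le> Suc m ^ n"
      by (rule Suc.IH) (rule order_trans[OF length_removeAll_le Suc.prems])
    then show ?case
      using Cons by simp
  qed simp
  also have "length \<sigma> * Suc m ^ n \<le> Suc m * Suc m ^ n"
    using Suc.prems by (intro mult_le_mono1) simp
  finally show ?case
    using one_le_power[of "Suc m" "Suc n"] by (cases "\<sigma> = []") auto
qed simp

lemma length_in_perms: "\<pi> \<in> set (perms n \<sigma>) \<Longrightarrow> length \<pi> \<le> n"
  by (induction n arbitrary: \<sigma> \<pi>) (auto split: if_splits)

text \<open>Induction on \<open>n\<close> unrolls the recursion: the program for
  \<open>Suc n\<close> runs the one for \<open>n\<close> on each list with one vertex
  omitted.\<close>

lemma computable_perms:
  "computable enc_simplex enc_complex {\<sigma>. length \<sigma> \<le> m} (\<lambda>_. 0) (perms n)"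
proof (induction n)
  case 0
  show ?case
    by (simp add: computable_const)
next
  case (Suc n)
  let ?Z = "{z. fst z \<in> {x \<in> {\<sigma>. length \<sigma> \<le> m}. x \<noteq> []} \<and> snd z \<in> set (fst z)} :: (nat list \<times> nat) set"
  have rec: "computable (enc_pair enc_simplex Num) enc_complex ?Z (\<lambda>_. 0)
      (\<lambda>z. perms n (removeAll (snd z) (fst z)))"
  proof (rule computable_comp[OF _ Suc])
    show "computable (enc_pair enc_simplex Num) enc_simplex ?Z (\<lambda>_. 0) (\<lambda>z. removeAll (snd z) (fst z))"
      by (rule computable_removeAll[where m = m] computable_fst computable_snd computable_id
          computable_fst_id computable_snd_id | (auto)[1])+
  qed (auto intro: order_trans[OF length_removeAll_le] bounded_by_const)
  have block: "computable (enc_pair enc_simplex Num) enc_complex ?Z (\<lambda>_. 0)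
      (\<lambda>z. map (Cons (snd z)) (perms n (removeAll (snd z) (fst z))))"
    by (rule computable_map rec computable_Cons computable_fst computable_snd computable_id
        computable_snd_id bounded_by_const[where m = "Suc m ^ n"] |
        (auto intro: length_perms order_trans[OF length_removeAll_le])[1])+
  have "computable enc_simplex enc_complex {\<sigma>. length \<sigma> \<le> m} (\<lambda>_. 0)
      (\<lambda>\<sigma>. if \<sigma> = [] then [[]] else concat (map (\<lambda>v. map (Cons v) (perms n (removeAll v \<sigma>))) \<sigma>))"
    by (rule block computable_if computable_null computable_const computable_concat[where m = "Suc m ^ n"]
        computable_map computable_id bounded_by_map bounded_by_const[where m = m] |
        (auto intro: length_perms order_trans[OF length_removeAll_le])[1])+
  then show ?case
    by (rule computable_cong) simp
qed

lemma computable_tails: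
  assumes "computable ea enc_simplex D b \<pi>" "\<And>x. x \<in> D \<Longrightarrow> length (\<pi> x) \<le> m"
  shows "computable ea enc_complex D b (\<lambda>x. tails (\<pi> x))"
proof -
  let ?g = "\<lambda>x acc. (x # (if acc = [] then [] else hd acc)) # acc"
  have "computable enc_simplex enc_complex {\<pi>. length \<pi> \<le> m} (\<lambda>_. 0) (\<lambda>\<pi>. foldr ?g \<pi> [])"
    by (rule computable_foldr_const computable_Cons computable_if computable_null computable_hd computable_const
        computable_fst computable_snd computable_id bounded_by_const[where m = m] | (auto)[1])+
  moreover have tails: "foldr ?g xs [] = tails xs" for xs :: "nat list"
  proof (induction xs)
    case (Cons x xs)
    then show ?case
      by (cases xs) auto
  qed simp
  ultimately have "computable enc_simplex enc_complex {\<pi>. length \<pi> \<le> m} (\<lambda>_. 0) tails"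
    by (intro computable_cong[of _ _ _ _ "\<lambda>\<pi>. foldr ?g \<pi> []" tails])
  from computable_comp[OF assms(1) this] show ?thesis
    using assms(2) by (simp add: bounded_by_const)
qed

lemma computable_position:
  assumes "computable ea enc_simplex D b \<sigma>" "computable ea Num D b v"
    and "\<And>x. x \<in> D \<Longrightarrow> length (\<sigma> x) \<le> m"
  shows "computable ea Num D b (\<lambda>x. position (\<sigma> x) (v x))"
proof -
  have "computable (enc_pair enc_simplex Num) Num {q. length (fst q) \<le> m} (\<lambda>_. 0)
      (\<lambda>q. position (fst q) (snd q))"
    unfolding position_def
    by (rule computable_length computable_takeWhile computable_not computable_eq computable_fst computable_snd
        computable_id computable_fst_id computable_snd_id bounded_by_const[where m = m] |
        (auto intro: order_trans[OF length_takeWhile_le])[1])+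
  from computable_comp2[OF assms(1,2) this] show ?thesis
    using assms(3) by (simp add: bounded_by_const)
qed

lemma computable_descents:
  assumes "computable ea enc_simplex D b \<sigma>" "computable ea enc_simplex D b \<pi>"
    and "\<And>x. x \<in> D \<Longrightarrow> length (\<sigma> x) \<le> m \<and> length (\<pi> x) \<le> m"
  shows "computable ea enc_complex D b (\<lambda>x. descents (position (\<sigma> x)) (\<pi> x))"
proof -
  let ?D = "{q. length (fst q) \<le> m \<and> length (snd q) \<le> m} :: (nat list \<times> nat list) set"
  \<comment> \<open>Working from the right, the accumulator holds the suffix read so far and its
    descents; the head of that suffix is the entry to compare with.\<close>
  let ?g = "\<lambda>q x s. (x # fst s,
    if fst s = [] then snd s
    else if position (fst q) (hd (fst s)) < position (fst q) x then fst s # snd s else snd s)"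
  have "computable (enc_pair enc_simplex enc_simplex) (enc_pair enc_simplex enc_complex) ?D (\<lambda>_. 0)
      (\<lambda>q. foldr (?g q) (snd q) ([], []))"
    by (rule computable_foldr_const computable_pair computable_Cons computable_if computable_null computable_less
        computable_position[where m = m] computable_hd computable_const computable_fst computable_snd computable_id
        computable_fst_id computable_snd_id bounded_by_const[where m = m] | (auto)[1])+
  from computable_snd[OF this]
  have loop: "computable (enc_pair enc_simplex enc_simplex) enc_complex ?D (\<lambda>_. 0)
      (\<lambda>q. snd (foldr (?g q) (snd q) ([], [])))" .
  have eq: "foldr (?g q) xs ([], []) = (xs, descents (position (fst q)) xs)" for q xs
    by (induction xs) (simp_all add: descents_Cons)
  have "computable (enc_pair enc_simplex enc_simplex) enc_complex ?D (\<lambda>_. 0)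
      (\<lambda>q. descents (position (fst q)) (snd q))"
    by (rule computable_cong[OF loop]) (simp only: eq snd_conv)
  from computable_comp2[OF assms(1,2) this] show ?thesis
    using assms(3) by (simp add: bounded_by_const)
qed

lemma length_tails: "length (tails \<pi>) = length \<pi>"
  by (induction \<pi>) auto

lemma length_in_tails: "s \<in> set (tails \<pi>) \<Longrightarrow> length s \<le> length \<pi>"
  by (induction \<pi>) auto

lemma length_descents: "length (descents k \<pi>) \<le> length \<pi>"
  by (induction k \<pi> rule: descents.induct) auto

lemma length_in_descents: "s \<in> set (descents k \<pi>) \<Longrightarrow> length s \<le> length \<pi>"
  using descents_in_tails length_in_tails by blast

lemma computable_sd_tile:
  "computable (enc_pair enc_piece enc_simplex) (enc_pair (enc_list enc_simplex) (enc_list (enc_list enc_simplex)))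
    {q. fst q \<in> small m \<and> length (snd q) \<le> m} (\<lambda>_. 0) (\<lambda>q. sd_tile (fst q) (snd q))"
proof -
  let ?desc = "\<lambda>q. descents (position (fst (fst q))) (snd q)"
  let ?R = "\<lambda>q. map (\<lambda>s. filter (\<lambda>t. length t \<noteq> length s) (tails (snd q))) (?desc q)"
  have "computable (enc_pair enc_piece enc_simplex) (enc_pair enc_complex (enc_list enc_complex))
      {q. fst q \<in> small m \<and> length (snd q) \<le> m} (\<lambda>_. 0)
      (\<lambda>q. (tails (snd q),
        if \<exists>s\<in>set (?desc q). \<not> covered (snd (fst q)) (set s) then ?R q
        else filter (\<lambda>t. covered (snd (fst q)) (set t)) (tails (snd q)) # ?R q))"
    by (rule computable_pair computable_if computable_Cons computable_bex computable_map computable_filter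
        computable_not computable_eq computable_length computable_covered_small[where m = m]
        computable_tails[where m = m] computable_descents[where m = m]
        computable_fst computable_snd computable_id computable_fst_id computable_snd_id
        bounded_by_const[where m = m] |
        (auto simp: length_tails dest: small_lengths(1) intro: order_trans[OF length_in_tails]
          order_trans[OF length_descents] order_trans[OF length_in_descents] le_SucI)[1])+
  then show ?thesis
    by (rule computable_cong) (simp add: sd_tile_def sd_removed_def Let_def)
qed

text \<open>Each piece yields boundedly many tiles of bounded size, so the quadratic cost is that of
  the initial pieces.\<close>

lemma computable_sd_tiles:
  "computable (enc_pair enc_complex enc_complex) (enc_tiles enc_simplex) (inputs d) (\<lambda>q. (length (fst q))\<^sup>2)
    (\<lambda>q. sd_tiles d (fst q) (snd q))"
proof -
  let ?m = "Suc d"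
  let ?et = "enc_pair (enc_list enc_simplex) (enc_list (enc_list enc_simplex))"
  have perms: "computable ea enc_complex D b (\<lambda>x. perms ?m (\<sigma> x))"
    if "computable ea enc_simplex D b \<sigma>" "\<And>x. x \<in> D \<Longrightarrow> length (\<sigma> x) \<le> ?m"
    for D b \<sigma> and ea :: "'z \<Rightarrow> val"
    by (rule computable_comp[OF that(1) computable_perms[of ?m]]) (use that(2) in \<open>auto simp: bounded_by_const\<close>)
  have block: "computable enc_piece (enc_list ?et) (small ?m) (\<lambda>_. 0)
      (\<lambda>p. map (sd_tile p) (perms ?m (fst p)))"
  proof (rule computable_map)
    show "computable (enc_pair enc_piece enc_simplex) ?et
        {z. fst z \<in> small ?m \<and> snd z \<in> set (perms ?m (fst (fst z)))} (\<lambda>_. 0) (\<lambda>z. sd_tile (fst z) (snd z))"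
      by (rule computable_subset[OF computable_sd_tile[of ?m]]) (auto dest: length_in_perms)
    show "computable enc_piece enc_complex (small ?m) (\<lambda>_. 0) (\<lambda>p. perms ?m (fst p))"
      by (rule perms computable_fst_id small_lengths(1) | assumption)+
    show "bounded_by (small ?m) (\<lambda>_. 0) (\<lambda>p. length (perms ?m (fst p)))"
      by (rule bounded_by_const[of _ _ "Suc ?m ^ ?m"]) (rule length_perms[OF small_lengths(1)])
  qed
  have "computable (enc_list enc_piece) (enc_list ?et) {ps. set ps \<subseteq> small ?m} length
      (\<lambda>ps. concat (map (\<lambda>p. map (sd_tile p) (perms ?m (fst p))) ps))"
  proof (rule computable_concat[where m = "Suc ?m ^ ?m"])
    show "computable (enc_list enc_piece) (enc_list (enc_list ?et)) {ps. set ps \<subseteq> small ?m} length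
        (\<lambda>ps. map (\<lambda>p. map (sd_tile p) (perms ?m (fst p))) ps)"
    proof (rule computable_map)
      have "computable (enc_pair (enc_list enc_piece) enc_piece) enc_piece
          {z. fst z \<in> {ps. set ps \<subseteq> small ?m} \<and> snd z \<in> set (fst z)} (\<lambda>_. 0) snd"
        by (rule computable_snd_id)
      from computable_comp[OF this block]
      show "computable (enc_pair (enc_list enc_piece) enc_piece) (enc_list ?et)
          {z. fst z \<in> {ps. set ps \<subseteq> small ?m} \<and> snd z \<in> set (fst z)} (\<lambda>_. 0)
          (\<lambda>z. map (sd_tile (snd z)) (perms ?m (fst (snd z))))"
        by (auto simp: bounded_by_const)
    qed (simp_all add: computable_id bounded_by_self)
    show "bounded_by {ps. set ps \<subseteq> small ?m} length
        (\<lambda>ps. length (map (\<lambda>p. map (sd_tile p) (perms ?m (fst p))) ps))"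
      by (simp add: bounded_by_self)
    show "length ts \<le> Suc ?m ^ ?m"
      if ps: "ps \<in> {ps. set ps \<subseteq> small ?m}"
        and ts: "ts \<in> set (map (\<lambda>p. map (sd_tile p) (perms ?m (fst p))) ps)" for ps ts
    proof -
      from ts obtain p where p: "p \<in> set ps" "ts = map (sd_tile p) (perms ?m (fst p))"
        unfolding set_map by blast
      then have "p \<in> small ?m"
        using ps by blast
      then show ?thesis
        using length_perms[OF small_lengths(1), of p ?m ?m] p(2) by (simp only: length_map)
    qed
  qed
  from computable_comp[OF computable_initial_inputs this]
  have "computable (enc_pair enc_complex enc_complex) (enc_list ?et) (inputs d) (\<lambda>q. (length (fst q))\<^sup>2)
      (\<lambda>q. concat (map (\<lambda>p. map (sd_tile p) (perms ?m (fst p))) (initial (snd q) (by_dim d (fst q)))))"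
  proof this
    show "initial (snd q) (by_dim d (fst q)) \<in> {ps. set ps \<subseteq> small ?m}" for q :: "nat list list \<times> nat list list"
      using initial_small[of "by_dim d (fst q)" ?m "snd q"] by (simp add: set_by_dim)
    show "bounded_by (inputs d) (\<lambda>q. (length (fst q))\<^sup>2) (\<lambda>q. length (initial (snd q) (by_dim d (fst q))))"
    proof (rule bounded_byI)
      fix q :: "nat list list \<times> nat list list"
      have "length (initial (snd q) (by_dim d (fst q))) \<le> Suc d * length (fst q)"
        unfolding length_initial by (rule length_by_dim)
      also have "\<dots> \<le> Suc d * Suc ((length (fst q))\<^sup>2)"
        by (rule mult_le_mono2) (cases "length (fst q)"; simp add: power2_eq_square)
      finally show "length (initial (snd q) (by_dim d (fst q))) \<le> Suc d * Suc ((length (fst q))\<^sup>2)" .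
    qed
  qed
  then show ?thesis
    by (simp add: sd_tiles_def enc_tiles_def)
qed

lemma quadratic_time_solvableI:
  assumes f: "computable (enc_pair enc_complex enc_complex) eo (inputs d) (\<lambda>q. (length (fst q))\<^sup>2) f"
    and sol: "\<And>K L xs ys. relative_complex K L \<Longrightarrow> (\<And>\<sigma>. \<sigma> \<in> K \<Longrightarrow> card \<sigma> \<le> d + 1) \<Longrightarrow>
      listing xs K \<Longrightarrow> listing ys L \<Longrightarrow> solution K L (eo (f (xs, ys)))"
  shows "quadratic_time_solvable d solution"
proof -
  obtain P e c where *: "\<And>q. q \<in> inputs d \<Longrightarrow>
      evalb P (enc_pair enc_complex enc_complex q) e (eo (f q)) (c * Suc ((length (fst q))\<^sup>2))"
    using f unfolding computable_def by blast
  \<comment> \<open>The entry point must be function 0, so the expression is placed first and all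
    calls move up by one.\<close>
  let ?Q = "[shift 1 e] @ map (shift 1) P"
  have "\<exists>out t. runs ?Q (Cell (enc_complex xs) (enc_complex ys)) out t \<and>
      t \<le> c * ((card (facets K))\<^sup>2 + 1) \<and> solution K L out"
    if KL: "relative_complex K L" "\<forall>\<sigma>\<in>K. card \<sigma> \<le> d + 1" "presents xs K" "presents ys L" for K L xs ys
  proof -
    have xs: "listing xs K" and ys: "listing ys L"
      using KL by (simp_all add: listing_def presents_def)
    then have "(xs, ys) \<in> inputs d"
      using KL unfolding inputs_def by auto
    from evalb_shift[OF *[OF this], of "[shift 1 e]" "[]"]
    obtain t where t: "t \<le> c * Suc ((length xs)\<^sup>2)"
      "eval_exp ?Q (Cell (enc_complex xs) (enc_complex ys)) (shift 1 e) (eo (f (xs, ys))) t"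
      unfolding evalb_def by auto
    have "runs ?Q (Cell (enc_complex xs) (enc_complex ys)) (eo (f (xs, ys))) t"
      using t(2) by (simp add: runs_def)
    moreover have "t \<le> c * ((card (facets K))\<^sup>2 + 1)"
      using t(1) length_listing[OF xs] by simp
    moreover have "solution K L (eo (f (xs, ys)))"
      using sol[OF KL(1) _ xs ys] KL(2) by blast
    ultimately show ?thesis
      by blast
  qed
  then show ?thesis
    unfolding quadratic_time_solvable_def by blast
qed

lemma exists_dimension:
  assumes "simplicial_complex K"
  shows "\<exists>d. \<forall>\<sigma>\<in>K. card \<sigma> \<le> d + 1"
proof -
  have "finite (card ` K)"
    using assms by (auto simp: simplicial_complex_def)
  then have "card \<sigma> \<le> Max (card ` K) + 1" if "\<sigma> \<in> K" for \<sigma>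
    using that by (simp add: le_SucI)
  then show ?thesis
    by blast
qed

lemma exists_fresh_supply:
  fixes K :: "'v::infinite set set"
  assumes "relative_complex K L"
  shows "\<exists>fr. fresh_supply K L fr 0"
proof -
  have "finite (\<Union>K)"
    using assms by (auto simp: relative_complex_def simplicial_complex_def)
  then have "infinite (UNIV - \<Union>K)"
    using infinite_UNIV by (simp add: Diff_infinite_finite)
  then obtain fr :: "nat \<Rightarrow> 'v" where "inj fr" "range fr \<subseteq> UNIV - \<Union>K"
    using infinite_countable_subset by blast
  then have "fresh_supply K L fr 0"
    using assms by unfold_locales (auto intro: inj_on_subset)
  then show ?thesis
    by blast
qed

theorem theorem1p3:
  shows "(\<forall>K L :: 'v::infinite set set. relative_complex K L \<longrightarrow>
            (\<exists>Ts. morse_shelling (Sd K) (Sd L) Ts) \<and>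
            (\<forall>m. \<exists>steps. subdivision_seq m K steps \<and>
                 (\<exists>Ts. h_shelling (stellar_seq steps K) (stellar_seq steps L) Ts)))
       \<and> (\<forall>d.
            quadratic_time_solvable d (\<lambda>K L out. \<exists>ts.
              out = enc_tiles enc_simplex ts \<and>
              morse_shelling (Sd K) (Sd L) (tiles_of set ts)) \<and>
            (\<forall>m. quadratic_time_solvable d (\<lambda>K L out. \<exists>steps ts.
              out = Cell (enc_steps steps) (enc_tiles Num ts) \<and>
              subdivision_seq m K (steps_of steps) \<and>
              h_shelling (stellar_seq (steps_of steps) K) (stellar_seq (steps_of steps) L)
                (tiles_of id ts))))"
proof (intro conjI allI impI)
  fix K L :: "'v set set"
  assume KL: "relative_complex K L"
  then have "simplicial_complex K" "simplicial_complex L"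
    by (auto simp: relative_complex_def)
  then obtain xs ys where xs: "listing xs K" and ys: "listing ys L"
    using exists_listing by metis
  obtain d where d: "\<And>\<sigma>. \<sigma> \<in> K \<Longrightarrow> card \<sigma> \<le> d + 1"
    using exists_dimension[OF \<open>simplicial_complex K\<close>] by blast
  show "\<exists>Ts. morse_shelling (Sd K) (Sd L) Ts"
    using morse_shelling_Sd[OF KL d xs ys] by blast
  obtain fr where "fresh_supply K L fr 0"
    using exists_fresh_supply[OF KL] by blast
  note sub = fresh_supply.subdivide_reached[OF this d xs ys]
  show "\<exists>steps. subdivision_seq m K steps \<and> (\<exists>Ts. h_shelling (stellar_seq steps K) (stellar_seq steps L) Ts)" for m
    using sub[of m] by blast
next
  fix d
  show "quadratic_time_solvable d (\<lambda>K L out. \<exists>ts.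
      out = enc_tiles enc_simplex ts \<and> morse_shelling (Sd K) (Sd L) (tiles_of set ts))"
    by (rule quadratic_time_solvableI[OF computable_sd_tiles]) (use morse_shelling_Sd in fastforce)
  fix m
  show "quadratic_time_solvable d (\<lambda>K L out. \<exists>steps ts.
      out = Cell (enc_steps steps) (enc_tiles Num ts) \<and>
      subdivision_seq m K (steps_of steps) \<and>
      h_shelling (stellar_seq (steps_of steps) K) (stellar_seq (steps_of steps) L) (tiles_of id ts))"
  proof (rule quadratic_time_solvableI[OF computable_subdivide[of d m]])
    fix K L :: "nat set set" and xs ys :: "nat list list"
    assume KL: "relative_complex K L" and d: "\<And>\<sigma>. \<sigma> \<in> K \<Longrightarrow> card \<sigma> \<le> d + 1"
      and xs: "listing xs K" and ys: "listing ys L"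
    have "(xs, ys) \<in> inputs d"
      using KL d xs ys unfolding inputs_def by auto
    have "fresh_supply K L (\<lambda>n. n) (above xs)"
      by (rule fresh_supply_above[OF KL xs])
    note sub = fresh_supply.subdivide_reached[OF this d xs ys, of m]
    have steps: "set_steps = steps_of"
      by (simp add: set_steps_def steps_of_def)
    show "\<exists>steps ts.
        enc_pair enc_steps (enc_tiles Num)
          (let st = subdivide d m (\<lambda>n. n) (above (fst (xs, ys))) (fst (xs, ys)) (snd (xs, ys))
           in (fst (snd st), map tile_of (fst st))) = Cell (enc_steps steps) (enc_tiles Num ts) \<and>
        subdivision_seq m K (steps_of steps) \<and>
        h_shelling (stellar_seq (steps_of steps) K) (stellar_seq (steps_of steps) L) (tiles_of id ts)"
      using sub unfolding steps Let_def fst_conv snd_conv enc_pair.simps by blast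
  qed
qed

end
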